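(* Let $\Omega$ be an annulus in $\mathbf{R}^2$ with inner boundary curve $\Sigma_1$ and outer boundary curve $\Sigma_2$, with $\Sigma_1$ convex, and suppose $\Omega$ is strictly starlike with respect to $\Sigma_1$. Let $A$ be a closed potential ($1$-form) on $\Omega$ having flux $\Phi^A$ around $\Sigma_1$. Then $$\lambda_1(\Omega,A)\ \geq\ \frac{4\pi^2}{L^2}\,\frac{\beta m}{B}\,d(\Phi^A,\mathbf{Z})^2,$$ where $\beta=\min_{x\in\Sigma_1}r(x)$, $B=\max_{x\in\Sigma_1}r(x)$, $m=\min_{x\in\Sigma_1}\cos\theta_x$, and $L$ is the length of the outer boundary component $\Sigma_2$. If $\Sigma_2$ is also convex, then $m\geq\beta/B$ and the lower bound takes the form $$\lambda_1(\Omega,A)\ \geq\ \frac{4\pi^2}{L^2}\,\frac{\beta^2}{B^2}\,d(\Phi^A,\mathbf{Z})^2.$$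
   Context: Annulus: a compact region $\Omega\subset\mathbf{R}^2$ (with the Euclidean metric) bounded by two disjoint smooth simple closed curves, the inner curve $\Sigma_1$ and the outer curve $\Sigma_2$. "Convex" for a closed curve means that it bounds a convex region. For $x\in\Sigma_1$ let $\gamma_x(t)=x+tN_x$, $t\ge0$, where $N_x$ is the exterior unit normal to $\Sigma_1$ at $x$ (pointing away from the region enclosed by $\Sigma_1$). Let $Q(x)$ be the first intersection of $\gamma_x$ with $\Sigma_2$ and $r(x)=d(x,Q(x))$. $\Omega$ is starlike with respect to $\Sigma_1$ if $x\mapsto Q(x)$ is a bijection between $\Sigma_1$ and $\Sigma_2$; equivalently, for every $y\in\Sigma_2$ the segment minimizing distance from $y$ to $\Sigma_1$ is entirely contained in $\Omega$. Let $\theta_x$ be the angle between $\gamma_x'$ and the outer normal to $\Sigma_2$ at $Q(x)$ (if $\Omega$ is starlike, $\theta_x\in[0,\pi/2]$), and $m=\min_{x\in\Sigma_1}\cos\theta_x$. $\Omega$ is strictly starlike with respect to $\Sigma_1$ if it is starlike with respect to $\Sigma_1$ and $m>0$. Magnetic Laplacian: for a smooth real $1$-form $A$ on $\Omega$ and $u\in C^\infty(\Omega,\mathbf{C})$, $\nabla^A_Xu=\nabla_Xu-iA(X)u$, $\Delta_A=(\nabla^A)^\star\nabla^A$ with magnetic Neumann condition $\nabla^A_Nu=0$ on $\partial\Omega$ ($N$ the inner unit normal). $\lambda_1(\Omega,A)$ is its first eigenvalue: $\lambda_1(\Omega,A)=\min\{\int_\Omega|\nabla^Au|^2/\int_\Omega|u|^2: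 u\in C^1(\Omega,\mathbf{C}),u\ne0\}$. The flux is $\Phi^A=\frac1{2\pi}\oint_{\Sigma_1}A$ (up to sign; the curve is travelled once), and $d(\Phi^A,\mathbf{Z})^2=\min\{(\Phi^A-k)^2:k\in\mathbf{Z}\}$. *)

theory Defs
  imports "HOL-Analysis.Analysis"
begin

text \<open>
  The Euclidean plane is the type \<^typ>\<open>complex\<close>, regarded as a real inner product space
  (the type for which the library proves the Jordan curve theorem). Derivatives below are
  Frechet derivatives over the reals; nothing is assumed holomorphic.
\<close>

subsection \<open>Differentiability classes\<close>

text \<open>
  \<open>Ck_open k f S\<close> is meant for open \<open>S\<close>. In finite dimension, asking that every directional
  derivative be of class \<open>C\<^sup>k\<close> is the same as asking it of the Frechet derivative, and it keeps
  the type of \<open>f\<close> fixed in the recursion.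
\<close>

primrec Ck_open ::
  "nat \<Rightarrow> ('a::euclidean_space \<Rightarrow> 'b::real_normed_vector) \<Rightarrow> 'a set \<Rightarrow> bool" where
  "Ck_open 0 f S \<longleftrightarrow> continuous_on S f"
| "Ck_open (Suc k) f S \<longleftrightarrow>
     (\<forall>x\<in>S. f differentiable (at x)) \<and>
     (\<forall>v. Ck_open k (\<lambda>x. frechet_derivative f (at x) v) S)"

text \<open>On a set that is not open, regularity up to the boundary means extendability to an open
  neighbourhood.\<close>

definition C1_on :: "'a::euclidean_space set \<Rightarrow> ('a \<Rightarrow> 'b::real_normed_vector) \<Rightarrow> bool" where
  "C1_on S f \<longleftrightarrow> (\<exists>U g. open U \<and> S \<subseteq> U \<and> Ck_open 1 g U \<and> (\<forall>x\<in>S. g x = f x))"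

definition smooth_on :: "'a::euclidean_space set \<Rightarrow> ('a \<Rightarrow> 'b::real_normed_vector) \<Rightarrow> bool" where
  "smooth_on S f \<longleftrightarrow> (\<exists>U g. open U \<and> S \<subseteq> U \<and> (\<forall>k. Ck_open k g U) \<and> (\<forall>x\<in>S. g x = f x))"

subsection \<open>Smooth closed curves and annuli\<close>

text \<open>A closed curve is given by a 1-periodic parametrization of the whole real line, so that
  smoothness also holds across the base point; \<^term>\<open>path_image c\<close> is the curve as a set.\<close>

definition smooth_simple_closed_curve :: "(real \<Rightarrow> complex) \<Rightarrow> bool" where
  "smooth_simple_closed_curve c \<longleftrightarrow>
     smooth_on UNIV c \<and> (\<forall>s. c (s + 1) = c s) \<and>
     (\<forall>s. vector_derivative c (at s) \<noteq> 0) \<and> simple_path c"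

definition curve_length :: "(real \<Rightarrow> complex) \<Rightarrow> real" where
  "curve_length c = integral {0..1} (\<lambda>s. norm (vector_derivative c (at s)))"

definition convex_curve :: "(real \<Rightarrow> complex) \<Rightarrow> bool" where
  "convex_curve c \<longleftrightarrow> convex (inside (path_image c))"

text \<open>Unit normal at a point \<open>x\<close> of the curve, pointing away from the enclosed region.\<close>

definition outer_normal :: "(real \<Rightarrow> complex) \<Rightarrow> complex \<Rightarrow> complex" where
  "outer_normal c x = (THE n. norm n = 1 \<and>
     (\<forall>s. c s = x \<longrightarrow> n \<bullet> vector_derivative c (at s) = 0) \<and>
     (\<exists>e>0. \<forall>t\<in>{0<..<e}. x + t *\<^sub>R n \<in> outside (path_image c)))"

text \<open>Throughout, \<open>c1\<close> is the inner and \<open>c2\<close> the outer boundary curve.\<close>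

definition annulus :: "complex set \<Rightarrow> (real \<Rightarrow> complex) \<Rightarrow> (real \<Rightarrow> complex) \<Rightarrow> bool" where
  "annulus \<Omega> c1 c2 \<longleftrightarrow>
     smooth_simple_closed_curve c1 \<and> smooth_simple_closed_curve c2 \<and>
     path_image c1 \<inter> path_image c2 = {} \<and>
     path_image c1 \<subseteq> inside (path_image c2) \<and>
     \<Omega> = (path_image c2 \<union> inside (path_image c2)) - inside (path_image c1)"

subsection \<open>Starlike annuli\<close>

definition normal_ray :: "(real \<Rightarrow> complex) \<Rightarrow> complex \<Rightarrow> real \<Rightarrow> complex" where
  "normal_ray c1 x t = x + t *\<^sub>R outer_normal c1 x"

definition ray_foot :: "(real \<Rightarrow> complex) \<Rightarrow> (real \<Rightarrow> complex) \<Rightarrow> complex \<Rightarrow> complex" where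
  "ray_foot c1 c2 x = normal_ray c1 x (Inf {t. 0 \<le> t \<and> normal_ray c1 x t \<in> path_image c2})"

definition ray_length :: "(real \<Rightarrow> complex) \<Rightarrow> (real \<Rightarrow> complex) \<Rightarrow> complex \<Rightarrow> real" where
  "ray_length c1 c2 x = dist x (ray_foot c1 c2 x)"

definition ray_angle :: "(real \<Rightarrow> complex) \<Rightarrow> (real \<Rightarrow> complex) \<Rightarrow> complex \<Rightarrow> real" where
  "ray_angle c1 c2 x = arccos (outer_normal c1 x \<bullet> outer_normal c2 (ray_foot c1 c2 x))"

definition min_ray :: "(real \<Rightarrow> complex) \<Rightarrow> (real \<Rightarrow> complex) \<Rightarrow> real" where
  "min_ray c1 c2 = (INF x\<in>path_image c1. ray_length c1 c2 x)"

definition max_ray :: "(real \<Rightarrow> complex) \<Rightarrow> (real \<Rightarrow> complex) \<Rightarrow> real" where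
  "max_ray c1 c2 = (SUP x\<in>path_image c1. ray_length c1 c2 x)"

definition min_cos :: "(real \<Rightarrow> complex) \<Rightarrow> (real \<Rightarrow> complex) \<Rightarrow> real" where
  "min_cos c1 c2 = (INF x\<in>path_image c1. cos (ray_angle c1 c2 x))"

definition starlike_annulus :: "(real \<Rightarrow> complex) \<Rightarrow> (real \<Rightarrow> complex) \<Rightarrow> bool" where
  "starlike_annulus c1 c2 \<longleftrightarrow> bij_betw (ray_foot c1 c2) (path_image c1) (path_image c2)"

definition strictly_starlike_annulus :: "(real \<Rightarrow> complex) \<Rightarrow> (real \<Rightarrow> complex) \<Rightarrow> bool" where
  "strictly_starlike_annulus c1 c2 \<longleftrightarrow> starlike_annulus c1 c2 \<and> min_cos c1 c2 > 0"

subsection \<open>Potentials and the first magnetic Neumann eigenvalue\<close>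

definition closed_potential :: "complex set \<Rightarrow> (complex \<Rightarrow> complex \<Rightarrow>\<^sub>L real) \<Rightarrow> bool" where
  "closed_potential \<Omega> A \<longleftrightarrow> smooth_on \<Omega> A \<and>
     (\<forall>p\<in>\<Omega>. \<forall>X Y. blinfun_apply (frechet_derivative A (at p within \<Omega>) X) Y
                  = blinfun_apply (frechet_derivative A (at p within \<Omega>) Y) X)"

definition flux :: "(complex \<Rightarrow> complex \<Rightarrow>\<^sub>L real) \<Rightarrow> (real \<Rightarrow> complex) \<Rightarrow> real" where
  "flux A c = 1 / (2 * pi) *
     integral {0..1} (\<lambda>s. blinfun_apply (A (c s)) (vector_derivative c (at s)))"

definition magnetic_deriv ::
  "complex set \<Rightarrow> (complex \<Rightarrow> complex \<Rightarrow>\<^sub>L real) \<Rightarrow> (complex \<Rightarrow> complex) \<Rightarrow> complex \<Rightarrow> complex \<Rightarrow> complex" where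
  "magnetic_deriv \<Omega> A u p X =
     frechet_derivative u (at p within \<Omega>) X - \<i> * complex_of_real (blinfun_apply (A p) X) * u p"

text \<open>
  The integrals use the completed measure \<^term>\<open>lebesgue\<close>, so that the values of the
  derivative on the boundary (a null set) are immaterial.
\<close>

definition magnetic_energy ::
  "complex set \<Rightarrow> (complex \<Rightarrow> complex \<Rightarrow>\<^sub>L real) \<Rightarrow> (complex \<Rightarrow> complex) \<Rightarrow> real" where
  "magnetic_energy \<Omega> A u = (LINT p:\<Omega>|lebesgue. (\<Sum>e\<in>Basis. (norm (magnetic_deriv \<Omega> A u p e))\<^sup>2))"

text \<open>The infimum of the Rayleigh quotients; it is attained, by a first eigenfunction.\<close>

definition lambda1 :: "complex set \<Rightarrow> (complex \<Rightarrow> complex \<Rightarrow>\<^sub>L real) \<Rightarrow> real" where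
  "lambda1 \<Omega> A =
     Inf {magnetic_energy \<Omega> A u / (LINT p:\<Omega>|lebesgue. (norm (u p))\<^sup>2) | u.
            C1_on \<Omega> u \<and> (\<exists>p\<in>\<Omega>. u p \<noteq> 0)}"

end

theory Submission
  imports Defs
begin

text \<open>
  Write \<open>r\<close> for the length of the normal ray and \<open>N\<close> for the outer unit normal of the convex inner
  curve \<open>\<Sigma>\<^sub>1\<close>. The annulus is swept out by the closed curves
  \<open>\<Sigma>(\<tau>) = {x + \<tau> r(x) N(x) | x \<in> \<Sigma>\<^sub>1}\<close>, \<open>0 \<le> \<tau> \<le> 1\<close>, which run from \<open>\<Sigma>\<^sub>1\<close> to
  \<open>\<Sigma>\<^sub>2\<close>. The two-dimensional Rayleigh quotient is estimated leaf by leaf.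

  On a closed curve of length \<open>l\<close> the magnetic energy is at least
  \<open>(2 \<pi> d(\<Phi>, \<int>) / l)\<^sup>2\<close> times the squared norm, where \<open>\<Phi>\<close> is the flux along that curve
  (\<open>magnetic_wirtinger\<close>). Because the potential is closed, all leaves have the flux of
  \<open>\<Sigma>\<^sub>1\<close> (\<open>leaf_flux_constant\<close>). Because \<open>\<Sigma>\<^sub>1\<close> is convex, its normals spread apart, so the
  velocity of a leaf is \<open>(1 + \<tau> \<kappa>) c1' + \<tau> \<rho> N\<close> with \<open>\<rho> = r'\<close>, where \<open>\<kappa> \<ge> 0\<close> is \<open>r\<close>
  times the curvature of \<open>\<Sigma>\<^sub>1\<close>. Its norm grows with \<open>\<tau>\<close>, and no leaf is longer than \<open>\<Sigma>\<^sub>2\<close>, whose length is \<open>L\<close>.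

  The area element in the coordinates \<open>(\<tau>, s)\<close> is \<open>r cos(\<theta>(\<tau>))\<close> times the length element of the
  leaf, where \<open>\<theta>(\<tau>)\<close> is the angle between the ray and the normal of the leaf. From
  \<open>\<bar>tan(\<theta>(\<tau>))\<bar> = \<bar>\<tau> \<rho>\<bar> / ((1 + \<tau> \<kappa>) \<bar>c1'\<bar>)\<close> one sees that this angle grows with \<open>\<tau>\<close>, so its cosine
  is at least its value \<open>cos \<theta>\<^sub>x \<ge> m\<close> on \<open>\<Sigma>\<^sub>2\<close>. Hence the density lies between \<open>\<beta> m\<close> and \<open>B\<close>
  (\<open>leaf_geometry\<close>). Since only the derivative along the leaf is kept, integrating over \<open>\<tau>\<close> costs
  the factor \<open>\<beta> m / B\<close>.

  For this to make sense one needs that the outer normal of a smooth Jordan curve exists and is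
  unique (\<open>curve_local_sides\<close>), that the normal rays of a convex curve do not meet
  (\<open>normal_ray_unique\<close>), that a starlike annulus is exactly the union of the ray segments
  (\<open>annulus_normal_point\<close>), and that the foot of the ray is a \<open>C\<^sup>1\<close> function of the parameter. The
  last point is where \<open>m > 0\<close> enters: the rays meet \<open>\<Sigma>\<^sub>2\<close> transversally (\<open>transversal\<close>,
  \<open>foot_C1\<close>).

  If \<open>\<Sigma>\<^sub>2\<close> is convex too, every point of \<open>\<Sigma>\<^sub>1\<close> is the centre of a disc of radius \<open>\<beta>\<close> enclosed by
  \<open>\<Sigma>\<^sub>2\<close>. The tangent line of \<open>\<Sigma>\<^sub>2\<close> at the foot of \<open>x\<close> leaves this disc on one side, so its distance
  \<open>r(x) cos \<theta>\<^sub>x\<close> from \<open>x\<close> is at least \<open>\<beta>\<close>, whence \<open>m \<ge> \<beta> / B\<close> (\<open>min_cos_ge_ratio\<close>).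
\<close>

section \<open>The magnetic Wirtinger inequality on a closed curve\<close>

lemma has_vector_derivative_cis:
  assumes "(f has_real_derivative d) (at s within S)"
  shows "((\<lambda>s. cis (f s)) has_vector_derivative d *\<^sub>R (\<i> * cis (f s))) (at s within S)"
  using has_derivative_cis[OF assms[unfolded has_field_derivative_def]]
  by (simp add: has_vector_derivative_def mult_ac)

text \<open>
  Picone's argument: completing the square in \<open>g' - q l g\<close> bounds the integrand below by the
  derivative of \<open>q \<bar>g\<bar>\<^sup>2\<close>, provided \<open>q\<close> solves the Riccati equation \<open>q' = - \<mu>\<^sup>2 l - q\<^sup>2 l\<close>; the
  boundary terms vanish with \<open>g\<close>. The weight \<open>l\<close> is the speed of a curve and takes the place of
  a reparametrization by arc length. The strict bound on \<open>\<mu>\<close> keeps the tangent finite.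
\<close>

lemma dirichlet_wirtinger_below:
  fixes g g' :: "real \<Rightarrow> 'a::real_inner" and l :: "real \<Rightarrow> real"
  assumes g: "\<And>s. s \<in> {0..1} \<Longrightarrow> (g has_vector_derivative g' s) (at s within {0..1})"
    and g': "continuous_on {0..1} g'"
    and l: "continuous_on {0..1} l" "\<And>s. s \<in> {0..1} \<Longrightarrow> 0 < l s"
    and ends: "g 0 = 0" "g 1 = 0"
    and lam: "0 \<le> \<mu>" "\<mu> * integral {0..1} l < pi"
  shows "\<mu>\<^sup>2 * integral {0..1} (\<lambda>s. (norm (g s))\<^sup>2 * l s) \<le> integral {0..1} (\<lambda>s. (norm (g' s))\<^sup>2 / l s)"
proof -
  define L where "L = integral {0..1} l"
  define \<sigma> where "\<sigma> = (\<lambda>s. integral {0..s} l)"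
  \<comment> \<open>centred at half the length, so that the argument stays within \<open>(-\<pi>/2, \<pi>/2)\<close>\<close>
  define q where "q = (\<lambda>s. - \<mu> * tan (\<mu> * (\<sigma> s - L / 2)))"
  have cg: "continuous_on {0..1} g"
    using g by (meson continuous_on_eq_continuous_within has_vector_derivative_continuous)
  have li: "l integrable_on {0..1}" using l(1) integrable_continuous_real by blast
  have \<sigma>d: "(\<sigma> has_vector_derivative l s) (at s within {0..1})" if "s \<in> {0..1}" for s
    unfolding \<sigma>_def using integral_has_vector_derivative[OF l(1) that] .
  have \<sigma>b: "0 \<le> \<sigma> s \<and> \<sigma> s \<le> L" if "s \<in> {0..1}" for s
  proof
    show "0 \<le> \<sigma> s" unfolding \<sigma>_def
      by (rule integral_nonneg, rule integrable_on_subinterval[OF li]) (use that l in \<open>auto intro: less_imp_le\<close>)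
    show "\<sigma> s \<le> L" unfolding \<sigma>_def L_def
      by (rule integral_subset_le[OF _ integrable_on_subinterval[OF li] li]) (use that l in \<open>auto intro: less_imp_le\<close>)
  qed
  have arg: "\<bar>\<mu> * (\<sigma> s - L / 2)\<bar> < pi / 2" if "s \<in> {0..1}" for s
  proof -
    have "\<bar>\<sigma> s - L/2\<bar> \<le> L/2" using \<sigma>b[OF that] by (auto simp: abs_if)
    then have "\<mu> * \<bar>\<sigma> s - L/2\<bar> \<le> \<mu> * (L/2)" using lam(1) mult_left_mono by blast
    then show ?thesis using lam unfolding L_def[symmetric] by (simp add: abs_mult)
  qed
  have cosn: "cos (\<mu> * (\<sigma> s - L / 2)) \<noteq> 0" if "s \<in> {0..1}" for s
    using cos_gt_zero_pi[of "\<mu> * (\<sigma> s - L / 2)"] arg[OF that] by (auto simp: abs_if split: if_splits)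
  have qd: "(q has_vector_derivative (- \<mu>\<^sup>2 * l s - (q s)\<^sup>2 * l s)) (at s within {0..1})" if s: "s \<in> {0..1}" for s
  proof -
    have *: "(\<sigma> has_real_derivative l s) (at s within {0..1})"
      using \<sigma>d[OF s] by (simp add: has_real_derivative_iff_has_vector_derivative)
    let ?x = "\<mu> * (\<sigma> s - L / 2)"
    have "(q has_real_derivative (- \<mu> * (inverse ((cos ?x)\<^sup>2) * (\<mu> * l s)))) (at s within {0..1})"
      unfolding q_def by (rule derivative_eq_intros * cosn[OF s] refl | simp)+
    moreover have "inverse ((cos ?x)\<^sup>2) = 1 + (tan ?x)\<^sup>2"
      using tan_sec[OF cosn[OF s]] by (simp add: power_inverse)
    ultimately have "(q has_real_derivative (- \<mu>\<^sup>2 * l s - (q s)\<^sup>2 * l s)) (at s within {0..1})"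
      by (simp add: q_def algebra_simps power2_eq_square)
    then show ?thesis by (simp add: has_real_derivative_iff_has_vector_derivative)
  qed
  define p where "p = (\<lambda>s. (- \<mu>\<^sup>2 * l s - (q s)\<^sup>2 * l s) * (g s \<bullet> g s) + 2 * q s * (g s \<bullet> g' s))"
  have pd: "((\<lambda>s. q s * (g s \<bullet> g s)) has_vector_derivative p s) (at s within {0..1})" if s: "s \<in> {0..1}" for s
  proof -
    have "((\<lambda>s. g s \<bullet> g s) has_vector_derivative (g s \<bullet> g' s + g' s \<bullet> g s)) (at s within {0..1})"
      by (rule bounded_bilinear.has_vector_derivative[OF bounded_bilinear_inner g[OF s] g[OF s]])
    then have "((\<lambda>s. q s * (g s \<bullet> g s)) has_vector_derivative
      (q s * (g s \<bullet> g' s + g' s \<bullet> g s) + (- \<mu>\<^sup>2 * l s - (q s)\<^sup>2 * l s) * (g s \<bullet> g s))) (at s within {0..1})"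
      using has_vector_derivative_mult[OF qd[OF s]] by blast
    then show ?thesis by (simp add: p_def inner_commute algebra_simps)
  qed
  have p0: "(p has_integral 0) {0..1}"
    using fundamental_theorem_of_calculus[of 0 1, OF _ pd] ends by simp
  have e1: "continuous_on {0..1} (\<lambda>s. (norm (g s))\<^sup>2 * l s)"
    by (intro continuous_intros cg l)
  have e2: "continuous_on {0..1} (\<lambda>s. (norm (g' s))\<^sup>2 / l s)"
    by (intro continuous_intros g' l) (use l in force)
  have "integral {0..1} p \<le> integral {0..1} (\<lambda>s. (norm (g' s))\<^sup>2 / l s - \<mu>\<^sup>2 * ((norm (g s))\<^sup>2 * l s))"
  proof (rule integral_le)
    show "p integrable_on {0..1}" using p0 by blast
    show "(\<lambda>s. (norm (g' s))\<^sup>2 / l s - \<mu>\<^sup>2 * ((norm (g s))\<^sup>2 * l s)) integrable_on {0..1}"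
      by (intro integrable_continuous_real continuous_intros e1 e2)
    fix s :: real assume s: "s \<in> {0..1}"
    then have ls: "0 < l s" using l by blast
    have "0 \<le> (norm (g' s - (q s * l s) *\<^sub>R g s))\<^sup>2 / l s" using ls by simp
    also have "(norm (g' s - (q s * l s) *\<^sub>R g s))\<^sup>2 = (g' s - (q s * l s) *\<^sub>R g s) \<bullet> (g' s - (q s * l s) *\<^sub>R g s)"
      by (simp add: power2_norm_eq_inner)
    also have "\<dots> = g' s \<bullet> g' s - 2 * (q s * l s) * (g s \<bullet> g' s) + (q s * l s)\<^sup>2 * (g s \<bullet> g s)"
      by (simp add: inner_diff_left inner_diff_right inner_commute power2_eq_square)
    also have "\<dots> / l s = (norm (g' s))\<^sup>2 / l s - 2 * q s * (g s \<bullet> g' s) + (q s)\<^sup>2 * l s * (g s \<bullet> g s)"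
      using ls by (simp add: dot_square_norm field_simps power2_eq_square)
    finally show "p s \<le> (norm (g' s))\<^sup>2 / l s - \<mu>\<^sup>2 * ((norm (g s))\<^sup>2 * l s)"
      by (simp add: p_def power2_norm_eq_inner algebra_simps)
  qed
  also have "\<dots> = integral {0..1} (\<lambda>s. (norm (g' s))\<^sup>2 / l s) - \<mu>\<^sup>2 * integral {0..1} (\<lambda>s. (norm (g s))\<^sup>2 * l s)"
    using e1 e2 by (subst integral_diff) (auto intro!: integrable_continuous_real continuous_intros)
  finally show ?thesis using p0 by (simp add: integral_unique)
qed

lemma integral_pos_continuous:
  fixes l :: "real \<Rightarrow> real"
  assumes "continuous_on {0..1} l" "\<And>s. s \<in> {0..1} \<Longrightarrow> 0 < l s"
  shows "0 < integral {0..1} l"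
proof -
  have "0 \<le> integral {0..1} l"
    using assms(1) less_imp_le[OF assms(2)] by (intro integral_nonneg integrable_continuous_real)
  moreover have "integral {0..1} l \<noteq> 0"
  proof
    assume "integral {0..1} l = 0"
    then have "l 0 = 0"
      using integral_eq_0_iff[of 0 1 l] assms(1) less_imp_le[OF assms(2)] by simp
    then show False using assms(2)[of 0] by simp
  qed
  ultimately show ?thesis by simp
qed

text \<open>
  The limit case \<open>\<bar>\<mu>\<bar> L = \<pi>\<close> is reached by letting \<open>c\<close> tend to \<open>1\<close> in \<open>c \<bar>\<mu>\<bar>\<close>. It is needed
  below when the flux is a half-integer.
\<close>

lemma dirichlet_wirtinger:
  fixes g g' :: "real \<Rightarrow> 'a::real_inner" and l :: "real \<Rightarrow> real"
  assumes g: "\<And>s. s \<in> {0..1} \<Longrightarrow> (g has_vector_derivative g' s) (at s within {0..1})"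
    and g': "continuous_on {0..1} g'"
    and l: "continuous_on {0..1} l" "\<And>s. s \<in> {0..1} \<Longrightarrow> 0 < l s"
    and ends: "g 0 = 0" "g 1 = 0"
    and lam: "\<bar>\<mu>\<bar> * integral {0..1} l \<le> pi"
  shows "\<mu>\<^sup>2 * integral {0..1} (\<lambda>s. (norm (g s))\<^sup>2 * l s) \<le> integral {0..1} (\<lambda>s. (norm (g' s))\<^sup>2 / l s)"
    (is "_ * ?I \<le> ?E")
proof -
  have Lp: "0 < integral {0..1} l" using l by (rule integral_pos_continuous)
  have below: "(c * \<bar>\<mu>\<bar>)\<^sup>2 * ?I \<le> ?E" if "c \<in> {0<..<1}" for c
  proof (cases "\<mu> = 0")
    case True
    have "0 \<le> ?E"
      by (rule integral_nonneg) (use g' l in \<open>force intro!: integrable_continuous_real continuous_intros intro: less_imp_le\<close>)+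
    then show ?thesis using True by simp
  next
    case False
    have "c * (\<bar>\<mu>\<bar> * integral {0..1} l) < 1 * (\<bar>\<mu>\<bar> * integral {0..1} l)"
      using that False Lp by (intro mult_strict_right_mono) auto
    then show ?thesis
      by (intro dirichlet_wirtinger_below g g' l ends) (use that lam in \<open>auto simp: mult.assoc\<close>)
  qed
  have "((\<lambda>c. (c * \<bar>\<mu>\<bar>)\<^sup>2 * ?I) \<longlongrightarrow> (1 * \<bar>\<mu>\<bar>)\<^sup>2 * ?I) (at_left 1)"
    by (intro tendsto_intros)
  moreover have "\<forall>\<^sub>F c in at_left 1. (c * \<bar>\<mu>\<bar>)\<^sup>2 * ?I \<le> ?E"
    by (rule eventually_mono[OF eventually_at_left_real[of 0 1]]) (use below in auto)
  ultimately show ?thesis using tendsto_upperbound[OF _ _ trivial_limit_at_left_real] by fastforce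
qed

text \<open>
  Subtracting the minimizer \<open>h(s) = w(0) exp(i \<theta> \<sigma>(s) / L)\<close>, with \<open>\<sigma>\<close> the arc length, leaves a
  function \<open>g\<close> that vanishes at both ends. The quadratic form \<open>\<integral>\<bar>w'\<bar>\<^sup>2/l - \<mu>\<^sup>2 \<integral>\<bar>w\<bar>\<^sup>2 l\<close> vanishes on \<open>h\<close>, and its mixed term is the
  integral of a derivative with zero boundary values, because \<open>h\<close> satisfies the Euler-Lagrange
  equation. So the form has the same value on \<open>w\<close> as on \<open>g\<close>, where it is nonnegative since
  \<open>\<bar>\<theta>\<bar> \<le> \<pi>\<close>.
\<close>

lemma quasiperiodic_wirtinger:
  fixes w w' :: "real \<Rightarrow> complex" and l :: "real \<Rightarrow> real"
  assumes w: "\<And>s. s \<in> {0..1} \<Longrightarrow> (w has_vector_derivative w' s) (at s within {0..1})"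
    and w': "continuous_on {0..1} w'"
    and l: "continuous_on {0..1} l" "\<And>s. s \<in> {0..1} \<Longrightarrow> 0 < l s"
    and qp: "w 1 = cis \<theta> * w 0" and th: "\<bar>\<theta>\<bar> \<le> pi"
  shows "(\<theta> / integral {0..1} l)\<^sup>2 * integral {0..1} (\<lambda>s. (norm (w s))\<^sup>2 * l s)
       \<le> integral {0..1} (\<lambda>s. (norm (w' s))\<^sup>2 / l s)"
proof -
  define L where "L = integral {0..1} l"
  have Lp: "0 < L" unfolding L_def using l by (rule integral_pos_continuous)
  define \<sigma> where "\<sigma> = (\<lambda>s. integral {0..s} l)"
  define \<mu> where "\<mu> = \<theta> / L"
  define h where "h = (\<lambda>s. w 0 * cis (\<mu> * \<sigma> s))"
  define h' where "h' = (\<lambda>s. \<i> * (\<mu> * l s) * h s)"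
  have cw: "continuous_on {0..1} w"
    using w by (meson continuous_on_eq_continuous_within has_vector_derivative_continuous)
  have \<sigma>d: "(\<sigma> has_vector_derivative l s) (at s within {0..1})" if "s \<in> {0..1}" for s
    unfolding \<sigma>_def using integral_has_vector_derivative[OF l(1) that] .
  have hd: "(h has_vector_derivative h' s) (at s within {0..1})" if s: "s \<in> {0..1}" for s
  proof -
    have *: "(\<sigma> has_real_derivative l s) (at s within {0..1})"
      using \<sigma>d[OF s] by (simp add: has_real_derivative_iff_has_vector_derivative)
    have "((\<lambda>s. \<mu> * \<sigma> s) has_real_derivative \<mu> * l s) (at s within {0..1})"
      using DERIV_cmult[OF *] .
    then have "((\<lambda>s. cis (\<mu> * \<sigma> s)) has_vector_derivative (\<mu> * l s) *\<^sub>R (\<i> * cis (\<mu> * \<sigma> s))) (at s within {0..1})"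
      by (rule has_vector_derivative_cis)
    from bounded_linear.has_vector_derivative[OF bounded_linear_mult_right[of "w 0"] this]
    show ?thesis by (simp add: h_def h'_def scaleR_conv_of_real mult_ac)
  qed
  have ch: "continuous_on {0..1} h"
    using hd by (meson continuous_on_eq_continuous_within has_vector_derivative_continuous)
  have ch': "continuous_on {0..1} h'" unfolding h'_def by (intro continuous_intros ch l)
  define g where "g = (\<lambda>s. w s - h s)"
  define g' where "g' = (\<lambda>s. w' s - h' s)"
  have gd: "(g has_vector_derivative g' s) (at s within {0..1})" if s: "s \<in> {0..1}" for s
    unfolding g_def g'_def using w[OF s] hd[OF s] by (rule has_vector_derivative_diff)
  have cg: "continuous_on {0..1} g" "continuous_on {0..1} g'"
    unfolding g_def g'_def by (intro continuous_intros cw w' ch ch')+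
  have \<sigma>01: "\<sigma> 0 = 0" "\<sigma> 1 = L" by (auto simp: \<sigma>_def L_def)
  have ends: "g 0 = 0" "g 1 = 0"
    using Lp by (auto simp: g_def h_def \<sigma>01 qp \<mu>_def mult_ac)
  \<comment> \<open>the derivative of \<open>2 (i \<mu> h) \<bullet> g\<close>, where \<open>i \<mu> h = h' / l\<close>: the mixed terms\<close>
  define p where "p = (\<lambda>s. 2 * ((\<i> * \<mu> * h' s) \<bullet> g s + (\<i> * \<mu> * h s) \<bullet> g' s))"
  have pd: "((\<lambda>s. 2 * ((\<i> * \<mu> * h s) \<bullet> g s)) has_vector_derivative p s) (at s within {0..1})" if s: "s \<in> {0..1}" for s
  proof -
    have "((\<lambda>s. \<i> * \<mu> * h s) has_vector_derivative \<i> * \<mu> * h' s) (at s within {0..1})"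
      by (rule bounded_linear.has_vector_derivative[OF bounded_linear_mult_right hd[OF s]])
    from bounded_bilinear.has_vector_derivative[OF bounded_bilinear_inner this gd[OF s]]
    have "((\<lambda>s. (\<i> * \<mu> * h s) \<bullet> g s) has_vector_derivative
      (\<i> * \<mu> * h s) \<bullet> g' s + (\<i> * \<mu> * h' s) \<bullet> g s) (at s within {0..1})" .
    from bounded_linear.has_vector_derivative[OF bounded_linear_mult_right[of 2] this]
    show ?thesis by (simp add: p_def algebra_simps)
  qed
  have p0: "(p has_integral 0) {0..1}"
    using fundamental_theorem_of_calculus[of 0 1, OF _ pd] ends by simp
  have e: "continuous_on {0..1} (\<lambda>s. (norm (g s))\<^sup>2 * l s)" "continuous_on {0..1} (\<lambda>s. (norm (w s))\<^sup>2 * l s)"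
      "continuous_on {0..1} (\<lambda>s. (norm (g' s))\<^sup>2 / l s)" "continuous_on {0..1} (\<lambda>s. (norm (w' s))\<^sup>2 / l s)"
    by (intro continuous_intros cg l cw w'; use l in force)+
  have "integral {0..1} (\<lambda>s. (norm (w' s))\<^sup>2 / l s - \<mu>\<^sup>2 * ((norm (w s))\<^sup>2 * l s))
      = integral {0..1} (\<lambda>s. ((norm (g' s))\<^sup>2 / l s - \<mu>\<^sup>2 * ((norm (g s))\<^sup>2 * l s)) + p s)"
  proof (rule integral_cong)
    fix s :: real assume s: "s \<in> {0..1}"
    then have ls: "0 < l s" using l by blast
    have W: "w s = g s + h s" "w' s = g' s + h' s" by (auto simp: g_def g'_def)
    have 1: "(norm (h' s))\<^sup>2 / l s = \<mu>\<^sup>2 * ((norm (h s))\<^sup>2 * l s)"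
      using ls by (simp add: h'_def norm_mult power_mult_distrib power2_eq_square)
    have 2: "(norm (w s))\<^sup>2 = (norm (g s))\<^sup>2 + (norm (h s))\<^sup>2 + 2 * (h s \<bullet> g s)" for s
      unfolding g_def by (simp add: power2_norm_eq_inner inner_diff_left inner_diff_right inner_commute)
    have 3: "(norm (w' s))\<^sup>2 = (norm (g' s))\<^sup>2 + (norm (h' s))\<^sup>2 + 2 * (h' s \<bullet> g' s)" for s
      unfolding g'_def by (simp add: power2_norm_eq_inner inner_diff_left inner_diff_right inner_commute)
    have 4: "(\<i> * \<mu> * h' s) \<bullet> g s = - (\<mu>\<^sup>2 * l s * (h s \<bullet> g s))"
    proof -
      have "\<i> * \<mu> * h' s = (- (\<mu>\<^sup>2 * l s)) *\<^sub>R h s"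
        by (simp add: h'_def complex_eq_iff power2_eq_square)
      then show ?thesis by simp
    qed
    have 5: "(h' s \<bullet> g' s) = l s * ((\<i> * \<mu> * h s) \<bullet> g' s)"
    proof -
      have "h' s = l s *\<^sub>R (\<i> * \<mu> * h s)" by (simp add: h'_def scaleR_conv_of_real)
      then show ?thesis by simp
    qed
    show "(norm (w' s))\<^sup>2 / l s - \<mu>\<^sup>2 * ((norm (w s))\<^sup>2 * l s)
      = ((norm (g' s))\<^sup>2 / l s - \<mu>\<^sup>2 * ((norm (g s))\<^sup>2 * l s)) + p s"
      unfolding 2 3 p_def 4 using 1 ls by (simp add: 5 add_divide_distrib algebra_simps)
  qed
  also have "\<dots> = integral {0..1} (\<lambda>s. (norm (g' s))\<^sup>2 / l s - \<mu>\<^sup>2 * ((norm (g s))\<^sup>2 * l s)) + integral {0..1} p"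
    by (rule integral_add[OF _ has_integral_integrable[OF p0]])
      (auto intro!: integrable_continuous_real continuous_on_diff continuous_on_mult_left e)
  also have "\<dots> = integral {0..1} (\<lambda>s. (norm (g' s))\<^sup>2 / l s) - \<mu>\<^sup>2 * integral {0..1} (\<lambda>s. (norm (g s))\<^sup>2 * l s)"
    using p0 by (subst integral_diff) (auto intro!: integrable_continuous_real continuous_on_mult_left e simp: integral_unique)
  also have "\<dots> \<ge> 0"
    using dirichlet_wirtinger[OF gd cg(2) l ends, of \<mu>] th Lp by (simp add: \<mu>_def L_def abs_mult)
  also have "integral {0..1} (\<lambda>s. (norm (w' s))\<^sup>2 / l s - \<mu>\<^sup>2 * ((norm (w s))\<^sup>2 * l s))
     = integral {0..1} (\<lambda>s. (norm (w' s))\<^sup>2 / l s) - \<mu>\<^sup>2 * integral {0..1} (\<lambda>s. (norm (w s))\<^sup>2 * l s)"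
    using e by (subst integral_diff) (auto intro!: integrable_continuous_real continuous_intros)
  finally show ?thesis by (simp add: \<mu>_def L_def)
qed

text \<open>
  The gauge factor \<open>exp(-i \<integral>a)\<close> removes the potential and makes the periodic function \<open>v\<close>
  quasi-periodic with phase \<open>- 2 \<pi> \<Phi>\<close>. Phases matter only modulo \<open>2 \<pi>\<close>, so \<open>\<Phi>\<close> may be reduced by
  the nearest integer.
\<close>

lemma magnetic_wirtinger:
  fixes v v' :: "real \<Rightarrow> complex" and l a :: "real \<Rightarrow> real"
  assumes v: "\<And>s. s \<in> {0..1} \<Longrightarrow> (v has_vector_derivative v' s) (at s within {0..1})"
    and v': "continuous_on {0..1} v'"
    and l: "continuous_on {0..1} l" "\<And>s. s \<in> {0..1} \<Longrightarrow> 0 < l s"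
    and a: "continuous_on {0..1} a"
    and per: "v 1 = v 0"
    and L: "integral {0..1} l \<le> L"
  shows "4 * pi\<^sup>2 / L\<^sup>2 * (infdist (1 / (2 * pi) * integral {0..1} a) \<int>)\<^sup>2 * integral {0..1} (\<lambda>s. (norm (v s))\<^sup>2 * l s)
       \<le> integral {0..1} (\<lambda>s. (norm (v' s - \<i> * complex_of_real (a s) * v s))\<^sup>2 / l s)"
proof -
  define \<Phi> where "\<Phi> = 1 / (2 * pi) * integral {0..1} a"
  define \<theta> where "\<theta> = 2 * pi * (of_int (round \<Phi>) - \<Phi>)"
  define al where "al = (\<lambda>s. integral {0..s} a)"
  define w where "w = (\<lambda>s. v s * cis (- al s))"
  define w' where "w' = (\<lambda>s. (v' s - \<i> * complex_of_real (a s) * v s) * cis (- al s))"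
  have Lp: "0 < integral {0..1} l" using l by (rule integral_pos_continuous)
  have cv: "continuous_on {0..1} v"
    using v by (meson continuous_on_eq_continuous_within has_vector_derivative_continuous)
  have ald: "(al has_vector_derivative a s) (at s within {0..1})" if "s \<in> {0..1}" for s
    unfolding al_def using integral_has_vector_derivative[OF a that] .
  have cal: "continuous_on {0..1} al"
    using ald by (meson continuous_on_eq_continuous_within has_vector_derivative_continuous)
  have wd: "(w has_vector_derivative w' s) (at s within {0..1})" if s: "s \<in> {0..1}" for s
  proof -
    have *: "(al has_real_derivative a s) (at s within {0..1})"
      using ald[OF s] by (simp add: has_real_derivative_iff_has_vector_derivative)
    have "((\<lambda>s. - al s) has_real_derivative - a s) (at s within {0..1})"
      using DERIV_minus[OF *] .
    then have "((\<lambda>s. cis (- al s)) has_vector_derivative (- a s) *\<^sub>R (\<i> * cis (- al s))) (at s within {0..1})"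
      by (rule has_vector_derivative_cis)
    from has_vector_derivative_mult[OF v[OF s] this]
    show ?thesis by (simp add: w_def w'_def scaleR_conv_of_real algebra_simps)
  qed
  have ccis: "continuous_on {0..1} (\<lambda>s. cis (- al s))"
    unfolding cis_conv_exp by (intro continuous_intros cal)
  have cw': "continuous_on {0..1} w'" unfolding w'_def
    by (intro continuous_intros cv v' a ccis)
  have qp: "w 1 = cis \<theta> * w 0"
  proof -
    have "al 1 = 2 * pi * \<Phi>" by (simp add: al_def \<Phi>_def)
    then have "\<theta> = 2 * pi * of_int (round \<Phi>) + (- al 1)" by (simp add: \<theta>_def algebra_simps)
    then have "cis \<theta> = cis (2 * pi * of_int (round \<Phi>)) * cis (- al 1)" by (simp only: cis_mult)
    moreover have "cis (2 * pi * of_int (round \<Phi>)) = 1" by (rule cis_multiple_2pi) simp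
    ultimately show ?thesis using per by (simp add: w_def al_def)
  qed
  have "\<bar>of_int (round \<Phi>) - \<Phi>\<bar> \<le> 1/2" by (rule of_int_round_abs_le)
  then have "2 * pi * \<bar>of_int (round \<Phi>) - \<Phi>\<bar> \<le> 2 * pi * (1/2)" by (intro mult_left_mono) auto
  then have th: "\<bar>\<theta>\<bar> \<le> pi" by (simp add: \<theta>_def abs_mult)
  have "infdist \<Phi> \<int> \<le> dist \<Phi> (of_int (round \<Phi>))" by (rule infdist_le) auto
  then have "2 * pi * infdist \<Phi> \<int> \<le> 2 * pi * \<bar>of_int (round \<Phi>) - \<Phi>\<bar>"
    by (intro mult_left_mono) (auto simp: dist_real_def)
  then have d: "2 * pi * infdist \<Phi> \<int> \<le> \<bar>\<theta>\<bar>" by (simp add: \<theta>_def abs_mult)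
  have "4 * pi\<^sup>2 / L\<^sup>2 * (infdist \<Phi> \<int>)\<^sup>2 = (2 * pi * infdist \<Phi> \<int> / L)\<^sup>2"
    by (simp add: power_mult_distrib power_divide)
  also have "\<dots> \<le> (\<bar>\<theta>\<bar> / integral {0..1} l)\<^sup>2"
    using d L Lp by (intro power_mono frac_le) (auto simp: infdist_nonneg)
  finally have c: "4 * pi\<^sup>2 / L\<^sup>2 * (infdist \<Phi> \<int>)\<^sup>2 \<le> (\<theta> / integral {0..1} l)\<^sup>2"
    by (simp add: power_divide)
  have I: "0 \<le> integral {0..1} (\<lambda>s. (norm (v s))\<^sup>2 * l s)"
    by (rule integral_nonneg) (use cv l in \<open>auto intro!: integrable_continuous_real continuous_intros mult_nonneg_nonneg intro: less_imp_le\<close>)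
  show ?thesis
    using quasiperiodic_wirtinger[OF wd cw' l qp th] mult_right_mono[OF c I]
    by (simp add: \<Phi>_def w_def w'_def norm_mult)
qed

section \<open>The flux of a closed potential along a family of closed curves\<close>

lemma has_vector_derivative_compose_has_derivative:
  assumes "(f has_vector_derivative f') (at s within S)" "(g has_derivative g') (at (f s))"
  shows "((\<lambda>s. g (f s)) has_vector_derivative g' f') (at s within S)"
proof -
  have "((g \<circ> f) has_derivative (g' \<circ> (\<lambda>h. h *\<^sub>R f'))) (at s within S)"
    using assms by (intro diff_chain_within) (auto simp: has_vector_derivative_def intro: has_derivative_at_withinI)
  moreover have "linear g'" using assms(2) has_derivative_linear by blast
  ultimately show ?thesis by (simp add: has_vector_derivative_def o_def linear_scale)
qed

lemma complex_linear_expand: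
  fixes f :: "complex \<Rightarrow> 'b::real_vector"
  assumes "linear f" shows "f v = Re v *\<^sub>R f 1 + Im v *\<^sub>R f \<i>"
proof -
  have "v = Re v *\<^sub>R 1 + Im v *\<^sub>R \<i>" by (simp add: complex_eq_iff)
  then have "f v = f (Re v *\<^sub>R 1 + Im v *\<^sub>R \<i>)" by simp
  then show ?thesis using assms by (simp add: linear_add linear_scale)
qed

text \<open>
  The hypothesis gives continuity of each directional derivative separately; linearity in the
  direction yields joint continuity.
\<close>

lemma continuous_on_directional_derivative:
  fixes D :: "complex \<Rightarrow> complex \<Rightarrow> 'b::real_normed_vector"
  assumes "\<And>p. p \<in> U \<Longrightarrow> (g has_derivative D p) (at p)" "\<And>v. continuous_on U (\<lambda>p. D p v)"
    and "continuous_on S f" "continuous_on S X" "f ` S \<subseteq> U"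
  shows "continuous_on S (\<lambda>z. D (f z) (X z))"
proof -
  have 1: "continuous_on S (\<lambda>z. D (f z) v)" for v
    using continuous_on_compose2[OF assms(2) assms(3)] assms(5) by blast
  have "continuous_on S (\<lambda>z. Re (X z) *\<^sub>R D (f z) 1 + Im (X z) *\<^sub>R D (f z) \<i>)"
    by (intro continuous_intros 1 assms)
  then show ?thesis
    by (rule continuous_on_cong[THEN iffD1, rotated -1])
       (use assms(1,5) has_derivative_linear complex_linear_expand in \<open>metis image_subset_iff\<close>)+
qed

lemma Ck_open_1D:
  fixes g :: "complex \<Rightarrow> 'b::real_normed_vector"
  assumes "Ck_open 1 g U"
  shows "\<And>p. p \<in> U \<Longrightarrow> (g has_derivative frechet_derivative g (at p)) (at p)"
    and "\<And>v. continuous_on U (\<lambda>p. frechet_derivative g (at p) v)"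
    and "continuous_on U g"
proof -
  show *: "\<And>p. p \<in> U \<Longrightarrow> (g has_derivative frechet_derivative g (at p)) (at p)"
    using assms by (auto simp: frechet_derivative_works)
  show "\<And>v. continuous_on U (\<lambda>p. frechet_derivative g (at p) v)" using assms by simp
  show "continuous_on U g" 
    using * by (meson continuous_at_imp_continuous_on has_derivative_continuous)
qed

text \<open>
  Differentiating under the integral sign in \<open>\<tau>\<close>, the symmetry of the derivative of \<open>G\<close> turns the
  integrand into the \<open>s\<close>-derivative of \<open>G(R)\<close>, whose integral over a period is zero. A
  closed potential on the annulus passes this symmetry on to an extension \<open>G\<close> at interior points, i.e.
  for \<open>0 < \<tau> < 1\<close>; continuity in \<open>\<tau>\<close> covers the boundary curves.
\<close>

lemma leaf_flux_constant:
  fixes G :: "complex \<Rightarrow> complex \<Rightarrow>\<^sub>L real" and c R c' R' :: "real \<Rightarrow> complex"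
  assumes G: "\<And>p. p \<in> U \<Longrightarrow> (G has_derivative DG p) (at p)" "\<And>v. continuous_on U (\<lambda>p. DG p v)"
    and c: "\<And>s. (c has_vector_derivative c' s) (at s)" "continuous_on UNIV c'" 
    and R: "\<And>s. (R has_vector_derivative R' s) (at s)" "continuous_on UNIV R'" 
    and per: "c 1 = c 0" "R 1 = R 0"
    and sub: "\<And>s \<tau>. s \<in> {0..1} \<Longrightarrow> \<tau> \<in> {0..1} \<Longrightarrow> c s + \<tau> *\<^sub>R R s \<in> U"
    and sym: "\<And>s \<tau> X Y. s \<in> {0..1} \<Longrightarrow> \<tau> \<in> {0<..<1} \<Longrightarrow>
        blinfun_apply (DG (c s + \<tau> *\<^sub>R R s) X) Y = blinfun_apply (DG (c s + \<tau> *\<^sub>R R s) Y) X"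
    and \<tau>: "\<tau> \<in> {0..1}"
  shows "integral {0..1} (\<lambda>s. blinfun_apply (G (c s + \<tau> *\<^sub>R R s)) (c' s + \<tau> *\<^sub>R R' s))
       = integral {0..1} (\<lambda>s. blinfun_apply (G (c s)) (c' s))"
proof -
  define f where "f = (\<lambda>\<tau> s. blinfun_apply (G (c s + \<tau> *\<^sub>R R s)) (c' s + \<tau> *\<^sub>R R' s))"
  define fx where "fx = (\<lambda>\<tau> s. blinfun_apply (G (c s + \<tau> *\<^sub>R R s)) (R' s)
        + blinfun_apply (DG (c s + \<tau> *\<^sub>R R s) (R s)) (c' s + \<tau> *\<^sub>R R' s))"
  let ?S = "{0..1} \<times> {0..1::real}"
  have cG: "continuous_on U G" 
    using G(1) by (meson continuous_at_imp_continuous_on has_derivative_continuous)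
  have cc: "continuous_on UNIV c" "continuous_on UNIV R"
    using c(1) R(1) by (meson continuous_at_imp_continuous_on has_vector_derivative_continuous)+
  have k: "continuous_on S (\<lambda>z. h (snd z))" if "continuous_on UNIV h" for h :: "real \<Rightarrow> complex" and S :: "(real \<times> real) set"
    using continuous_on_compose2[OF that, of S snd] by (simp add: continuous_on_snd)
  have cF: "continuous_on ?S (\<lambda>z. c (snd z) + fst z *\<^sub>R R (snd z))"
    by (intro continuous_intros k cc)
  have FU: "(\<lambda>z. c (snd z) + fst z *\<^sub>R R (snd z)) ` ?S \<subseteq> U" using sub by auto
  have cGF: "continuous_on ?S (\<lambda>z. G (c (snd z) + fst z *\<^sub>R R (snd z)))"
    using continuous_on_compose2[OF cG cF FU] .
  have cont_f: "continuous_on ?S (\<lambda>(\<tau>, s). f \<tau> s)"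
    unfolding f_def case_prod_beta by (intro continuous_intros cGF k c(2) R(2))
  have cont_fx: "continuous_on ?S (\<lambda>(\<tau>, s). fx \<tau> s)"
    unfolding fx_def case_prod_beta
    by (intro continuous_intros cGF k cc c(2) R(2) continuous_on_directional_derivative[OF G cF _ FU])
  have cont_I: "continuous_on {0..1} (\<lambda>\<tau>. integral {0..1} (f \<tau>))"
    using integral_continuous_on_param[of "{0..1}" 0 1 f] cont_f by simp
  have zero: "((\<lambda>\<tau>. integral {0..1} (f \<tau>)) has_real_derivative 0) (at t)" if t: "t \<in> {0<..<1}" for t
  proof -
    have "((\<lambda>\<tau>. integral (cbox 0 1) (f \<tau>)) has_vector_derivative integral (cbox 0 1) (fx t)) (at t within {0<..<1})"
    proof (rule leibniz_rule_vector_derivative)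
      fix x s :: real assume xs: "x \<in> {0<..<1}" "s \<in> cbox 0 1"
      have "((\<lambda>\<tau>. c s + \<tau> *\<^sub>R R s) has_vector_derivative R s) (at x within {0<..<1})"
        by (auto intro!: derivative_eq_intros simp: has_vector_derivative_def)
      moreover have "(G has_derivative DG (c s + x *\<^sub>R R s)) (at (c s + x *\<^sub>R R s))"
        using G(1) sub xs by auto
      ultimately have 1: "((\<lambda>\<tau>. G (c s + \<tau> *\<^sub>R R s)) has_vector_derivative DG (c s + x *\<^sub>R R s) (R s)) (at x within {0<..<1})"
        by (rule has_vector_derivative_compose_has_derivative)
      have 2: "((\<lambda>\<tau>. c' s + \<tau> *\<^sub>R R' s) has_vector_derivative R' s) (at x within {0<..<1})"
        by (auto intro!: derivative_eq_intros simp: has_vector_derivative_def)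
      show "((\<lambda>\<tau>. f \<tau> s) has_vector_derivative fx x s) (at x within {0<..<1})"
        unfolding f_def fx_def
        by (rule bounded_bilinear.has_vector_derivative[OF bounded_bilinear_blinfun_apply 1 2])
    next
      fix x :: real assume "x \<in> {0<..<1}"
      then show "f x integrable_on cbox 0 1"
        using continuous_on_compose2[OF cont_f, of "{0..1}" "\<lambda>s. (x, s)"]
        by (simp add: integrable_continuous_real continuous_on_Pair image_subset_iff)
    next
      show "continuous_on ({0<..<1} \<times> cbox 0 1) (\<lambda>(x, t). fx x t)"
        using cont_fx by (rule continuous_on_subset) auto
    qed (use t in auto)
    moreover have "(fx t has_integral 0) {0..1}"
    proof -
      have "((\<lambda>s. blinfun_apply (G (c s + t *\<^sub>R R s)) (R s)) has_vector_derivative fx t s) (at s within {0..1})"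
        if s: "s \<in> {0..1}" for s
      proof -
        have a: "((\<lambda>s. c s + t *\<^sub>R R s) has_vector_derivative c' s + t *\<^sub>R R' s) (at s within {0..1})"
          by (auto intro!: derivative_eq_intros has_vector_derivative_at_within[OF c(1)] has_vector_derivative_at_within[OF R(1)])
        have "(G has_derivative DG (c s + t *\<^sub>R R s)) (at (c s + t *\<^sub>R R s))"
          using G(1) sub s t by auto
        from has_vector_derivative_compose_has_derivative[OF a this]
        have "((\<lambda>s. blinfun_apply (G (c s + t *\<^sub>R R s)) (R s)) has_vector_derivative
           blinfun_apply (G (c s + t *\<^sub>R R s)) (R' s) + blinfun_apply (DG (c s + t *\<^sub>R R s) (c' s + t *\<^sub>R R' s)) (R s)) (at s within {0..1})"
          by (rule bounded_bilinear.has_vector_derivative[OF bounded_bilinear_blinfun_apply _ has_vector_derivative_at_within[OF R(1)]])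
        then show ?thesis unfolding fx_def using sym[OF s t] by simp
      qed
      from fundamental_theorem_of_calculus[of 0 1, OF _ this] show ?thesis using per by simp
    qed
    ultimately have "((\<lambda>\<tau>. integral {0..1} (f \<tau>)) has_vector_derivative 0) (at t within {0<..<1})"
      by (simp add: integral_unique)
    then show ?thesis using t
      by (simp add: has_real_derivative_iff_has_vector_derivative has_vector_derivative_def at_within_open[of t "{0<..<1}"])
  qed
  have "integral {0..1} (f \<tau>) = integral {0..1} (f 0)"
  proof (cases "\<tau> = 0")
    case False
    show ?thesis
      by (rule DERIV_isconst_end[of 0 \<tau> "\<lambda>\<tau>. integral {0..1} (f \<tau>)"])
         (use False \<tau> zero continuous_on_subset[OF cont_I] in auto)
  qed simp
  then show ?thesis by (simp add: f_def)
qed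

section \<open>Change of variables in the plane\<close>

text \<open>
  The gauge integral is defined through boxes, so a linear bijection that preserves norms,
  boxes and their volume transports it for arbitrary integrands and sets. This carries results
  for \<^typ>\<open>real^2\<close> over to \<^typ>\<open>complex\<close> and \<^typ>\<open>real \<times> real\<close>.
\<close>

lemma has_integral_box_isometry:
  fixes g :: "'a::euclidean_space \<Rightarrow> 'b::euclidean_space" and f :: "'b \<Rightarrow> 'c::banach"
  assumes hg: "\<And>x. h (g x) = x" and gh: "\<And>y. g (h y) = y"
    and lin: "linear g" and nrm: "\<And>x. norm (g x) = norm x"
    and box: "\<And>x u v. g x \<in> cbox (g u) (g v) \<longleftrightarrow> x \<in> cbox u v"
    and vol: "\<And>u v. measure lborel (cbox (g u) (g v)) = measure lborel (cbox u v)"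
    and f: "(f has_integral i) S"
  shows "((\<lambda>x. f (g x)) has_integral i) (g -` S)"
proof (subst has_integral', intro allI impI)
  fix e :: real assume "e > 0"
  then obtain B where B: "B > 0" "\<And>a b. ball 0 B \<subseteq> cbox a b \<Longrightarrow>
      \<exists>z. ((\<lambda>x. if x \<in> S then f x else 0) has_integral z) (cbox a b) \<and> norm (z - i) < e"
    using f[THEN has_integral'[THEN iffD1]] by blast
  have gbox: "g ` cbox u v = cbox (g u) (g v)" for u v
  proof (intro equalityI subsetI)
    fix y assume "y \<in> cbox (g u) (g v)"
    then have "h y \<in> cbox u v" using box[of "h y" u v] by (simp add: gh)
    then show "y \<in> g ` cbox u v" using gh[of y] by (metis imageI)
  qed (use box in auto)
  have hbox: "h ` cbox u v = cbox (h u) (h v)" for u v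
    using gbox[of "h u" "h v"] by (metis (no_types, lifting) gh hg image_cong image_ident image_image)
  have "\<exists>z. ((\<lambda>x. if x \<in> g -` S then f (g x) else 0) has_integral z) (cbox a b) \<and> norm (z - i) < e"
    if ab: "ball 0 B \<subseteq> cbox a b" for a b
  proof -
    have "ball 0 B \<subseteq> cbox (g a) (g b)"
    proof
      fix y :: 'b assume "y \<in> ball 0 B"
      then have "h y \<in> cbox a b" using ab nrm[of "h y"] gh by auto
      then show "y \<in> cbox (g a) (g b)" using box[of "h y" a b] gh by simp
    qed
    then obtain z where z: "((\<lambda>x. if x \<in> S then f x else 0) has_integral z) (cbox (g a) (g b))" "norm (z - i) < e"
      using B by blast
    have "((\<lambda>x. (if g x \<in> S then f (g x) else 0)) has_integral (1 / 1) *\<^sub>R z) (h ` cbox (g a) (g b))"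
      by (rule has_integral_twiddle[of 1 h g, OF _ hg gh _ _ _ _ z(1)])
         (use gbox hbox vol linear_continuous_at[of g] lin in \<open>auto simp: linear_conv_bounded_linear\<close>)
    then show ?thesis using z(2) by (auto simp: hbox hg)
  qed
  then show "\<exists>B>0. \<forall>a b. ball 0 B \<subseteq> cbox a b \<longrightarrow>
     (\<exists>z. ((\<lambda>x. if x \<in> g -` S then f (g x) else 0) has_integral z) (cbox a b) \<and> norm (z - i) < e)"
    using B(1) by blast
qed

lemma has_integral_box_isometry_iff:
  fixes g :: "'a::euclidean_space \<Rightarrow> 'b::euclidean_space" and f :: "'b \<Rightarrow> 'c::banach"
  assumes hg: "\<And>x. h (g x) = x" and gh: "\<And>y. g (h y) = y"
    and lin: "linear g" and nrm: "\<And>x. norm (g x) = norm x"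
    and box: "\<And>x u v. g x \<in> cbox (g u) (g v) \<longleftrightarrow> x \<in> cbox u v"
    and vol: "\<And>u v. measure lborel (cbox (g u) (g v)) = measure lborel (cbox u v)"
  shows "(f has_integral i) S \<longleftrightarrow> ((\<lambda>x. f (g x)) has_integral i) (g -` S)"
proof
  assume "((\<lambda>x. f (g x)) has_integral i) (g -` S)"
  moreover have "linear h"
  proof (rule linearI)
    show "h (x + y) = h x + h y" for x y
      using hg[of "h x + h y"] by (simp add: linear_add[OF lin] gh)
    show "h (c *\<^sub>R x) = c *\<^sub>R h x" for c x
      using hg[of "c *\<^sub>R h x"] by (simp add: linear_scale[OF lin] gh)
  qed
  moreover have "norm (h y) = norm y" for y using nrm[of "h y"] by (simp add: gh)
  moreover have "h y \<in> cbox (h u) (h v) \<longleftrightarrow> y \<in> cbox u v" for y u v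
    using box[of "h y" "h u" "h v"] by (simp add: gh)
  moreover have "measure lborel (cbox (h u) (h v)) = measure lborel (cbox u v)" for u v
    using vol[of "h u" "h v"] by (simp add: gh)
  ultimately have "((\<lambda>y. f (g (h y))) has_integral i) (h -` (g -` S))"
    by (intro has_integral_box_isometry[OF gh hg])
  then show "(f has_integral i) S" by (simp add: vimage_def gh)
qed (rule has_integral_box_isometry[OF assms])

lemma ex_2: "(\<exists>i::2. P i) \<longleftrightarrow> P 1 \<or> P 2"
  using forall_2[of "\<lambda>i. \<not> P i"] by blast

lemma complex_neq_i: "(1::complex) \<noteq> \<i>" "\<i> \<noteq> (1::complex)"
  by (auto simp: complex_eq_iff)

lemma has_integral_cart2_complex:
  fixes f :: "complex \<Rightarrow> 'c::banach"
  shows "(f has_integral i) S \<longleftrightarrow>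
    ((\<lambda>x::real^2. f (Complex (x$1) (x$2))) has_integral i) ((\<lambda>x. Complex (x$1) (x$2)) -` S)"
proof (rule has_integral_box_isometry_iff[where h="\<lambda>z. vector [Re z, Im z]"])
  fix u v :: "real^2"
  show "measure lborel (cbox (Complex (u$1) (u$2)) (Complex (v$1) (v$2))) = measure lborel (cbox u v)"
    by (simp add: content_cbox_if_cart content_cbox_if Basis_complex_def inner_complex_def
        interval_eq_empty_cart box_eq_empty ex_2 UNIV_2 complex_neq_i)
qed (auto simp: vec_eq_iff forall_2 complex_eq_iff norm_vec_def L2_set_def sum_2 cmod_def
        mem_box_cart in_cbox_complex_iff intro!: linearI)

lemma has_integral_cart2_prod:
  fixes f :: "real \<times> real \<Rightarrow> 'c::banach"
  shows "(f has_integral i) S \<longleftrightarrow>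
    ((\<lambda>x::real^2. f (x$1, x$2)) has_integral i) ((\<lambda>x. (x$1, x$2)) -` S)"
proof (rule has_integral_box_isometry_iff[where h="\<lambda>z. vector [fst z, snd z]"])
  fix u v :: "real^2"
  show "measure lborel (cbox (u$1, u$2) (v$1, v$2)) = measure lborel (cbox u v)"
    by (simp add: content_Pair content_cbox_if_cart interval_eq_empty_cart ex_2 UNIV_2 content_real_if not_less)
qed (auto simp: vec_eq_iff forall_2 norm_vec_def L2_set_def sum_2 norm_Pair mem_box_cart cbox_Pair_eq
     intro!: linearI)

text \<open>
  In the coordinates of \<^typ>\<open>real^2\<close> this is the general change of variables theorem. For columns
  \<open>a\<close>, \<open>b\<close> of a \<open>2 \<times> 2\<close> matrix, written as complex numbers, the determinant is the imaginary part
  of \<open>cnj a * b\<close>.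
\<close>

lemma change_of_variables_plane:
  fixes g :: "real \<times> real \<Rightarrow> complex" and f :: "complex \<Rightarrow> real"
  assumes S: "open S" and der: "\<And>x. x \<in> S \<Longrightarrow> (g has_derivative g' x) (at x)" and inj: "inj_on g S"
    and f: "f absolutely_integrable_on g ` S"
  shows "((\<lambda>x. \<bar>Im (cnj (g' x (1, 0)) * g' x (0, 1))\<bar> * f (g x)) has_integral integral (g ` S) f) S"
proof -
  let ?j = "\<lambda>x::real^2. (x$1, x$2)"
  let ?h = "\<lambda>x::real^2. Complex (x$1) (x$2)"
  let ?k = "\<lambda>z::complex. vector [Re z, Im z] :: real^2"
  have hk: "?h (?k z) = z" for z by simp
  have kh: "?k (?h x) = x" for x by (simp add: vec_eq_iff forall_2)
  have link: "linear ?k" by (rule linearI) (auto simp: vec_eq_iff forall_2)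
  have linj: "linear ?j" by (rule linearI) auto
  define S2 where "S2 = ?j -` S"
  define G where "G = (\<lambda>x. ?k (g (?j x)))"
  define G' where "G' = (\<lambda>x v. ?k (g' (?j x) (?j v)))"
  have S2: "open S2" unfolding S2_def
    by (rule open_vimage[OF S]) (intro continuous_intros)
  have jS: "?j ` S2 = S"
  proof -
    have "x \<in> ?j ` S2" if "x \<in> S" for x
      using that by (intro image_eqI[of _ _ "vector [fst x, snd x]"]) (auto simp: S2_def)
    then show ?thesis by (auto simp: S2_def)
  qed
  have GS: "G ` S2 = ?h -` (g ` S)"
  proof -
    have "G ` S2 = ?k ` g ` S" unfolding jS[symmetric] by (simp add: image_image G_def)
    also have "\<dots> = ?h -` (g ` S)"
    proof
      show "?h -` (g ` S) \<subseteq> ?k ` g ` S"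
      proof
        fix x assume "x \<in> ?h -` (g ` S)"
        then have "?k (?h x) \<in> ?k ` g ` S" by (intro imageI) simp
        then show "x \<in> ?k ` g ` S" by (simp only: kh)
      qed
    qed auto
    finally show ?thesis .
  qed
  have derG: "(G has_derivative G' x) (at x within S2)" if x: "x \<in> S2" for x
  proof -
    have "?j x \<in> S" using x by (simp add: S2_def)
    then have "(g has_derivative g' (?j x)) (at (?j x))" by (rule der)
    moreover have "(?j has_derivative ?j) (at x within S2)"
      by (intro bounded_linear_imp_has_derivative linear_conv_bounded_linear[THEN iffD1] linj)
    ultimately have "((\<lambda>x. g (?j x)) has_derivative (\<lambda>v. g' (?j x) (?j v))) (at x within S2)"
      by (rule has_derivative_compose[rotated])
    moreover have "(?k has_derivative ?k) (at (g (?j x)))"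
      by (intro bounded_linear_imp_has_derivative linear_conv_bounded_linear[THEN iffD1] link)
    ultimately show ?thesis unfolding G_def G'_def
      by (rule has_derivative_compose)
  qed
  have injG: "inj_on G S2"
  proof (rule inj_onI)
    fix x y assume xy: "x \<in> S2" "y \<in> S2" "G x = G y"
    then have "g (?j x) = g (?j y)" unfolding G_def by (metis hk)
    then have "?j x = ?j y" using inj xy by (auto simp: inj_on_def S2_def)
    then show "x = y" by (simp add: vec_eq_iff forall_2)
  qed
  have det: "det (matrix (G' x)) = Im (cnj (g' (?j x) (1, 0)) * g' (?j x) (0, 1))" for x
    by (simp add: det_2 matrix_def G'_def axis_def)
  define f2 where "f2 = (\<lambda>x. vec (f (?h x)) :: real^1)"
  have fi: "f integrable_on g ` S" "(\<lambda>x. norm (f x)) integrable_on g ` S"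
    using f by (auto simp: absolutely_integrable_on_def)
  have tr: "((\<lambda>x. u (?h x)) integrable_on G ` S2) \<and> integral (G ` S2) (\<lambda>x. u (?h x)) = integral (g ` S) u"
    if "u integrable_on g ` S" for u :: "complex \<Rightarrow> real"
  proof -
    have "((\<lambda>x. u (?h x)) has_integral integral (g ` S) u) (G ` S2)"
      unfolding GS by (rule iffD1[OF has_integral_cart2_complex integrable_integral[OF that]])
    then show ?thesis by (simp only: has_integral_iff)
  qed
  have "(\<lambda>x. f (?h x)) absolutely_integrable_on G ` S2"
    unfolding absolutely_integrable_on_def using tr[OF fi(1)] tr[OF fi(2)] by auto
  then have f2: "f2 absolutely_integrable_on G ` S2"
    unfolding f2_def by (simp add: absolutely_integrable_on_1_iff)
  have i2: "integral (G ` S2) f2 = vec (integral (g ` S) f)"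
    using tr[OF fi(1)] by (simp add: f2_def integral_on_1_eq)
  have S2m: "S2 \<in> sets lebesgue" using S2 by simp
  let ?u = "\<lambda>x. \<bar>Im (cnj (g' x (1, 0)) * g' x (0, 1))\<bar> * f (g x)"
  have "(\<lambda>x. \<bar>det (matrix (G' x))\<bar> *\<^sub>R f2 (G x)) absolutely_integrable_on S2 \<and>
      integral S2 (\<lambda>x. \<bar>det (matrix (G' x))\<bar> *\<^sub>R f2 (G x)) = vec (integral (g ` S) f)"
    by (rule iffD2[OF has_absolute_integral_change_of_variables[OF S2m derG injG, where f = f2]
          conjI[OF f2 i2]])
  then have "((\<lambda>x. ?u (?j x)) absolutely_integrable_on S2) \<and> integral S2 (\<lambda>x. ?u (?j x)) = integral (g ` S) f"
    unfolding absolutely_integrable_on_1_iff integral_on_1_eq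
    by (simp add: det f2_def G_def vec_eq_iff)
  then have "((\<lambda>x. ?u (?j x)) has_integral integral (g ` S) f) S2"
    by (auto simp: absolutely_integrable_on_def has_integral_iff)
  then show ?thesis
    using has_integral_cart2_prod[of ?u _ S] by (simp add: S2_def)
qed

section \<open>Smooth Jordan curves and their outer normal\<close>

lemma plane_parallel:
  fixes d n m :: complex
  assumes "d \<noteq> 0" "n \<bullet> d = 0" "norm n = 1" "m \<bullet> d = 0"
  shows "m = (m \<bullet> n) *\<^sub>R n"
proof -
  have n: "Re n * Re n + Im n * Im n = 1"
    using assms(3) by (simp add: cmod_def power2_eq_square)
  have nd: "Re n * Re d + Im n * Im d = 0" using assms(2) by (simp add: inner_complex_def)
  have md: "Re m * Re d + Im m * Im d = 0" using assms(4) by (simp add: inner_complex_def)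
  define l where "l = Im d * Re n - Re d * Im n"
  have d: "Re d = - l * Im n" "Im d = l * Re n" unfolding l_def using n nd by algebra+
  then have "l \<noteq> 0" using assms(1) by (auto simp: complex_eq_iff)
  then have "Im m * Re n = Re m * Im n" using md unfolding d by algebra
  then have "Re m = (Re m * Re n + Im m * Im n) * Re n" "Im m = (Re m * Re n + Im m * Im n) * Im n"
    using n by algebra+
  then show ?thesis by (simp add: complex_eq_iff inner_complex_def)
qed

context
  fixes c :: "real \<Rightarrow> complex"
  assumes c: "smooth_simple_closed_curve c"
begin

lemma curve_C2:
  shows curve_deriv: "(c has_vector_derivative vector_derivative c (at s)) (at s)"
    and curve_deriv2: "((\<lambda>s. vector_derivative c (at s)) has_vector_derivative
        vector_derivative (\<lambda>s. vector_derivative c (at s)) (at s)) (at s)"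
    and curve_cont2: "continuous_on UNIV (\<lambda>s. vector_derivative (\<lambda>s. vector_derivative c (at s)) (at s))"
proof -
  let ?c' = "\<lambda>s. vector_derivative c (at s)"
  obtain U g where g: "open U" "UNIV \<subseteq> U" "\<forall>k. Ck_open k g U" "\<forall>x\<in>UNIV. g x = c x"
    using c unfolding smooth_simple_closed_curve_def smooth_on_def by blast
  have "g = c" "U = UNIV" using g by auto
  then have k: "Ck_open (Suc (Suc 0)) c UNIV" using g by blast
  then have d: "c differentiable at x" for x by simp
  then have e: "frechet_derivative c (at x) 1 = ?c' x" for x
    by (simp add: frechet_derivative_eq_vector_derivative)
  show "(c has_vector_derivative ?c' s) (at s)"
    using d vector_derivative_works by blast
  have "Ck_open (Suc 0) (\<lambda>x. frechet_derivative c (at x) 1) UNIV" using k by simp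
  then have k': "Ck_open (Suc 0) ?c' UNIV" by (simp add: e)
  then have d': "?c' differentiable at x" for x by simp
  then have e': "frechet_derivative ?c' (at x) 1 = vector_derivative ?c' (at x)" for x
    by (simp add: frechet_derivative_eq_vector_derivative)
  show "(?c' has_vector_derivative vector_derivative ?c' (at s)) (at s)"
    using d' vector_derivative_works by blast
  have "Ck_open 0 (\<lambda>x. frechet_derivative ?c' (at x) 1) UNIV" using k' by simp
  then show "continuous_on UNIV (\<lambda>s. vector_derivative ?c' (at s))"
    by (simp add: e')
qed

lemma curve_continuous: "continuous_on S c" "continuous_on S (\<lambda>s. vector_derivative c (at s))"
  using curve_deriv curve_deriv2
  by (meson continuous_at_imp_continuous_on has_vector_derivative_continuous)+

lemma curve_deriv_nonzero: "vector_derivative c (at s) \<noteq> 0"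
  using c unfolding smooth_simple_closed_curve_def by blast

lemma curve_shift_int: "c (s + of_int n) = c s"
proof -
  have p: "c (s + 1) = c s" for s using c unfolding smooth_simple_closed_curve_def by blast
  have N: "c (s + real k) = c s" for s k
  proof (induction k)
    case (Suc k) 
    have "c (s + real (Suc k)) = c (s + real k + 1)" by (simp add: algebra_simps)
    then show ?case using p Suc by simp
  qed simp
  show ?thesis
  proof (cases "n \<ge> 0")
    case True then show ?thesis using N[of s "nat n"] by simp
  next
    case False then show ?thesis using N[of "s + of_int n" "nat (- n)"] by simp
  qed
qed

lemma curve_deriv_shift_int: "vector_derivative c (at (s + of_int n)) = vector_derivative c (at s)"
proof -
  have "((\<lambda>x. c (x + of_int n)) has_vector_derivative vector_derivative c (at (s + of_int n))) (at s)"
    using vector_diff_chain_at[where f = "\<lambda>x. x + of_int n" and x = s and g = c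
        and f' = 1 and g' = "vector_derivative c (at (s + of_int n))"] curve_deriv
    by (simp add: o_def has_vector_derivative_add_const)
  then show ?thesis
    using curve_deriv[of s] by (simp add: curve_shift_int vector_derivative_unique_at)
qed

lemma curve_frac: "c (frac s) = c s"
  using curve_shift_int[of "frac s" "\<lfloor>s\<rfloor>"] by (simp add: frac_def)

lemma curve_range: "path_image c = range c"
proof -
  have "c s \<in> c ` {0..1}" for s
    using curve_frac[of s] frac_ge_0[of s] frac_lt_1[of s]
    by (metis atLeastAtMost_iff image_eqI less_imp_le)
  then show ?thesis unfolding path_image_def by auto
qed

lemma curve_simple: "simple_path c" "pathfinish c = pathstart c"
  using c curve_shift_int[of 0 1] by (auto simp: smooth_simple_closed_curve_def pathfinish_def pathstart_def)

lemma curve_eq_iff: "c s = c t \<longleftrightarrow> (\<exists>n::int. s = t + of_int n)"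
proof
  assume st: "c s = c t"
  have lf: "loop_free c" using curve_simple(1) by (simp add: simple_path_def)
  have "c (frac s) = c (frac t)" using st by (simp add: curve_frac)
  moreover have "frac s \<in> {0..1}" "frac t \<in> {0..1}" "frac s \<noteq> 1" "frac t \<noteq> 1"
    using frac_lt_1[of s] frac_lt_1[of t] by (auto intro: less_imp_le)
  ultimately have "frac s = frac t" using lf unfolding loop_free_def by blast
  then have "s = t + of_int (\<lfloor>s\<rfloor> - \<lfloor>t\<rfloor>)" by (simp add: frac_def)
  then show "\<exists>n::int. s = t + of_int n" by blast
qed (auto simp: curve_shift_int)

lemma curve_inj: "\<bar>s - t\<bar> < 1 \<Longrightarrow> c s = c t \<Longrightarrow> s = t"
  by (auto simp: curve_eq_iff)

lemma curve_Jordan: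
  shows "inside (path_image c) \<noteq> {}" "open (inside (path_image c))" "connected (inside (path_image c))"
    "open (outside (path_image c))" "bounded (inside (path_image c))"
    "inside (path_image c) \<inter> outside (path_image c) = {}"
    "inside (path_image c) \<union> outside (path_image c) = - path_image c"
    "frontier (inside (path_image c)) = path_image c" "frontier (outside (path_image c)) = path_image c"
  using Jordan_inside_outside[OF curve_simple] by auto

lemma curve_in_period: 
  assumes "p \<in> path_image c" obtains s where "p = c s" "a \<le> s" "s < a + 1"
proof -
  obtain t where "p = c t" using assms curve_range by auto
  moreover have "c (a + frac (t - a)) = c t"
    using curve_shift_int[of "a + frac (t - a)" "\<lfloor>t - a\<rfloor>"] by (simp add: frac_def)
  ultimately show ?thesis using that[of "a + frac (t - a)"] frac_lt_1[of "t - a"] by auto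
qed

text \<open>
  Rotate the plane so that the tangent at \<open>y = c s\<close> is horizontal. Near \<open>y\<close> the curve is contained in the
  double cone \<open>\<bar>b\<bar> \<le> \<bar>a\<bar>\<close> (\<open>cone\<close>) and meets each vertical line at most once (\<open>line\<close>). From a
  point off the curve one can therefore escape vertically in at least one direction, and then
  horizontally above or below the cone, to one of the two points \<open>P 0 (\<plusminus>h)\<close> on the normal line
  (\<open>reach\<close>). Since \<open>y\<close> is in the frontier of both the inside and the outside, points of both kinds
  exist arbitrarily close to \<open>y\<close>, so one of the two points lies inside and the other outside.
\<close>

lemma curve_local_sides:
  obtains n e where "norm n = 1" "n \<bullet> vector_derivative c (at s) = 0" "0 < e"
    "\<And>t. 0 < t \<Longrightarrow> t < e \<Longrightarrow> c s + t *\<^sub>R n \<in> outside (path_image c)"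
    "\<And>t. 0 < t \<Longrightarrow> t < e \<Longrightarrow> c s - t *\<^sub>R n \<in> inside (path_image c)"
proof -
  define y d where "y = c s" and "d = vector_derivative c (at s)"
  define T where "T = sgn d"
  have d0: "d \<noteq> 0" unfolding d_def by (rule curve_deriv_nonzero)
  then have T1: "norm T = 1" by (simp add: T_def norm_sgn)
  then have TT: "T * cnj T = 1" by (simp add: complex_norm_square[symmetric])
  \<comment> \<open>the curve in coordinates with \<open>y\<close> at the origin and the real axis tangent to it\<close>
  define w where "w = (\<lambda>x. (c x - y) * cnj T)"
  define w' where "w' = (\<lambda>x. vector_derivative c (at x) * cnj T)"
  have wd: "(w has_vector_derivative w' x) (at x)" for x
    unfolding w_def w'_def
    by (rule has_vector_derivative_mult_left) (auto intro!: derivative_eq_intros curve_deriv)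
  have Rew: "((\<lambda>x. Re (w x)) has_real_derivative Re (w' x)) (at x)"
    and Imw: "((\<lambda>x. Im (w x)) has_real_derivative Im (w' x)) (at x)" for x
    unfolding has_real_derivative_iff_has_vector_derivative
    by (intro bounded_linear.has_vector_derivative[OF bounded_linear_Re wd]
        bounded_linear.has_vector_derivative[OF bounded_linear_Im wd])+
  have ws: "w s = 0" by (simp add: w_def y_def)
  have w's: "w' s = of_real (norm d)"
    using d0 by (simp add: w'_def d_def[symmetric] T_def sgn_div_norm complex_norm_square[symmetric] power2_eq_square scaleR_conv_of_real divide_simps)
  obtain \<delta> where \<delta>: "0 < \<delta>" "\<delta> < 1/2" "\<And>x. \<bar>x - s\<bar> < \<delta> \<Longrightarrow> \<bar>Im (w' x)\<bar> < Re (w' x)"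
  proof -
    have "continuous_on UNIV (\<lambda>x. Re (w' x) - \<bar>Im (w' x)\<bar>)"
      unfolding w'_def by (intro continuous_intros curve_continuous)
    then have "isCont (\<lambda>x. Re (w' x) - \<bar>Im (w' x)\<bar>) s"
      by (simp add: continuous_on_eq_continuous_at)
    moreover have "0 < Re (w' s) - \<bar>Im (w' s)\<bar>" using w's d0 by simp
    ultimately have "\<forall>\<^sub>F x in at s. 0 < Re (w' x) - \<bar>Im (w' x)\<bar>"
      using order_tendstoD(1)[of "\<lambda>x. Re (w' x) - \<bar>Im (w' x)\<bar>"] by (simp only: isCont_def)
    then obtain r where "0 < r" "\<And>x. x \<noteq> s \<Longrightarrow> dist x s < r \<Longrightarrow> 0 < Re (w' x) - \<bar>Im (w' x)\<bar>"
      by (auto simp: eventually_at)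
    then show ?thesis
      using that[of "min r (1/4)"] w's d0 by (force simp: dist_real_def)
  qed
  have strict: "Re (w x) < Re (w z)" if "x < z" "\<bar>x - s\<bar> < \<delta>" "\<bar>z - s\<bar> < \<delta>" for x z
  proof (rule DERIV_pos_imp_increasing[OF that(1)])
    fix u assume "x \<le> u" "u \<le> z"
    then have "\<bar>Im (w' u)\<bar> < Re (w' u)" using that by (intro \<delta>(3)) auto
    then show "\<exists>y. ((\<lambda>x. Re (w x)) has_real_derivative y) (at u) \<and> 0 < y" using Rew[of u] by (intro exI[of _ "Re (w' u)"]) auto
  qed
  have cone: "\<bar>Im (w x)\<bar> \<le> \<bar>Re (w x)\<bar>" if x: "\<bar>x - s\<bar> < \<delta>" for x
  proof -
    \<comment> \<open>for \<open>k = \<plusminus>1\<close> the functions \<open>a + k b\<close> increase, since \<open>a' > \<bar>b'\<bar>\<close>\<close>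
    have p: "Re (w u) + k * Im (w u) \<le> Re (w v) + k * Im (w v)"
      if "u \<le> v" "\<bar>u - s\<bar> < \<delta>" "\<bar>v - s\<bar> < \<delta>" "\<bar>k\<bar> = 1" for u v k
    proof (rule DERIV_nonneg_imp_nondecreasing[OF that(1), of "\<lambda>x. Re (w x) + k * Im (w x)"])
      fix z assume "u \<le> z" "z \<le> v"
      then have z: "\<bar>Im (w' z)\<bar> < Re (w' z)" using that \<delta>(3) by force
      have "((\<lambda>x. Re (w x) + k * Im (w x)) has_real_derivative Re (w' z) + k * Im (w' z)) (at z)"
        by (intro DERIV_add DERIV_cmult Rew Imw)
      moreover have "0 \<le> Re (w' z) + k * Im (w' z)"
        using z \<open>\<bar>k\<bar> = 1\<close> by (auto simp: abs_if split: if_splits)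
      ultimately show "\<exists>y. ((\<lambda>x. Re (w x) + k * Im (w x)) has_real_derivative y) (at z) \<and> 0 \<le> y" by blast
    qed
    show ?thesis
      using p[of s x 1] p[of s x "-1"] p[of x s 1] p[of x s "-1"] x \<delta>(1) ws by (cases "s \<le> x") auto
  qed
  obtain \<rho> where \<rho>: "0 < \<rho>" "\<And>p. p \<in> path_image c \<Longrightarrow> dist y p < \<rho> \<Longrightarrow> \<exists>x. \<bar>x - s\<bar> < \<delta> \<and> p = c x"
  proof -
    \<comment> \<open>the rest of the curve is compact and stays away from \<open>y\<close>\<close>
    define K where "K = c ` ({s - 1/2..s + 1/2} - {s - \<delta><..<s + \<delta>})"
    have "compact K" unfolding K_def
      by (intro compact_continuous_image curve_continuous compact_diff) auto
    moreover have "y \<notin> K"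
    proof
      assume "y \<in> K"
      then obtain x where x: "c s = c x" "\<bar>x - s\<bar> \<le> 1/2" "\<not> \<bar>x - s\<bar> < \<delta>"
        unfolding K_def y_def by (auto simp: abs_if)
      then have "x = s" using curve_inj[of s x] by (auto simp: abs_minus_commute)
      then show False using x \<delta> by simp
    qed
    ultimately obtain r where r: "0 < r" "\<And>p. p \<in> K \<Longrightarrow> r \<le> dist y p"
      using separate_point_closed[of K y] compact_imp_closed by (metis dist_commute)
    show ?thesis
    proof (rule that[OF r(1)])
      fix p assume p: "p \<in> path_image c" "dist y p < r"
      then obtain x where x: "p = c x" "s - 1/2 \<le> x" "x < s - 1/2 + 1"
        using curve_in_period[of p "s - 1/2"] by blast
      have "\<bar>x - s\<bar> < \<delta>"
      proof (rule ccontr)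
        assume "\<not> \<bar>x - s\<bar> < \<delta>"
        then have "p \<in> K" unfolding K_def x(1) using x by (intro imageI) auto
        then show False using r p by force
      qed
      then show "\<exists>x. \<bar>x - s\<bar> < \<delta> \<and> p = c x" using x by blast
    qed
  qed
  define P where "P = (\<lambda>a b. y + T * Complex a b)"
  have P_w: "w x = Complex a b" if "P a b = c x" for a b x
  proof -
    have "c x - y = T * Complex a b" using that by (simp add: P_def algebra_simps)
    then show ?thesis unfolding w_def using TT by (metis mult.commute mult.left_commute mult.right_neutral)
  qed
  have P_surj: "\<exists>a b. p = P a b" for p
  proof -
    have "p = P (Re ((p - y) * cnj T)) (Im ((p - y) * cnj T))"
    proof -
      have "T * ((p - y) * cnj T) = (p - y) * (T * cnj T)" by (simp only: mult_ac)
      then have *: "T * ((p - y) * cnj T) = p - y" by (simp only: TT mult_1_right)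
      show ?thesis unfolding P_def complex_surj * by simp
    qed
    then show ?thesis by blast
  qed
  have P_dist: "dist y (P a b) = cmod (Complex a b)" for a b
    unfolding P_def by (simp add: dist_norm norm_mult T1)
  have P_seg: "closed_segment (P a b) (P a' b') \<subseteq> {P ((1-u) * a + u * a') ((1-u) * b + u * b') |u. 0 \<le> u \<and> u \<le> 1}" for a b a' b'
  proof
    fix z assume "z \<in> closed_segment (P a b) (P a' b')"
    then obtain u where u: "0 \<le> u" "u \<le> 1" "z = (1 - u) *\<^sub>R P a b + u *\<^sub>R P a' b'"
      by (auto simp: closed_segment_def)
    have *: "Complex ((1-u) * a + u * a') ((1-u) * b + u * b') = of_real (1-u) * Complex a b + of_real u * Complex a' b'"
      by (simp add: complex_eq_iff)
    have "z = P ((1-u) * a + u * a') ((1-u) * b + u * b')"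
      unfolding u P_def * by (simp add: scaleR_conv_of_real algebra_simps)
    then show "z \<in> {P ((1-u) * a + u * a') ((1-u) * b + u * b') |u. 0 \<le> u \<and> u \<le> 1}" using u by blast
  qed
  define h where "h = \<rho> / 2"
  have h: "0 < h" using \<rho> by (simp add: h_def)
  have off: "P a b \<notin> path_image c" if "\<bar>a\<bar> < \<bar>b\<bar>" "\<bar>a\<bar> \<le> \<rho>/4" "\<bar>b\<bar> \<le> h" for a b
  proof
    assume p: "P a b \<in> path_image c"
    have "cmod (Complex a b) \<le> \<bar>a\<bar> + \<bar>b\<bar>" using cmod_le[of "Complex a b"] by simp
    then have "dist y (P a b) < \<rho>" using that \<rho>(1) unfolding P_dist h_def by linarith
    then obtain x where x: "\<bar>x - s\<bar> < \<delta>" "P a b = c x" using \<rho>(2) p by blast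
    then show False using cone[OF x(1)] P_w[OF x(2)] that by simp
  qed
  have side: "connected_component (- path_image c) (P 0 (k * t)) (P 0 (k * h))"
    if "0 < t" "t \<le> h" "\<bar>k\<bar> = 1" for k t
    unfolding connected_component_def
  proof (intro exI conjI)
    show "closed_segment (P 0 (k * t)) (P 0 (k * h)) \<subseteq> - path_image c"
    proof
      fix z assume "z \<in> closed_segment (P 0 (k * t)) (P 0 (k * h))"
      then obtain u where u: "0 \<le> u" "u \<le> 1" "z = P ((1-u) * 0 + u * 0) ((1-u) * (k * t) + u * (k * h))"
        using P_seg by blast
      have "(1-u) * (k * t) + u * (k * h) = k * ((1-u) * t + u * h)" by (simp add: algebra_simps)
      then have "\<bar>(1-u) * (k * t) + u * (k * h)\<bar> = \<bar>(1-u) * t + u * h\<bar>" using that by (simp add: abs_mult)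
      moreover have "(1-u) * t + u * h \<le> h" using that u mult_left_mono[of t h "1-u"] by (simp add: algebra_simps)
      moreover have "0 < (1-u) * t + u * h"
        using that u h by (cases "u = 0") (auto intro!: add_nonneg_pos mult_nonneg_nonneg mult_pos_pos)
      ultimately show "z \<in> - path_image c" using off[of 0 "(1-u) * (k * t) + u * (k * h)"] u \<rho>(1) by auto
    qed
  qed auto
  have reach: "\<exists>k. \<bar>k\<bar> = 1 \<and> connected_component (- path_image c) p (P 0 (k * h))"
    if p: "p \<notin> path_image c" "dist y p < \<rho>/4" for p
  proof -
    obtain a b where ab: "p = P a b" using P_surj by blast
    have a: "\<bar>a\<bar> < \<rho>/4" and b: "\<bar>b\<bar> < \<rho>/4" 
      using p(2) abs_Re_le_cmod[of "Complex a b"] abs_Im_le_cmod[of "Complex a b"] unfolding ab P_dist by auto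
    have line: "\<beta> = \<beta>'" if on: "P a \<beta> \<in> path_image c" "P a \<beta>' \<in> path_image c" "\<bar>\<beta>\<bar> \<le> h" "\<bar>\<beta>'\<bar> \<le> h" for \<beta> \<beta>'
    proof -
      have "cmod (Complex a \<beta>) \<le> \<bar>a\<bar> + \<bar>\<beta>\<bar>" "cmod (Complex a \<beta>') \<le> \<bar>a\<bar> + \<bar>\<beta>'\<bar>" 
        using cmod_le[of "Complex a \<beta>"] cmod_le[of "Complex a \<beta>'"] by auto
      then have "dist y (P a \<beta>) < \<rho>" "dist y (P a \<beta>') < \<rho>" using that a \<rho>(1) unfolding P_dist h_def by linarith+
      then obtain x z where x: "\<bar>x - s\<bar> < \<delta>" "P a \<beta> = c x" and z: "\<bar>z - s\<bar> < \<delta>" "P a \<beta>' = c z"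
        using \<rho>(2)[of "P a \<beta>"] \<rho>(2)[of "P a \<beta>'"] on by blast
      have "Re (w x) = Re (w z)" using P_w[OF x(2)] P_w[OF z(2)] by simp
      then have "x = z" using strict[of x z] strict[of z x] x z by (metis less_irrefl linorder_neqE_linordered_idom)
      then show ?thesis using P_w[OF x(2)] P_w[OF z(2)] by simp
    qed
    obtain k where k: "\<bar>k\<bar> = 1" "\<And>u. 0 \<le> u \<Longrightarrow> u \<le> 1 \<Longrightarrow> P a ((1-u) * b + u * (k * h)) \<notin> path_image c"
    proof -
      have le: "\<bar>(1-u) * b + u * (k * h)\<bar> \<le> h" if "0 \<le> u" "u \<le> 1" "\<bar>k\<bar> = 1" for u k
      proof -
        have "\<bar>(1-u) * b + u * (k * h)\<bar> \<le> (1-u) * \<bar>b\<bar> + u * h"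
          using that h by (intro order_trans[OF abs_triangle_ineq]) (simp add: abs_mult)
        also have "\<dots> \<le> (1-u) * h + u * h" using that b h_def by (intro add_right_mono mult_left_mono) auto
        finally show ?thesis by (simp add: algebra_simps)
      qed
      show ?thesis
      \<comment> \<open>if the curve passes below the point on its vertical line, it does not pass above it\<close>
      proof (cases "\<exists>\<beta>. \<bar>\<beta>\<bar> \<le> h \<and> \<beta> < b \<and> P a \<beta> \<in> path_image c")
        case True
        then obtain \<beta> where \<beta>: "\<bar>\<beta>\<bar> \<le> h" "\<beta> < b" "P a \<beta> \<in> path_image c" by blast
        show ?thesis
        proof (rule that[of 1])
          fix u :: real assume u: "0 \<le> u" "u \<le> 1"
          have "b \<le> (1-u) * b + u * (1 * h)" using mult_left_mono[of b h u] b h_def u by (auto simp: algebra_simps)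
          then show "P a ((1-u) * b + u * (1 * h)) \<notin> path_image c"
            using line[OF \<beta>(3) _ \<beta>(1) le[OF u, of 1]] \<beta>(2) by auto
        qed simp
      next
        case False
        show ?thesis
        proof (rule that[of "-1"])
          fix u :: real assume u: "0 \<le> u" "u \<le> 1"
          show "P a ((1-u) * b + u * (- 1 * h)) \<notin> path_image c"
          proof (cases "u = 0")
            case True then show ?thesis using p ab by simp
          next
            case u0: False
            have "-h < b" using b h_def \<rho>(1) by (auto simp: abs_if split: if_splits)
            then have "(1-u) * b + u * (-1 * h) < b" using mult_strict_left_mono[of "-h" b u] u u0 by (auto simp: algebra_simps)
            then show ?thesis using False le[OF u, of "-1"] by auto
          qed
        qed simp
      qed
    qed
    let ?S = "closed_segment (P a b) (P a (k * h)) \<union> closed_segment (P a (k * h)) (P 0 (k * h))"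
    have "?S \<subseteq> - path_image c"
    proof
      fix z assume "z \<in> ?S"
      then show "z \<in> - path_image c"
      proof
        assume "z \<in> closed_segment (P a b) (P a (k * h))"
        then obtain u where u: "0 \<le> u" "u \<le> 1" "z = P ((1-u) * a + u * a) ((1-u) * b + u * (k * h))"
          using P_seg by blast
        moreover have "(1-u) * a + u * a = a" by (simp add: algebra_simps)
        ultimately show ?thesis using k(2)[OF u(1,2)] by simp
      next
        assume "z \<in> closed_segment (P a (k * h)) (P 0 (k * h))"
        then obtain u where u: "0 \<le> u" "u \<le> 1" "z = P ((1-u) * a + u * 0) ((1-u) * (k * h) + u * (k * h))"
          using P_seg by blast
        moreover have e: "(1-u) * (k * h) + u * (k * h) = k * h" by (simp add: algebra_simps)
        moreover have "\<bar>(1-u) * a + u * 0\<bar> \<le> \<bar>a\<bar>" using u by (simp add: abs_mult mult_left_le_one_le)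
        moreover have "\<bar>k * h\<bar> = h" using k h by (simp add: abs_mult)
        ultimately have "P ((1-u) * a + u * 0) (k * h) \<notin> path_image c"
          using a \<rho>(1) h_def by (intro off) linarith+
        then show ?thesis unfolding u(3) e by simp
      qed
    qed
    moreover have "connected ?S"
      by (rule connected_Un) auto
    ultimately have "connected_component (- path_image c) p (P 0 (k * h))"
      unfolding connected_component_def ab by (intro exI[of _ ?S]) auto
    then show ?thesis using k by blast
  qed
  have y: "y \<in> path_image c" using curve_range y_def by auto
  have "y \<in> closure (inside (path_image c))" "y \<in> closure (outside (path_image c))"
    using y curve_Jordan(8,9) by (auto simp: frontier_def)
  then obtain p q where p: "p \<in> inside (path_image c)" "dist y p < \<rho>/4" and q: "q \<in> outside (path_image c)" "dist y q < \<rho>/4"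
    using \<rho>(1) unfolding closure_approachable by (metis dist_commute divide_pos_pos zero_less_numeral)
  have pq: "p \<notin> path_image c" "q \<notin> path_image c"
    using p(1) q(1) inside_no_overlap[of "path_image c"] outside_no_overlap[of "path_image c"] by blast+
  obtain k where k: "\<bar>k\<bar> = 1" "connected_component (- path_image c) p (P 0 (k * h))" using reach[OF pq(1) p(2)] by blast
  obtain l where l: "\<bar>l\<bar> = 1" "connected_component (- path_image c) q (P 0 (l * h))" using reach[OF pq(2) q(2)] by blast
  have I: "P 0 (k * t) \<in> inside (path_image c)" if "0 < t" "t < h" for t
    using inside_same_component[of "path_image c"] k(2) p(1) side[of t k] that k(1)
    by (metis connected_component_sym less_imp_le)
  have O: "P 0 (l * t) \<in> outside (path_image c)" if "0 < t" "t < h" for t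
    using outside_same_component[of "path_image c"] l(2) q(1) side[of t l] that l(1)
    by (metis connected_component_sym less_imp_le)
  have "k \<noteq> l"
  proof
    assume "k = l"
    then have "P 0 (l * (h/2)) \<in> inside (path_image c)" "P 0 (l * (h/2)) \<in> outside (path_image c)"
      using I[of "h/2"] O[of "h/2"] h by simp_all
    then show False using curve_Jordan(6) by blast
  qed
  then have kl: "k = - l" using k(1) l(1) by (auto simp: abs_if split: if_splits)
  define n where "n = T * Complex 0 l"
  have Pn: "P 0 (l * t) = c s + t *\<^sub>R n" for t
    unfolding P_def n_def y_def by (simp add: complex_eq_iff)
  have nd: "n \<bullet> d = 0"
  proof -
    have "d = norm d *\<^sub>R T" using d0 by (simp add: T_def sgn_div_norm)
    moreover have "n \<bullet> T = 0" by (simp add: n_def inner_complex_def algebra_simps)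
    ultimately show ?thesis by (metis inner_scaleR_right mult_zero_right)
  qed
  show ?thesis
  proof (rule that[of n h])
    show "norm n = 1" using l(1) T1 by (simp add: n_def norm_mult) (simp add: cmod_def)
    show "n \<bullet> vector_derivative c (at s) = 0" using nd by (simp add: d_def)
    show "c s + t *\<^sub>R n \<in> outside (path_image c)" if "0 < t" "t < h" for t
      using O[OF that] Pn by simp
    show "c s - t *\<^sub>R n \<in> inside (path_image c)" if "0 < t" "t < h" for t
      using I[OF that] Pn[of "-t"] kl by simp
  qed (rule h)
qed

text \<open>
  There are two unit vectors orthogonal to the tangent. By \<open>curve_local_sides\<close> exactly one of them
  points to the outside, so the description of the outer normal is met by a unique vector.
\<close>

lemma outer_normal_properties:
  shows "norm (outer_normal c (c s)) = 1" (is ?A)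
    and "outer_normal c (c s) \<bullet> vector_derivative c (at s) = 0" (is ?B)
    and "\<exists>e>0. \<forall>t. 0 < t \<longrightarrow> t < e \<longrightarrow> c s + t *\<^sub>R outer_normal c (c s) \<in> outside (path_image c)
        \<and> c s - t *\<^sub>R outer_normal c (c s) \<in> inside (path_image c)" (is ?C)
proof -
  obtain n e where n: "norm n = 1" "n \<bullet> vector_derivative c (at s) = 0" "0 < e"
    "\<And>t. 0 < t \<Longrightarrow> t < e \<Longrightarrow> c s + t *\<^sub>R n \<in> outside (path_image c)"
    "\<And>t. 0 < t \<Longrightarrow> t < e \<Longrightarrow> c s - t *\<^sub>R n \<in> inside (path_image c)"
    using curve_local_sides[of s] by blast
  have "outer_normal c (c s) = n"
    unfolding outer_normal_def
  proof (rule the_equality)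
    show "norm n = 1 \<and> (\<forall>s'. c s' = c s \<longrightarrow> n \<bullet> vector_derivative c (at s') = 0) \<and>
         (\<exists>e>0. \<forall>t\<in>{0<..<e}. c s + t *\<^sub>R n \<in> outside (path_image c))"
      using n by (auto simp: curve_eq_iff curve_deriv_shift_int)
    fix m assume m: "norm m = 1 \<and> (\<forall>s'. c s' = c s \<longrightarrow> m \<bullet> vector_derivative c (at s') = 0) \<and>
         (\<exists>e>0. \<forall>t\<in>{0<..<e}. c s + t *\<^sub>R m \<in> outside (path_image c))"
    then obtain e' where e': "0 < e'" "\<And>t. t \<in> {0<..<e'} \<Longrightarrow> c s + t *\<^sub>R m \<in> outside (path_image c)" by blast
    have mm: "m = (m \<bullet> n) *\<^sub>R n"
      using plane_parallel[OF curve_deriv_nonzero n(2) n(1)] m by blast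
    then have "\<bar>m \<bullet> n\<bar> = 1" using m n(1) by (metis mult.right_neutral norm_scaleR)
    moreover have "m \<bullet> n \<noteq> -1"
    proof
      assume "m \<bullet> n = -1"
      then have "m = - n" using mm by simp
      moreover define t where "t = min e e' / 2"
      moreover have "0 < t" "t < e" "t < e'" using e'(1) n(3) by (auto simp: t_def min_def)
      ultimately have "c s - t *\<^sub>R n \<in> outside (path_image c)" "c s - t *\<^sub>R n \<in> inside (path_image c)"
        using e'(2)[of t] n(5)[of t] by auto
      then show False using curve_Jordan(6) by blast
    qed
    ultimately have "m \<bullet> n = 1" by (auto simp: abs_if split: if_splits)
    then show "m = n" using mm by simp
  qed
  then show ?A ?B ?C using n by blast+
qed

end

section \<open>Convex smooth curves\<close>

lemma has_vector_derivative_iff_quotient: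
  "(f has_vector_derivative f') (at x) \<longleftrightarrow> ((\<lambda>y. (1 / (y - x)) *\<^sub>R (f y - f x)) \<longlongrightarrow> f') (at x)"
proof -
  have "(f has_vector_derivative f') (at x) \<longleftrightarrow>
      ((\<lambda>y. norm ((f y - f x) - (y - x) *\<^sub>R f') / norm (y - x)) \<longlongrightarrow> 0) (at x)"
    by (simp add: has_vector_derivative_def has_derivative_iff_norm bounded_linear_scaleR_left)
  also have "\<dots> \<longleftrightarrow> ((\<lambda>y. norm ((1 / (y - x)) *\<^sub>R (f y - f x) - f')) \<longlongrightarrow> 0) (at x)"
  proof (rule filterlim_cong[OF refl refl], unfold eventually_at_filter, intro always_eventually allI impI)
    fix y assume "y \<noteq> x"
    then have "(f y - f x) - (y - x) *\<^sub>R f' = (y - x) *\<^sub>R ((1 / (y - x)) *\<^sub>R (f y - f x) - f')"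
      by (simp add: scaleR_diff_right)
    then show "norm ((f y - f x) - (y - x) *\<^sub>R f') / norm (y - x) = norm ((1 / (y - x)) *\<^sub>R (f y - f x) - f')"
      using \<open>y \<noteq> x\<close> by simp
  qed
  also have "\<dots> \<longleftrightarrow> ((\<lambda>y. (1 / (y - x)) *\<^sub>R (f y - f x)) \<longlongrightarrow> f') (at x)"
    by (simp add: tendsto_norm_zero_iff LIM_zero_iff)
  finally show ?thesis .
qed

lemma nonvanishing_constant_sign:
  fixes f :: "real \<Rightarrow> real"
  assumes "continuous_on UNIV f" "\<And>s. f s \<noteq> 0"
  shows "(\<forall>s. 0 < f s) \<or> (\<forall>s. f s < 0)"
proof (rule ccontr)
  assume "\<not> ?thesis"
  then obtain a b where "f a \<le> 0" "0 \<le> f b" by (meson not_less)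
  moreover have "connected (range f)" using assms(1) by (intro connected_continuous_image) auto
  ultimately have "0 \<in> range f" using connectedD_interval[of "range f" "f a" "f b" 0] by auto
  then show False using assms(2) by auto
qed

locale convex_smooth_curve =
  fixes c :: "real \<Rightarrow> complex"
  assumes curve: "smooth_simple_closed_curve c" and convex: "convex_curve c"
begin

abbreviation N where "N s \<equiv> outer_normal c (c s)"
abbreviation c' where "c' s \<equiv> vector_derivative c (at s)"
abbreviation region where "region \<equiv> inside (path_image c)"

lemma convex_region: "convex region" "convex (closure region)"
  using convex by (auto simp: convex_curve_def intro: convex_closure)

lemma closure_region: "closure region = region \<union> path_image c"
  using curve_Jordan(8)[OF curve] by (simp add: closure_Un_frontier)

lemma on_closure: "c s \<in> closure region"
  using closure_region curve_range[OF curve] by auto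

text \<open>
  A linear functional that is maximal over the closed region at \<open>c s\<close> is maximal along the
  curve, hence vanishes on the tangent; its sign is decided by the points \<open>c s - t N s\<close> of the region.
\<close>

lemma support_is_normal:
  assumes a: "\<And>z. z \<in> closure region \<Longrightarrow> a \<bullet> (z - c s) \<le> 0"
  shows "a = norm a *\<^sub>R N s"
proof -
  have "((\<lambda>x. a \<bullet> (c x - c s)) has_real_derivative a \<bullet> c' s) (at s)"
    unfolding has_real_derivative_iff_has_vector_derivative
    by (intro bounded_linear.has_vector_derivative[OF bounded_linear_inner_right])
      (auto intro!: derivative_eq_intros curve_deriv[OF curve])
  moreover have "a \<bullet> (c x - c s) \<le> a \<bullet> (c s - c s)" for x using a[OF on_closure] by simp
  ultimately have "a \<bullet> c' s = 0"
    by (intro DERIV_local_max[of "\<lambda>x. a \<bullet> (c x - c s)" _ s 1]) auto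
  then have aN: "a = (a \<bullet> N s) *\<^sub>R N s"
    using plane_parallel[OF curve_deriv_nonzero[OF curve] outer_normal_properties(2)[OF curve] outer_normal_properties(1)[OF curve]]
    by blast
  obtain e where e: "e > 0" "\<And>t. 0 < t \<Longrightarrow> t < e \<Longrightarrow> c s - t *\<^sub>R N s \<in> region"
    using outer_normal_properties(3)[OF curve] by blast
  have "c s - (e/2) *\<^sub>R N s \<in> closure region" using e closure_region by auto
  from a[OF this] have "0 \<le> a \<bullet> N s" using e(1) by (simp add: zero_le_mult_iff)
  moreover have "norm a = \<bar>a \<bullet> N s\<bar>" using arg_cong[OF aN, of norm] by (simp add: outer_normal_properties(1)[OF curve])
  ultimately show ?thesis using aN by simp
qed

lemma normal_supports:
  assumes "z \<in> closure region" shows "N s \<bullet> (z - c s) \<le> 0"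
proof -
  have "c s \<in> path_image c" using curve_range[OF curve] by simp
  then have "c s \<notin> region" using inside_no_overlap[of "path_image c"] by blast
  then have "c s \<notin> rel_interior region" by (simp add: rel_interior_open[OF curve_Jordan(2)[OF curve]])
  then obtain a where a: "a \<noteq> 0" "\<And>y. y \<in> closure region \<Longrightarrow> a \<bullet> c s \<le> a \<bullet> y"
    and "\<And>y. y \<in> rel_interior region \<Longrightarrow> a \<bullet> c s < a \<bullet> y"
    using supporting_hyperplane_relative_frontier[OF convex_region(1) on_closure[of s]] by metis
  have "- a = norm (- a) *\<^sub>R N s"
    by (rule support_is_normal) (use a in \<open>simp add: inner_diff_right\<close>)
  moreover have "(- a) \<bullet> (z - c s) \<le> 0" using a(2)[OF assms] by (simp add: inner_diff_right)
  ultimately have "(norm a *\<^sub>R N s) \<bullet> (z - c s) \<le> 0" by (metis norm_minus_cancel)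
  then show ?thesis using a(1) by (simp add: mult_le_0_iff)
qed

lemma normal_supports_strictly:
  assumes "z \<in> region" shows "N s \<bullet> (z - c s) < 0"
proof -
  obtain e where e: "e > 0" "ball z e \<subseteq> region"
    using assms curve_Jordan(2)[OF curve] open_contains_ball by blast
  have n: "norm (N s) = 1" by (rule outer_normal_properties(1)[OF curve])
  have "z + (e/2) *\<^sub>R N s \<in> closure region"
    using e n closure_region by (intro UnI1[THEN subsetD[OF equalityD2[OF closure_region]]] subsetD[OF e(2)]) (simp add: dist_norm)
  from normal_supports[OF this, of s] have "N s \<bullet> (z - c s) + (e/2) * (N s \<bullet> N s) \<le> 0"
    by (simp add: inner_diff_right inner_add_right algebra_simps)
  then show ?thesis using e n by (simp add: dot_square_norm)
qed

text \<open>
  A point \<open>x + t N\<^sub>x\<close> with \<open>t \<ge> 0\<close> has \<open>x\<close> as its nearest point in the closed convex region;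
  adding the two support inequalities gives the uniqueness directly.
\<close>

lemma normal_ray_unique:
  assumes "0 \<le> t" "0 \<le> t'" "c s + t *\<^sub>R N s = c s' + t' *\<^sub>R N s'"
  shows "c s = c s' \<and> t = t'"
proof -
  let ?p = "c s + t *\<^sub>R N s"
  have 1: "(?p - c s) \<bullet> (c s' - c s) \<le> 0"
    using assms(1) normal_supports[OF on_closure, of s s'] by (simp add: mult_nonneg_nonpos)
  have 2: "(?p - c s') \<bullet> (c s - c s') \<le> 0"
    using assms(2) normal_supports[OF on_closure, of s' s] unfolding assms(3) by (simp add: mult_nonneg_nonpos)
  have "(c s - c s') \<bullet> (c s - c s') = (?p - c s') \<bullet> (c s - c s') + (?p - c s) \<bullet> (c s' - c s)"
    by (simp add: inner_diff_right inner_diff_left inner_add_left inner_commute algebra_simps)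
  then have "(c s - c s') \<bullet> (c s - c s') \<le> 0" using 1 2 by linarith
  then have eq: "c s = c s'" by (metis antisym inner_eq_zero_iff inner_ge_zero right_minus_eq)
  then have "t *\<^sub>R N s = t' *\<^sub>R N s" using assms by simp
  then have "t = t'" using outer_normal_properties(1)[OF curve, of s] by auto
  then show ?thesis using eq by simp
qed

text \<open>
  The vector from the nearest point of the closed region to \<open>p\<close> supports the region there, hence is a
  multiple of the normal.
\<close>

lemma normal_ray_exists:
  assumes "p \<notin> region"
  obtains s t where "0 \<le> t" "p = c s + t *\<^sub>R N s" "closest_point (closure region) p = c s"
proof -
  let ?K = "closure region"
  define q where "q = closest_point ?K p"
  have ne: "?K \<noteq> {}" using on_closure[of 0] by (metis empty_iff)
  have q: "q \<in> ?K" unfolding q_def by (rule closest_point_in_set[OF closed_closure ne])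
  have dot: "(p - q) \<bullet> (z - q) \<le> 0" if "z \<in> ?K" for z
    unfolding q_def by (rule closest_point_dot[OF convex_region(2) closed_closure that])
  have "q \<notin> region"
  proof
    assume "q \<in> region"
    then obtain e where e: "e > 0" "ball q e \<subseteq> region" using curve_Jordan(2)[OF curve] open_contains_ball by blast
    define d where "d = (e / (2 * norm (p - q))) *\<^sub>R (p - q)"
    have pq: "p \<noteq> q" using \<open>q \<in> region\<close> assms by auto
    have "norm d = e / 2" using e(1) pq by (simp add: d_def)
    then have "q + d \<in> ball q e" using e(1) by (simp add: dist_norm)
    then have "q + d \<in> ?K" using e(2) closure_subset by blast
    from dot[OF this] have "(e / (2 * norm (p - q))) * ((p - q) \<bullet> (p - q)) \<le> 0" by (simp add: d_def)
    moreover have "0 < (e / (2 * norm (p - q))) * ((p - q) \<bullet> (p - q))" using e(1) pq by simp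
    ultimately show False by simp
  qed
  then obtain s where s: "q = c s" using q closure_region curve_range[OF curve] by auto
  have "p - q = norm (p - q) *\<^sub>R N s"
    by (rule support_is_normal) (use dot s in auto)
  moreover have "p = q + (p - q)" by simp
  ultimately have "p = c s + norm (p - q) *\<^sub>R N s" using s by (simp only:)
  then show ?thesis using that[of "norm (p - q)" s] s q_def by simp
qed

lemma normal_ray_closest_point:
  assumes "0 \<le> t" shows "closest_point (closure region) (c s + t *\<^sub>R N s) = c s"
proof -
  have n: "norm (N s) = 1" by (rule outer_normal_properties(1)[OF curve])
  have "c s + t *\<^sub>R N s \<notin> region"
  proof
    assume "c s + t *\<^sub>R N s \<in> region"
    from normal_supports_strictly[OF this, of s] show False using assms n by (simp add: dot_square_norm)
  qed
  then obtain s' t' where "0 \<le> t'" "c s + t *\<^sub>R N s = c s' + t' *\<^sub>R N s'"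
    "closest_point (closure region) (c s + t *\<^sub>R N s) = c s'" by (rule normal_ray_exists)
  then show ?thesis using normal_ray_unique assms by metis
qed

text \<open>
  Up to sign, \<open>N\<close> is the unit tangent rotated by a right angle. The sign is constant along the
  curve: for a fixed point \<open>z\<close> of the region, \<open>N s \<bullet> (z - c s)\<close> is never zero. The derivative of a
  unit vector field is orthogonal to it, hence tangential, and the factor \<open>k\<close> is the curvature. It
  is nonnegative because the normal map of a convex region is monotone:
  \<open>(N y - N s) \<bullet> (c y - c s) \<ge> 0\<close>.
\<close>

lemma normal_C1:
  obtains k where "continuous_on UNIV k" "\<And>s. 0 \<le> k s"
    "\<And>s. ((\<lambda>s. N s) has_vector_derivative k s *\<^sub>R c' s) (at s)"
proof -
  define n where "n = (\<lambda>s. norm (c' s))"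
  define c'' where "c'' = (\<lambda>s. vector_derivative c' (at s))"
  define \<nu> where "\<nu> = (\<lambda>s. \<i> * (inverse (n s) *\<^sub>R c' s))"
  note c'0 = curve_deriv_nonzero[OF curve]
  have n0: "n s \<noteq> 0" for s using c'0 by (simp add: n_def)
  have c''d: "(c' has_vector_derivative c'' s) (at s)" for s
    unfolding c''_def by (rule curve_deriv2[OF curve])
  have nd: "(n has_real_derivative (c'' s \<bullet> sgn (c' s))) (at s)" for s
    unfolding n_def has_real_derivative_iff_has_vector_derivative
    by (rule has_vector_derivative_compose_has_derivative[OF c''d has_derivative_norm[OF c'0]])
  \<comment> \<open>the derivative of \<open>\<nu>\<close> by the quotient rule\<close>
  define \<nu>' where "\<nu>' = (\<lambda>s. \<i> * (inverse (n s) *\<^sub>R c'' s + (- (c'' s \<bullet> sgn (c' s)) / (n s)\<^sup>2) *\<^sub>R c' s))"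
  have \<nu>d: "(\<nu> has_vector_derivative \<nu>' s) (at s)" for s
  proof -
    have "((\<lambda>s. inverse (n s)) has_real_derivative (- (c'' s \<bullet> sgn (c' s)) / (n s)\<^sup>2)) (at s)"
      using DERIV_inverse_fun[OF nd n0, of s] by (simp add: divide_inverse power2_eq_square)
    from has_vector_derivative_scaleR[OF this c''d]
    have "((\<lambda>s. inverse (n s) *\<^sub>R c' s) has_vector_derivative (inverse (n s) *\<^sub>R c'' s + (- (c'' s \<bullet> sgn (c' s)) / (n s)\<^sup>2) *\<^sub>R c' s)) (at s)" .
    then show ?thesis unfolding \<nu>_def \<nu>'_def
      by (rule bounded_linear.has_vector_derivative[OF bounded_linear_mult_right])
  qed
  have cc: "continuous_on UNIV c'" "continuous_on UNIV c''" "continuous_on UNIV c" 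
    unfolding c''_def using curve_continuous[OF curve] curve_cont2[OF curve] by auto
  have cn: "continuous_on UNIV n" unfolding n_def by (intro continuous_intros cc)
  have csgn: "continuous_on UNIV (\<lambda>s. sgn (c' s))"
    unfolding sgn_div_norm using cn n0 by (intro continuous_intros cc) (auto simp: n_def)
  have c\<nu>': "continuous_on UNIV \<nu>'" unfolding \<nu>'_def using n0
    by (intro continuous_intros cc cn csgn) auto
  have c\<nu>: "continuous_on UNIV \<nu>" unfolding \<nu>_def using n0
    by (intro continuous_intros cc cn) auto
  have \<nu>n: "norm (\<nu> s) = 1" for s using n0[of s] by (simp add: \<nu>_def norm_mult n_def)
  have \<nu>c: "\<nu> s \<bullet> c' s = 0" for s by (simp add: \<nu>_def inner_complex_def algebra_simps)
  have Nn: "norm (N s) = 1" for s by (rule outer_normal_properties(1)[OF curve])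
  have Nc: "N s \<bullet> c' s = 0" for s by (rule outer_normal_properties(2)[OF curve])
  have N\<nu>: "N s = (N s \<bullet> \<nu> s) *\<^sub>R \<nu> s" for s
    by (rule plane_parallel[OF c'0 \<nu>c \<nu>n Nc])
  have N1: "\<bar>N s \<bullet> \<nu> s\<bar> = 1" for s using arg_cong[OF N\<nu>[of s], of norm] by (simp add: Nn \<nu>n)
  obtain z where z: "z \<in> region" using curve_Jordan(1)[OF curve] by blast
  have sgnz: "(N s \<bullet> \<nu> s) * (\<nu> s \<bullet> (z - c s)) < 0" for s
    using normal_supports_strictly[OF z, of s] by (subst (asm) N\<nu>) simp
  then have "\<nu> s \<bullet> (z - c s) \<noteq> 0" for s by (metis less_irrefl mult_zero_right)
  moreover have "continuous_on UNIV (\<lambda>s. \<nu> s \<bullet> (z - c s))" by (intro continuous_intros c\<nu> cc)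
  ultimately have "(\<forall>s. 0 < \<nu> s \<bullet> (z - c s)) \<or> (\<forall>s. \<nu> s \<bullet> (z - c s) < 0)"
    using nonvanishing_constant_sign by blast
  then obtain e where e: "\<And>s. N s = e *\<^sub>R \<nu> s" "\<bar>e\<bar> = 1"
  proof
    assume pos: "\<forall>s. 0 < \<nu> s \<bullet> (z - c s)"
    have "N s \<bullet> \<nu> s = -1" for s using N1[of s] sgnz[of s] spec[OF pos, of s]
      by (simp add: abs_if mult_less_0_iff split: if_splits)
    then show ?thesis using N\<nu> that[of "-1"] by (metis abs_minus_cancel abs_one)
  next
    assume neg: "\<forall>s. \<nu> s \<bullet> (z - c s) < 0"
    have "N s \<bullet> \<nu> s = 1" for s using N1[of s] sgnz[of s] spec[OF neg, of s]
      by (simp add: abs_if mult_less_0_iff split: if_splits)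
    then show ?thesis using N\<nu> that[of 1] by (metis abs_one)
  qed
  define N' where "N' = (\<lambda>s. e *\<^sub>R \<nu>' s)"
  have Nd: "((\<lambda>s. N s) has_vector_derivative N' s) (at s)" for s
    unfolding e(1) N'_def by (rule bounded_linear.has_vector_derivative[OF bounded_linear_scaleR_right \<nu>d])
  have N'N: "N' s \<bullet> N s = 0" for s
  proof -
    have "((\<lambda>s. N s \<bullet> N s) has_vector_derivative (N s \<bullet> N' s + N' s \<bullet> N s)) (at s)"
      by (rule bounded_bilinear.has_vector_derivative[OF bounded_bilinear_inner Nd Nd])
    moreover have "((\<lambda>s. N s \<bullet> N s) has_vector_derivative 0) (at s)"
      using Nn by (simp add: dot_square_norm)
    ultimately show ?thesis using vector_derivative_unique_at by (fastforce simp: inner_commute)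
  qed
  define k where "k = (\<lambda>s. (N' s \<bullet> c' s) / (n s)\<^sup>2)"
  have N'k: "N' s = k s *\<^sub>R c' s" for s
  proof -
    have "N' s = (N' s \<bullet> (inverse (n s) *\<^sub>R c' s)) *\<^sub>R (inverse (n s) *\<^sub>R c' s)"
    proof (rule plane_parallel)
      show "N s \<noteq> 0" using Nn[of s] by auto
      show "(inverse (n s) *\<^sub>R c' s) \<bullet> N s = 0" using Nc[of s] by (simp add: inner_commute)
      show "norm (inverse (n s) *\<^sub>R c' s) = 1" using n0[of s] by (simp add: n_def)
      show "N' s \<bullet> N s = 0" by (rule N'N)
    qed
    then show ?thesis by (simp add: k_def divide_inverse power2_eq_square mult_ac)
  qed
  have "0 \<le> N' s \<bullet> c' s" for s
  proof (rule tendsto_lowerbound)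
    show "((\<lambda>y. ((1 / (y - s)) *\<^sub>R (N y - N s)) \<bullet> ((1 / (y - s)) *\<^sub>R (c y - c s))) \<longlongrightarrow> N' s \<bullet> c' s) (at s)"
      using Nd[of s] curve_deriv[OF curve, of s] unfolding has_vector_derivative_iff_quotient by (rule tendsto_inner)
    have "0 \<le> ((1 / (y - s)) *\<^sub>R (N y - N s)) \<bullet> ((1 / (y - s)) *\<^sub>R (c y - c s))" for y
    proof -
      have "(N y - N s) \<bullet> (c y - c s) = - (N y \<bullet> (c s - c y)) - N s \<bullet> (c y - c s)"
        by (simp add: inner_diff_right inner_diff_left)
      then have "0 \<le> (N y - N s) \<bullet> (c y - c s)"
        using normal_supports[OF on_closure, of y s] normal_supports[OF on_closure, of s y] by linarith
      then show ?thesis by simp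
    qed
    then show "\<forall>\<^sub>F y in at s. 0 \<le> ((1 / (y - s)) *\<^sub>R (N y - N s)) \<bullet> ((1 / (y - s)) *\<^sub>R (c y - c s))" by simp
  qed simp
  then have k0: "0 \<le> k s" for s by (simp add: k_def)
  have "continuous_on UNIV k" unfolding k_def N'_def using n0
    by (intro continuous_intros c\<nu>' cc cn) auto
  then show ?thesis using that[of k] k0 Nd N'k by metis
qed

end

section \<open>The normal rays of a starlike annulus\<close>

lemma inside_along_ray:
  fixes p n :: "'a::real_normed_vector"
  assumes "p \<in> inside S" "0 \<le> t" "\<And>u. 0 \<le> u \<Longrightarrow> u \<le> t \<Longrightarrow> p + u *\<^sub>R n \<notin> S"
  shows "p + t *\<^sub>R n \<in> inside S"
proof -
  let ?I = "(\<lambda>u. p + u *\<^sub>R n) ` {0..t}"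
  have "connected ?I" by (intro connected_continuous_image continuous_intros) auto
  moreover have "p \<in> ?I" using assms(2) by (intro image_eqI[of _ _ 0]) auto
  moreover have "p + t *\<^sub>R n \<in> ?I" using assms(2) by (intro image_eqI[of _ _ t]) auto
  moreover have "?I \<subseteq> - S" using assms(3) by auto
  ultimately have "connected_component (- S) p (p + t *\<^sub>R n)"
    unfolding connected_component_def by blast
  then show ?thesis using inside_same_component assms(1) by metis
qed

lemma ray_leaves_bounded_inside:
  fixes p n :: "'a::real_normed_vector"
  assumes "p \<in> inside S" "norm n = 1" "bounded (inside S)"
  obtains t where "0 \<le> t" "p + t *\<^sub>R n \<in> S"
proof (rule ccontr)
  assume no: "\<not> thesis"
  then have all: "p + t *\<^sub>R n \<in> inside S" if "0 \<le> t" for t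
    using inside_along_ray[OF assms(1) that] that(1) \<open>\<And>t. 0 \<le> t \<Longrightarrow> p + t *\<^sub>R n \<in> S \<Longrightarrow> thesis\<close> by blast
  obtain B where B: "0 < B" "\<And>x. x \<in> inside S \<Longrightarrow> norm x \<le> B" using assms(3) bounded_pos by metis
  define t where "t = B + norm p + 1"
  have "t = norm (t *\<^sub>R n)" using B(1) by (simp add: t_def assms(2) add_nonneg_nonneg)
  also have "\<dots> \<le> norm (p + t *\<^sub>R n) + norm p" using norm_triangle_ineq4[of "p + t *\<^sub>R n" p] by simp
  also have "\<dots> \<le> B + norm p" using B(2)[OF all[of t]] B(1) by (simp add: t_def add_nonneg_nonneg)
  finally show False by (simp add: t_def)
qed

locale convex_starlike =
  fixes \<Omega> :: "complex set" and c1 c2 :: "real \<Rightarrow> complex"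
  assumes ann: "annulus \<Omega> c1 c2"
    and convex1: "convex_curve c1"
    and star: "strictly_starlike_annulus c1 c2"
begin

lemma curve1: "smooth_simple_closed_curve c1" and curve2: "smooth_simple_closed_curve c2"
  using ann by (auto simp: annulus_def)

sublocale convex_smooth_curve c1
  by unfold_locales (rule curve1 convex1)+

abbreviation Q where "Q s \<equiv> ray_foot c1 c2 (c1 s)"
abbreviation r where "r s \<equiv> ray_length c1 c2 (c1 s)"

lemma on_curve1: "c1 s \<in> path_image c1" and on_curve2: "c2 s \<in> path_image c2"
  using curve_range[OF curve1] curve_range[OF curve2] by auto

lemma N_unit: "norm (N s) = 1"
  by (rule outer_normal_properties(1)[OF curve1])

lemma curve1_inside: "c1 s \<in> inside (path_image c2)"
  using ann on_curve1 by (auto simp: annulus_def)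

text \<open>
  The ray starts inside \<open>c2\<close> and is unbounded, so the set of its hitting times is nonempty; it is
  closed, so the infimum in the definition of the foot is attained.
\<close>

lemma foot:
  shows foot_eq: "Q s = c1 s + r s *\<^sub>R N s"
    and foot_on_curve2: "Q s \<in> path_image c2"
    and ray_length_pos: "0 < r s"
    and foot_first: "0 \<le> t \<Longrightarrow> t < r s \<Longrightarrow> c1 s + t *\<^sub>R N s \<notin> path_image c2"
proof -
  define H where "H = {t. 0 \<le> t \<and> c1 s + t *\<^sub>R N s \<in> path_image c2}"
  have "H \<noteq> {}"
    using ray_leaves_bounded_inside[OF curve1_inside N_unit curve_Jordan(5)[OF curve2]] unfolding H_def by blast
  moreover have "closed H"
  proof -
    have "H = {0..} \<inter> (\<lambda>t. c1 s + t *\<^sub>R N s) -` path_image c2" by (auto simp: H_def)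
    moreover have "closed (path_image c2)"
      using curve_simple(1)[OF curve2] by (simp add: closed_simple_path_image)
    ultimately show ?thesis by (auto intro!: closed_Int closed_vimage continuous_intros)
  qed
  moreover have bdd: "bdd_below H" unfolding H_def by (rule bdd_belowI[of _ 0]) auto
  ultimately have Inf: "Inf H \<in> H" using closed_contains_Inf by blast
  have Q: "Q s = c1 s + Inf H *\<^sub>R N s"
    by (simp add: ray_foot_def normal_ray_def H_def)
  have rI: "r s = Inf H"
    unfolding ray_length_def Q using Inf by (simp add: dist_norm N_unit H_def)
  show "Q s = c1 s + r s *\<^sub>R N s" using Q rI by simp
  show "Q s \<in> path_image c2" using Q Inf by (simp add: H_def)
  have "r s \<noteq> 0"
  proof
    assume "r s = 0"
    then have "c1 s \<in> path_image c2" using Inf rI by (simp add: H_def)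
    then show False using curve1_inside[of s] inside_no_overlap[of "path_image c2"] by blast
  qed
  then show "0 < r s" using Inf rI by (simp add: H_def)
  show "c1 s + t *\<^sub>R N s \<notin> path_image c2" if "0 \<le> t" "t < r s"
    using cInf_lower[OF _ bdd, of t] that rI by (force simp: H_def)
qed

text \<open>
  A second hit would be the foot of another ray, since the feet exhaust the outer curve, but two
  different rays are disjoint.
\<close>

lemma ray_hits_once:
  assumes "0 \<le> t" "c1 s + t *\<^sub>R N s \<in> path_image c2"
  shows "t = r s"
proof -
  have "path_image c2 = ray_foot c1 c2 ` path_image c1"
    using star by (auto simp: strictly_starlike_annulus_def starlike_annulus_def bij_betw_def)
  then obtain s' where "c1 s + t *\<^sub>R N s = Q s'" using assms(2) curve_range[OF curve1] by auto
  then have "c1 s = c1 s' \<and> t = r s'"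
    using normal_ray_unique[OF assms(1), of "r s'" s s'] foot_eq[of s'] ray_length_pos[of s'] by simp
  then show ?thesis by simp
qed

lemma normal_point_in_gap:
  assumes "0 < t" "t < r s"
  shows "c1 s + t *\<^sub>R N s \<in> inside (path_image c2) \<inter> outside (path_image c1)"
proof
  show "c1 s + t *\<^sub>R N s \<in> inside (path_image c2)"
    by (rule inside_along_ray[OF curve1_inside]) (use assms foot_first in auto)
  have "c1 s + t *\<^sub>R N s \<notin> closure region"
    using normal_supports[of "c1 s + t *\<^sub>R N s" s] assms(1) by (auto simp: dot_square_norm N_unit)
  then show "c1 s + t *\<^sub>R N s \<in> outside (path_image c1)"
    using closure_region curve_Jordan(7)[OF curve1] by blast
qed

lemma gap_subset: "inside (path_image c2) \<inter> outside (path_image c1) \<subseteq> \<Omega>"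
proof -
  have "\<Omega> = (path_image c2 \<union> inside (path_image c2)) - region" using ann by (simp add: annulus_def)
  then show ?thesis using curve_Jordan(6)[OF curve1] by blast
qed

lemma gap_interior: "inside (path_image c2) \<inter> outside (path_image c1) \<subseteq> interior \<Omega>"
  by (intro interior_maximal gap_subset open_Int curve_Jordan(2)[OF curve2] curve_Jordan(4)[OF curve1])

lemma compact_annulus: "compact \<Omega>"
proof -
  have cl: "closure (inside (path_image c2)) = inside (path_image c2) \<union> path_image c2"
    using curve_Jordan(8)[OF curve2] by (simp add: closure_Un_frontier)
  have "\<Omega> = closure (inside (path_image c2)) - inside (path_image c1)"
    using ann unfolding cl by (auto simp: annulus_def)
  then show ?thesis
    using curve_Jordan(5)[OF curve2] curve_Jordan(2)[OF curve1]
    by (simp add: compact_diff)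
qed

lemma normal_point_in_annulus:
  assumes "0 \<le> t" "t \<le> r s" shows "c1 s + t *\<^sub>R N s \<in> \<Omega>"
proof -
  consider "t = 0" | "t = r s" | "0 < t" "t < r s" using assms by linarith
  then show ?thesis
  proof cases
    case 1
    have "c1 s \<notin> region" using on_curve1 inside_no_overlap[of "path_image c1"] by blast
    then show ?thesis using ann curve1_inside 1 by (auto simp: annulus_def)
  next
    case 2
    have "Q s \<notin> region"
    proof
      assume "Q s \<in> region"
      then have "N s \<bullet> (Q s - c1 s) < 0" by (rule normal_supports_strictly)
      then show False using foot_eq[of s] ray_length_pos[of s] by (simp add: dot_square_norm N_unit)
    qed
    then show ?thesis using ann foot_on_curve2[of s] foot_eq[of s] 2 by (auto simp: annulus_def)
  next
    case 3 then show ?thesis using normal_point_in_gap gap_subset by blast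
  qed
qed

text \<open>
  The point lies on the ray from its nearest point on the inner curve. Beyond the foot it could not lie
  inside \<open>c2\<close>: the ray would have to hit \<open>c2\<close> again.
\<close>

lemma annulus_normal_point:
  assumes "p \<in> \<Omega>"
  obtains s t where "0 \<le> t" "t \<le> r s" "p = c1 s + t *\<^sub>R N s"
proof -
  have "p \<notin> region" and p: "p \<in> path_image c2 \<or> p \<in> inside (path_image c2)"
    using assms ann by (auto simp: annulus_def)
  then obtain s t where st: "0 \<le> t" "p = c1 s + t *\<^sub>R N s" using normal_ray_exists by metis
  have "t \<le> r s"
    using p
  proof
    assume "p \<in> path_image c2" then show ?thesis using ray_hits_once st by auto
  next
    assume "p \<in> inside (path_image c2)"
    then obtain u where u: "0 \<le> u" "p + u *\<^sub>R N s \<in> path_image c2"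
      using ray_leaves_bounded_inside[OF _ N_unit curve_Jordan(5)[OF curve2]] by metis
    then have "c1 s + (t + u) *\<^sub>R N s \<in> path_image c2" by (simp add: st(2) algebra_simps)
    then have "t + u = r s" using ray_hits_once[of "t + u" s] u(1) st(1) by simp
    then show ?thesis using u(1) by simp
  qed
  then show ?thesis using that st by blast
qed

lemma foot_inj: "Q s = Q s' \<Longrightarrow> c1 s = c1 s'"
  using normal_ray_unique[of "r s" "r s'" s s'] foot_eq[of s] foot_eq[of s'] ray_length_pos[of s] ray_length_pos[of s']
  by simp

lemma foot_surj: 
  assumes "y \<in> path_image c2" obtains s where "y = Q s"
proof -
  have "path_image c2 = ray_foot c1 c2 ` path_image c1"
    using star by (auto simp: strictly_starlike_annulus_def starlike_annulus_def bij_betw_def)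
  then show ?thesis using assms that curve_range[OF curve1] by auto
qed

lemma closest_point_foot: "closest_point (closure region) (Q s) = c1 s"
  unfolding foot_eq by (rule normal_ray_closest_point) (use ray_length_pos[of s] in simp)

text \<open>
  The foot map is the inverse of the nearest-point projection, a continuous injection of the compact
  outer curve onto the inner curve.
\<close>

lemma foot_continuous: "continuous_on S (\<lambda>s. Q s)"
proof -
  let ?\<pi> = "closest_point (closure region)"
  have ne: "closure region \<noteq> {}" using on_closure[of 0] by (metis empty_iff)
  have im: "?\<pi> ` path_image c2 = path_image c1"
  proof
    show "?\<pi> ` path_image c2 \<subseteq> path_image c1"
    proof
      fix x assume "x \<in> ?\<pi> ` path_image c2"
      then obtain y where "y \<in> path_image c2" "x = ?\<pi> y" by blast
      then obtain s where "x = ?\<pi> (Q s)" using foot_surj by metis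
      then show "x \<in> path_image c1" by (simp add: closest_point_foot on_curve1)
    qed
    show "path_image c1 \<subseteq> ?\<pi> ` path_image c2"
    proof
      fix x assume "x \<in> path_image c1"
      then obtain s where s: "x = c1 s" using curve_range[OF curve1] by auto
      show "x \<in> ?\<pi> ` path_image c2"
        by (rule image_eqI[where x = "Q s"]) (simp_all add: s closest_point_foot foot_on_curve2)
    qed
  qed
  have "continuous_on (?\<pi> ` path_image c2) (ray_foot c1 c2)"
  proof (rule continuous_on_inv)
    show "continuous_on (path_image c2) ?\<pi>"
      by (rule continuous_on_closest_point[OF convex_region(2) closed_closure ne])
    show "compact (path_image c2)" using curve_simple(1)[OF curve2] by (simp add: compact_simple_path_image)
    show "\<forall>y\<in>path_image c2. ray_foot c1 c2 (?\<pi> y) = y"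
    proof
      fix y assume "y \<in> path_image c2"
      then obtain s where "y = Q s" by (rule foot_surj)
      then show "ray_foot c1 c2 (?\<pi> y) = y" by (simp add: closest_point_foot)
    qed
  qed
  then have "continuous_on (path_image c1) (ray_foot c1 c2)" by (simp add: im)
  then show ?thesis
    by (rule continuous_on_compose2[OF _ curve_continuous(1)[OF curve1]]) (use on_curve1 in auto)
qed

lemma ray_length_bounds: "0 \<le> min_ray c1 c2" "min_ray c1 c2 \<le> r s" "r s \<le> max_ray c1 c2"
proof -
  show "0 \<le> min_ray c1 c2" unfolding min_ray_def
    by (rule cINF_greatest) (use on_curve1 in \<open>auto simp: ray_length_def\<close>)
  show "min_ray c1 c2 \<le> r s" unfolding min_ray_def
    by (rule cINF_lower[OF _ on_curve1]) (auto simp: ray_length_def intro!: bdd_belowI2[of _ 0])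
  have "bounded (path_image c1)" "bounded (path_image c2)"
    using curve_simple(1)[OF curve1] curve_simple(1)[OF curve2] by (simp_all add: bounded_simple_path_image)
  then have "bounded (path_image c1 \<union> path_image c2)" by simp
  then obtain e where e: "\<And>x y. x \<in> path_image c1 \<union> path_image c2 \<Longrightarrow> y \<in> path_image c1 \<union> path_image c2 \<Longrightarrow> dist x y \<le> e"
    unfolding bounded_two_points by blast
  have "ray_length c1 c2 x \<le> e" if "x \<in> path_image c1" for x
    using that e foot_on_curve2 curve_range[OF curve1] unfolding ray_length_def by auto
  then have "bdd_above (ray_length c1 c2 ` path_image c1)" by (rule bdd_aboveI2)
  then show "r s \<le> max_ray c1 c2" unfolding max_ray_def by (rule cSUP_upper[OF on_curve1])
qed

lemma max_ray_pos: "0 < max_ray c1 c2"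
  using ray_length_pos[of 0] ray_length_bounds(3)[of 0] by linarith

lemma cos_ray_angle: "cos (ray_angle c1 c2 (c1 s)) = N s \<bullet> outer_normal c2 (Q s)"
proof -
  obtain x where x: "Q s = c2 x" using foot_on_curve2[of s] curve_range[OF curve2] by auto
  have "\<bar>N s \<bullet> outer_normal c2 (Q s)\<bar> \<le> 1"
    using Cauchy_Schwarz_ineq2[of "N s" "outer_normal c2 (Q s)"] outer_normal_properties(1)[OF curve2, of x]
    by (simp add: N_unit x)
  then show ?thesis by (simp add: ray_angle_def cos_arccos_abs)
qed

lemma min_cos_bounds: "0 < min_cos c1 c2" "min_cos c1 c2 \<le> N s \<bullet> outer_normal c2 (Q s)" "min_cos c1 c2 \<le> 1"
proof -
  show "0 < min_cos c1 c2" using star by (simp add: strictly_starlike_annulus_def)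
  have le: "min_cos c1 c2 \<le> cos (ray_angle c1 c2 (c1 s))" for s
    unfolding min_cos_def by (rule cINF_lower[OF _ on_curve1]) (auto intro!: bdd_belowI2[of _ "-1"])
  show "min_cos c1 c2 \<le> N s \<bullet> outer_normal c2 (Q s)" using le[of s] by (simp add: cos_ray_angle)
  show "min_cos c1 c2 \<le> 1" using le[of 0] cos_le_one order_trans by blast
qed

end

section \<open>Regularity of the foot of the normal ray\<close>

text \<open>
  Implicit differentiation of \<open>(c(\<phi>(s)) - w(s)) \<bullet> v(s) = 0\<close> when only the continuity of \<open>\<phi>\<close> is
  known: the difference quotient \<open>D\<close> of \<open>c\<close>, completed by \<open>D(\<phi>(s0)) = d\<close>, is continuous, and
  the equation can be solved for the difference quotient of \<open>\<phi>\<close>.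
\<close>

lemma implicit_real_derivative:
  fixes c v w :: "real \<Rightarrow> 'a::real_inner"
  assumes c: "(c has_vector_derivative d) (at (\<phi> s0))" and \<phi>: "isCont \<phi> s0"
    and v: "isCont v s0" and d: "d \<bullet> v s0 \<noteq> 0"
    and eq: "\<forall>\<^sub>F s in at s0. (c (\<phi> s) - w s) \<bullet> v s = 0" "(c (\<phi> s0) - w s0) \<bullet> v s0 = 0"
    and G: "((\<lambda>s. (c (\<phi> s0) - w s) \<bullet> v s) has_real_derivative G') (at s0)"
  shows "(\<phi> has_real_derivative (- G' / (d \<bullet> v s0))) (at s0)"
proof -
  let ?x = "\<phi> s0"
  define D where "D = (\<lambda>\<sigma>. if \<sigma> = ?x then d else (1 / (\<sigma> - ?x)) *\<^sub>R (c \<sigma> - c ?x))"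
  have "((\<lambda>\<sigma>. (1 / (\<sigma> - ?x)) *\<^sub>R (c \<sigma> - c ?x)) \<longlongrightarrow> d) (at ?x)"
    using c by (simp add: has_vector_derivative_iff_quotient)
  moreover have "\<forall>\<^sub>F \<sigma> in at ?x. (1 / (\<sigma> - ?x)) *\<^sub>R (c \<sigma> - c ?x) = D \<sigma>"
    by (auto simp: D_def eventually_at_filter)
  ultimately have "(D \<longlongrightarrow> d) (at ?x)" by (rule Lim_transform_eventually)
  then have "isCont D ?x" by (simp add: isCont_def D_def)
  then have cD: "isCont (\<lambda>s. D (\<phi> s)) s0" using \<phi> isCont_o2 by blast
  have D: "c \<sigma> - c ?x = (\<sigma> - ?x) *\<^sub>R D \<sigma>" for \<sigma> by (simp add: D_def)
  define E where "E = (\<lambda>s. D (\<phi> s) \<bullet> v s)"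
  have "isCont E s0" unfolding E_def using cD v by (intro continuous_intros)
  then have E: "(E \<longlongrightarrow> d \<bullet> v s0) (at s0)" by (simp add: isCont_def E_def D_def)
  then have E0: "\<forall>\<^sub>F s in at s0. E s \<noteq> 0" using d tendsto_imp_eventually_ne by blast
  define G where "G = (\<lambda>s. (c ?x - w s) \<bullet> v s)"
  have "((\<lambda>s. (G s - G s0) / (s - s0)) \<longlongrightarrow> G') (at s0)"
    using assms(7) by (simp add: has_field_derivative_iff G_def)
  then have "((\<lambda>s. - ((G s - G s0) / (s - s0)) / E s) \<longlongrightarrow> - G' / (d \<bullet> v s0)) (at s0)"
    by (intro tendsto_divide tendsto_minus E d)
  moreover have "\<forall>\<^sub>F s in at s0. - ((G s - G s0) / (s - s0)) / E s = (\<phi> s - \<phi> s0) / (s - s0)"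
    using eq(1) E0
  proof eventually_elim
    case (elim s)
    have "(c (\<phi> s) - w s) \<bullet> v s = (c (\<phi> s) - c ?x) \<bullet> v s + G s"
      by (simp add: G_def inner_diff_left)
    then have "G s = - ((\<phi> s - ?x) * E s)" using elim(1) by (simp add: D E_def)
    moreover have "G s0 = 0" using eq(2) by (simp add: G_def)
    ultimately show ?case using elim(2) by simp
  qed
  ultimately have "((\<lambda>s. (\<phi> s - \<phi> s0) / (s - s0)) \<longlongrightarrow> - G' / (d \<bullet> v s0)) (at s0)"
    by (rule Lim_transform_eventually)
  then show ?thesis by (simp add: has_field_derivative_iff)
qed

text \<open>
  On a period the curve is injective away from the end points, so the image of the parameters at
  distance at least \<open>e\<close> from \<open>\<phi> s0\<close> is a compact set that does not contain \<open>g s0\<close>.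
\<close>

lemma curve_parameter_isCont:
  fixes \<phi> :: "real \<Rightarrow> real"
  assumes c: "smooth_simple_closed_curve c" and g: "isCont g s0"
    and S: "open S" "s0 \<in> S" "\<And>s. s \<in> S \<Longrightarrow> c (\<phi> s) = g s"
      "\<And>s. s \<in> S \<Longrightarrow> a < \<phi> s" "\<And>s. s \<in> S \<Longrightarrow> \<phi> s < a + 1"
  shows "isCont \<phi> s0"
  unfolding continuous_at_eps_delta
proof (intro allI impI)
  fix e :: real assume e: "0 < e"
  define K where "K = c ` ({a..a + 1} - ball (\<phi> s0) e)"
  have "compact K" unfolding K_def
    by (intro compact_continuous_image curve_continuous[OF c] compact_diff) auto
  moreover have "g s0 \<notin> K"
  proof
    assume "g s0 \<in> K"
    then obtain x where x: "c x = c (\<phi> s0)" "a \<le> x" "x \<le> a + 1" "x \<notin> ball (\<phi> s0) e"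
      unfolding K_def using S by auto
    then have "x = \<phi> s0" using S by (intro curve_inj[OF c _ x(1)]) (force simp: abs_if)
    then show False using x e by simp
  qed
  ultimately obtain \<rho> where \<rho>: "0 < \<rho>" "\<And>p. p \<in> K \<Longrightarrow> \<rho> \<le> dist (g s0) p"
    using separate_point_closed[of K "g s0"] compact_imp_closed by (metis dist_commute)
  obtain d1 where d1: "0 < d1" "\<And>s. dist s s0 < d1 \<Longrightarrow> dist (g s) (g s0) < \<rho>"
    using g \<rho>(1) unfolding continuous_at_eps_delta by blast
  obtain d2 where d2: "0 < d2" "\<And>s. dist s s0 < d2 \<Longrightarrow> s \<in> S"
    using S(1,2) unfolding open_dist by blast
  have "dist (\<phi> s) (\<phi> s0) < e" if "dist s s0 < min d1 d2" for s
  proof (rule ccontr)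
    assume "\<not> dist (\<phi> s) (\<phi> s0) < e"
    moreover have "s \<in> S" using d2 that by simp
    ultimately have "g s \<in> K" unfolding K_def
      using S(3)[of s] S(4)[of s] S(5)[of s] by (intro image_eqI[of _ _ "\<phi> s"]) (auto simp: dist_commute)
    then show False using \<rho>(2)[of "g s"] d1(2)[of s] that by (simp add: dist_commute)
  qed
  then show "\<exists>d>0. \<forall>x'. dist x' s0 < d \<longrightarrow> dist (\<phi> x') (\<phi> s0) < e"
    using d1(1) d2(1) by (intro exI[of _ "min d1 d2"]) auto
qed

lemma integral_period:
  fixes f :: "real \<Rightarrow> real"
  assumes f: "continuous_on UNIV f" and per: "\<And>x. f (x + 1) = f x" and a: "0 \<le> a" "a \<le> 1"
  shows "integral {a..a + 1} f = integral {0..1} f"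
proof -
  have i: "f integrable_on {x..y}" for x y
    by (rule integrable_continuous_real[OF continuous_on_subset[OF f]]) simp
  have "integral {1..a + 1} f = integral {0..a} (f \<circ> (\<lambda>x. x + 1))"
    using integral_shift[of 0 1 a f] continuous_on_subset[OF f] by simp
  also have "\<dots> = integral {0..a} f" by (simp add: o_def per)
  finally have "integral {1..a + 1} f = integral {0..a} f" .
  then show ?thesis
    using Henstock_Kurzweil_Integration.integral_combine[OF _ _ i, of a 1 "a + 1"]
      Henstock_Kurzweil_Integration.integral_combine[OF _ _ i, of 0 a 1] a by simp
qed

context convex_starlike
begin

abbreviation c1' where "c1' s \<equiv> vector_derivative c1 (at s)"
abbreviation c2' where "c2' s \<equiv> vector_derivative c2 (at s)"

text \<open>
  If the two tangents were orthogonal, i.e. if the ray were tangent to \<open>c2\<close> at its foot, then the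
  two normals would be orthogonal as well, contradicting \<open>m > 0\<close>.
\<close>

lemma transversal:
  assumes "c2 x = Q s" shows "c2' x \<bullet> c1' s \<noteq> 0"
proof
  assume "c2' x \<bullet> c1' s = 0"
  then have "c2' x = (c2' x \<bullet> N s) *\<^sub>R N s"
    by (rule plane_parallel[OF curve_deriv_nonzero[OF curve1] outer_normal_properties(2)[OF curve1] N_unit])
  moreover have "outer_normal c2 (Q s) \<bullet> c2' x = 0"
    using outer_normal_properties(2)[OF curve2, of x] assms by simp
  ultimately have "(c2' x \<bullet> N s) * (N s \<bullet> outer_normal c2 (Q s)) = 0"
    by (metis inner_commute inner_scaleR_right)
  then have "c2' x \<bullet> N s = 0" using min_cos_bounds(1) min_cos_bounds(2)[of s] by auto
  then have "c2' x = 0" using \<open>c2' x = (c2' x \<bullet> N s) *\<^sub>R N s\<close> by simp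
  then show False using curve_deriv_nonzero[OF curve2] by blast
qed

text \<open>
  Cutting both curves open at the base point \<open>b\<close> and at its foot turns the foot map into a
  bijection \<open>\<phi>\<close> of open unit intervals. This suffices for regularity at every point, since the cut
  may be placed anywhere, and for the length, since a change of variables does not see
  orientation.
\<close>

lemma foot_parameter:
  assumes a: "c2 a = Q b"
  obtains \<phi> \<phi>' where "\<And>s. s \<in> {b<..<b+1} \<Longrightarrow> a < \<phi> s \<and> \<phi> s < a + 1 \<and> c2 (\<phi> s) = Q s"
    "inj_on \<phi> {b<..<b+1}" "\<phi> ` {b<..<b+1} = {a<..<a+1}"
    "\<And>s. s \<in> {b<..<b+1} \<Longrightarrow> (\<phi> has_real_derivative \<phi>' s) (at s)"
    "continuous_on {b<..<b+1} \<phi>'"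
proof -
  have ex: "\<exists>\<sigma>. a < \<sigma> \<and> \<sigma> < a + 1 \<and> c2 \<sigma> = Q s" if s: "s \<in> {b<..<b+1}" for s
  proof -
    obtain \<sigma> where \<sigma>: "Q s = c2 \<sigma>" "a \<le> \<sigma>" "\<sigma> < a + 1" using curve_in_period[OF curve2 foot_on_curve2] by metis
    have "\<sigma> \<noteq> a"
    proof
      assume "\<sigma> = a"
      then have "c1 s = c1 b" using \<sigma>(1) a by (intro foot_inj) simp
      then show False using curve_inj[OF curve1, of s b] s by auto
    qed
    then show ?thesis using \<sigma> by (intro exI[of _ \<sigma>]) auto
  qed
  then obtain \<phi> where \<phi>: "\<And>s. s \<in> {b<..<b+1} \<Longrightarrow> a < \<phi> s \<and> \<phi> s < a + 1 \<and> c2 (\<phi> s) = Q s" by metis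
  have inj: "inj_on \<phi> {b<..<b+1}"
  proof (rule inj_onI)
    fix s t assume st: "s \<in> {b<..<b+1}" "t \<in> {b<..<b+1}" "\<phi> s = \<phi> t"
    then have "c1 s = c1 t" using \<phi> by (intro foot_inj) metis
    then show "s = t" using st by (intro curve_inj[OF curve1]) auto
  qed
  have surj: "\<phi> ` {b<..<b+1} = {a<..<a+1}"
  proof
    show "\<phi> ` {b<..<b+1} \<subseteq> {a<..<a+1}" using \<phi> by auto
    show "{a<..<a+1} \<subseteq> \<phi> ` {b<..<b+1}"
    proof
      fix \<sigma> assume \<sigma>: "\<sigma> \<in> {a<..<a+1}"
      obtain u where u: "c2 \<sigma> = Q u" using foot_surj[OF on_curve2] by metis
      obtain s where s: "c1 u = c1 s" "b \<le> s" "s < b + 1" using curve_in_period[OF curve1 on_curve1] by metis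
      have "s \<noteq> b"
      proof
        assume "s = b"
        then have "c2 \<sigma> = c2 a" using u s a by simp
        then show False using curve_inj[OF curve2, of \<sigma> a] \<sigma> by auto
      qed
      then have sb: "s \<in> {b<..<b+1}" using s by auto
      have "\<phi> s = \<sigma>" using \<phi>[OF sb] \<sigma> u s by (intro curve_inj[OF curve2]) auto
      then show "\<sigma> \<in> \<phi> ` {b<..<b+1}" using sb by blast
    qed
  qed
  have cont: "isCont \<phi> s" if "s \<in> {b<..<b+1}" for s
    by (rule curve_parameter_isCont[OF curve2, where g = "\<lambda>s. Q s" and S = "{b<..<b+1}" and a = a])
       (use that \<phi> foot_continuous[of UNIV] in \<open>auto simp: continuous_on_eq_continuous_at\<close>)
  define c1'' where "c1'' = (\<lambda>s. vector_derivative c1' (at s))"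
  \<comment> \<open>from implicit differentiation of \<open>(c2(\<phi>(s)) - c1(s)) \<bullet> c1'(s) = 0\<close>, which says that the ray is normal\<close>
  define \<phi>' where "\<phi>' = (\<lambda>s. - ((Q s - c1 s) \<bullet> c1'' s - c1' s \<bullet> c1' s) / (c2' (\<phi> s) \<bullet> c1' s))"
  have der: "(\<phi> has_real_derivative \<phi>' s) (at s)" if s: "s \<in> {b<..<b+1}" for s
    unfolding \<phi>'_def
  proof (rule implicit_real_derivative[where c = c2 and w = c1 and v = c1'])
    show "(c2 has_vector_derivative c2' (\<phi> s)) (at (\<phi> s))" by (rule curve_deriv[OF curve2])
    show "isCont \<phi> s" by (rule cont[OF s])
    show "isCont c1' s" using curve_continuous(2)[OF curve1, of UNIV] by (simp add: continuous_on_eq_continuous_at)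
    show "c2' (\<phi> s) \<bullet> c1' s \<noteq> 0" using transversal \<phi>[OF s] by blast
    have *: "(c2 (\<phi> u) - c1 u) \<bullet> c1' u = 0" if "u \<in> {b<..<b+1}" for u
      using \<phi>[OF that] foot_eq[of u] outer_normal_properties(2)[OF curve1, of u] by simp
    then show "\<forall>\<^sub>F u in at s. (c2 (\<phi> u) - c1 u) \<bullet> c1' u = 0"
      using eventually_at_in_open'[of "{b<..<b+1}" s] s by (auto elim: eventually_mono)
    show "(c2 (\<phi> s) - c1 s) \<bullet> c1' s = 0" by (rule *[OF s])
    have "((\<lambda>u. c2 (\<phi> s) - c1 u) has_vector_derivative - c1' s) (at s)"
      by (auto intro!: derivative_eq_intros curve_deriv[OF curve1])
    from bounded_bilinear.has_vector_derivative[OF bounded_bilinear_inner this curve_deriv2[OF curve1]]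
    show "((\<lambda>u. (c2 (\<phi> s) - c1 u) \<bullet> c1' u) has_real_derivative ((Q s - c1 s) \<bullet> c1'' s - c1' s \<bullet> c1' s)) (at s)"
      using \<phi>[OF s] by (simp add: has_real_derivative_iff_has_vector_derivative c1''_def)
  qed
  have cs: "continuous_on S c1''" for S
    unfolding c1''_def using curve_cont2[OF curve1] continuous_on_subset by blast
  have "continuous_on {b<..<b+1} \<phi>" using cont by (simp add: continuous_at_imp_continuous_on)
  then have "continuous_on {b<..<b+1} \<phi>'" unfolding \<phi>'_def
    by (intro continuous_intros foot_continuous curve_continuous[OF curve1] cs
        continuous_on_compose2[OF curve_continuous(2)[OF curve2, of UNIV]]) (use transversal \<phi> in auto)
  then show ?thesis using that \<phi> inj surj der by metis
qed

lemma foot_derivative_of_parameter: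
  assumes "s \<in> {b<..<b+1}" "\<And>s. s \<in> {b<..<b+1} \<Longrightarrow> c2 (\<phi> s) = Q s" "(\<phi> has_real_derivative d) (at s)"
  shows "((\<lambda>s. Q s) has_vector_derivative d *\<^sub>R c2' (\<phi> s)) (at s)"
proof -
  have "((c2 \<circ> \<phi>) has_vector_derivative d *\<^sub>R c2' (\<phi> s)) (at s)"
    by (rule vector_diff_chain_at[OF _ curve_deriv[OF curve2]])
       (use assms(3) in \<open>simp add: has_real_derivative_iff_has_vector_derivative\<close>)
  then show ?thesis
    by (rule has_vector_derivative_transform_within_open[of _ _ _ "{b<..<b+1}"]) (use assms in auto)
qed

definition foot' :: "real \<Rightarrow> complex" where
  "foot' s = vector_derivative (\<lambda>s. Q s) (at s)"

text \<open>
  Regularity is local, so at each \<open>s\<close> the parameter change of \<open>foot_parameter\<close> with the cut half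
  a period away from \<open>s\<close> can be used.
\<close>

lemma foot_C1:
  shows foot_derivative: "((\<lambda>s. Q s) has_vector_derivative foot' s) (at s)"
    and foot'_tangent: "\<exists>x k. c2 x = Q s \<and> foot' s = k *\<^sub>R c2' x"
    and foot'_continuous: "continuous_on UNIV foot'"
proof -
  have loc: "((\<lambda>s. Q s) has_vector_derivative foot' s) (at s) \<and> (\<exists>x k. c2 x = Q s \<and> foot' s = k *\<^sub>R c2' x) \<and> isCont foot' s" for s
  proof -
    define b where "b = s - 1/2"
    have sb: "s \<in> {b<..<b+1}" by (auto simp: b_def)
    obtain a where "c2 a = Q b" using foot_on_curve2 curve_range[OF curve2] by (metis rangeE)
    then obtain \<phi> \<phi>' where \<phi>: "\<And>s. s \<in> {b<..<b+1} \<Longrightarrow> a < \<phi> s \<and> \<phi> s < a + 1 \<and> c2 (\<phi> s) = Q s"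
      "\<And>s. s \<in> {b<..<b+1} \<Longrightarrow> (\<phi> has_real_derivative \<phi>' s) (at s)" "continuous_on {b<..<b+1} \<phi>'"
      using foot_parameter by metis
    have d: "((\<lambda>s. Q s) has_vector_derivative \<phi>' u *\<^sub>R c2' (\<phi> u)) (at u)" if "u \<in> {b<..<b+1}" for u
      using foot_derivative_of_parameter[OF that _ \<phi>(2)[OF that]] \<phi>(1) by blast
    then have e: "foot' u = \<phi>' u *\<^sub>R c2' (\<phi> u)" if "u \<in> {b<..<b+1}" for u
      unfolding foot'_def using that vector_derivative_at by blast
    have "continuous_on {b<..<b+1} \<phi>"
      using \<phi>(2) by (meson DERIV_isCont continuous_at_imp_continuous_on)
    then have "continuous_on {b<..<b+1} (\<lambda>u. \<phi>' u *\<^sub>R c2' (\<phi> u))"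
      by (intro continuous_intros \<phi> continuous_on_compose2[OF curve_continuous(2)[OF curve2, of UNIV]]) auto
    then have "continuous_on {b<..<b+1} foot'"
      by (rule continuous_on_cong[THEN iffD2, rotated -1]) (use e in auto)
    then have "isCont foot' s" using sb by (simp add: continuous_on_eq_continuous_at)
    then show ?thesis using d[OF sb] e[OF sb] \<phi>(1)[OF sb] by auto
  qed
  show "((\<lambda>s. Q s) has_vector_derivative foot' s) (at s)" "\<exists>x k. c2 x = Q s \<and> foot' s = k *\<^sub>R c2' x" using loc by auto
  show "continuous_on UNIV foot'" using loc by (simp add: continuous_at_imp_continuous_on)
qed

text \<open>
  The foot curve runs through \<open>c2\<close> once; the change of variables formula for \<open>\<phi>\<close> compares the
  lengths.
\<close>

lemma foot_length: "integral {0..1} (\<lambda>s. norm (foot' s)) = curve_length c2"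
proof -
  obtain a where a: "Q 0 = c2 a" "0 \<le> a" "a < 0 + 1" using curve_in_period[OF curve2 foot_on_curve2] by metis
  obtain \<phi> \<phi>' where \<phi>: "\<And>s. s \<in> {0<..<0+1} \<Longrightarrow> a < \<phi> s \<and> \<phi> s < a + 1 \<and> c2 (\<phi> s) = Q s"
      "inj_on \<phi> {0<..<0+1}" "\<phi> ` {0<..<0+1} = {a<..<a+1}"
      "\<And>s. s \<in> {0<..<0+1} \<Longrightarrow> (\<phi> has_real_derivative \<phi>' s) (at s)"
    using foot_parameter[OF a(1)[symmetric]] by metis
  have e: "norm (foot' s) = \<bar>\<phi>' s\<bar> * norm (c2' (\<phi> s))" if "s \<in> {0<..<1}" for s
  proof -
    have "((\<lambda>s. Q s) has_vector_derivative \<phi>' s *\<^sub>R c2' (\<phi> s)) (at s)"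
      by (rule foot_derivative_of_parameter[of s 0]) (use \<phi>(1,4) that in auto)
    then show ?thesis unfolding foot'_def by (simp add: vector_derivative_at)
  qed
  have c2n: "continuous_on S (\<lambda>x. norm (c2' x))" for S
    by (intro continuous_intros curve_continuous[OF curve2])
  have "(\<lambda>x. norm (c2' x)) absolutely_integrable_on {a..a+1}"
    by (rule absolutely_integrable_continuous_real[OF c2n])
  then have "(\<lambda>x. norm (c2' x)) absolutely_integrable_on \<phi> ` {0<..<1}"
    using \<phi>(3) by (auto elim: set_integrable_subset)
  then have "integral {0<..<1} (\<lambda>s. \<bar>\<phi>' s\<bar> * norm (c2' (\<phi> s))) = integral (\<phi> ` {0<..<1}) (\<lambda>x. norm (c2' x))"
    using has_absolute_integral_change_of_variables_1'[of "{0<..<1}" \<phi> \<phi>' "\<lambda>x. norm (c2' x)"] \<phi>(2,4)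
    by (auto intro: has_field_derivative_at_within)
  moreover have "integral {0<..<1} (\<lambda>s. norm (foot' s)) = integral {0<..<1} (\<lambda>s. \<bar>\<phi>' s\<bar> * norm (c2' (\<phi> s)))"
    by (rule integral_cong) (rule e)
  ultimately have "integral {0..1} (\<lambda>s. norm (foot' s)) = integral {a..a+1} (\<lambda>x. norm (c2' x))"
    using \<phi>(3) by (simp add: integral_open_interval_real)
  also have "\<dots> = integral {0..1} (\<lambda>x. norm (c2' x))"
    using a curve_deriv_shift_int[OF curve2, of _ 1] by (intro integral_period c2n) auto
  finally show ?thesis by (simp add: curve_length_def)
qed

text \<open>
  The distance of \<open>y = Q s'\<close> to the closed inner region is attained at \<open>c1 s'\<close> and equals \<open>r s'\<close>.
\<close>

lemma inradius_bound:
  assumes "y \<in> path_image c2" shows "min_ray c1 c2 \<le> dist (c1 s) y"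
proof -
  obtain s' where s': "y = Q s'" using assms by (rule foot_surj)
  have "min_ray c1 c2 \<le> r s'" by (rule ray_length_bounds)
  also have "r s' = dist y (closest_point (closure region) y)"
    by (simp add: s' closest_point_foot ray_length_def dist_commute)
  also have "\<dots> \<le> dist y (c1 s)" by (rule closest_point_le[OF closed_closure on_closure])
  finally show ?thesis by (simp add: dist_commute)
qed

text \<open>
  The disc of radius \<open>\<beta>\<close> around \<open>c1 s\<close> lies inside \<open>c2\<close>, hence on the inner side of the tangent
  line of \<open>c2\<close> at \<open>Q s\<close>. Moving from \<open>c1 s\<close> by \<open>\<delta> < \<beta>\<close> along the outer normal \<open>n\<close> of that line gives
  \<open>\<delta> \<le> (Q s - c1 s) \<bullet> n = r s cos \<theta>\<close>.
\<close>

lemma min_cos_ge_ratio: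
  assumes "convex_curve c2"
  shows "min_ray c1 c2 / max_ray c1 c2 \<le> min_cos c1 c2"
  unfolding min_cos_def
proof (rule cINF_greatest)
  show "path_image c1 \<noteq> {}" using on_curve1 by blast
  fix x assume "x \<in> path_image c1"
  then obtain s where s: "x = c1 s" using curve_range[OF curve1] by auto
  interpret outer: convex_smooth_curve c2 by unfold_locales (rule curve2 assms)+
  obtain \<sigma> where \<sigma>: "Q s = c2 \<sigma>" using foot_on_curve2[of s] curve_range[OF curve2] by auto
  define n where "n = outer_normal c2 (Q s)"
  have n1: "norm n = 1" unfolding n_def \<sigma> by (rule outer_normal_properties(1)[OF curve2])
  have "\<delta> \<le> r s * (N s \<bullet> n)" if \<delta>: "0 \<le> \<delta>" "\<delta> < min_ray c1 c2" for \<delta>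
  proof -
    have "c1 s + \<delta> *\<^sub>R n \<in> inside (path_image c2)"
    proof (rule inside_along_ray[OF curve1_inside \<delta>(1)])
      fix u assume u: "0 \<le> u" "u \<le> \<delta>"
      have "dist (c1 s) (c1 s + u *\<^sub>R n) = u" using u n1 by (simp add: dist_norm)
      then show "c1 s + u *\<^sub>R n \<notin> path_image c2" using inradius_bound[of "c1 s + u *\<^sub>R n" s] \<delta> u by auto
    qed
    then have "n \<bullet> (c1 s + \<delta> *\<^sub>R n - Q s) < 0"
      using outer.normal_supports_strictly[of _ \<sigma>] by (simp add: \<sigma> n_def)
    then show ?thesis
      using n1 by (simp add: foot_eq inner_diff_right inner_add_right dot_square_norm inner_commute)
  qed
  moreover have "0 \<le> r s * (N s \<bullet> n)"
    using ray_length_pos[of s] min_cos_bounds(1) min_cos_bounds(2)[of s] by (simp add: n_def)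
  ultimately have "min_ray c1 c2 \<le> r s * (N s \<bullet> n)"
    using dense_le_bounded[of 0 "min_ray c1 c2"] ray_length_bounds(1) by (metis less_imp_le order_antisym_conv not_le)
  also have "\<dots> \<le> max_ray c1 c2 * (N s \<bullet> n)"
    using ray_length_bounds(3)[of s] min_cos_bounds(1) min_cos_bounds(2)[of s]
    by (intro mult_right_mono) (auto simp: n_def)
  finally have "min_ray c1 c2 \<le> max_ray c1 c2 * cos (ray_angle c1 c2 x)"
    by (simp add: s cos_ray_angle n_def)
  then show "min_ray c1 c2 / max_ray c1 c2 \<le> cos (ray_angle c1 c2 x)"
    using max_ray_pos by (simp add: divide_le_eq mult.commute)
qed

end

section \<open>The sweep-out of the annulus by leaves\<close>

lemma absolutely_integrable_continuous_compact:
  fixes f :: "'a::euclidean_space \<Rightarrow> 'b::euclidean_space"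
  assumes "compact S" "continuous_on S f" shows "f absolutely_integrable_on S"
proof -
  have "integrable lborel (\<lambda>x. indicator S x *\<^sub>R f x)"
    using borel_integrable_compact[OF assms] .
  then have "integrable lebesgue (\<lambda>x. indicator S x *\<^sub>R f x)"
    by (subst integrable_completion) (auto dest: borel_measurable_integrable)
  then show ?thesis by (simp add: set_integrable_def)
qed

lemma plane_rotated_inner:
  fixes a n :: complex assumes "norm n = 1"
  shows "(Im (cnj a * n))\<^sup>2 + (a \<bullet> n)\<^sup>2 = (norm a)\<^sup>2"
proof -
  have "(Re n)\<^sup>2 + (Im n)\<^sup>2 = 1" using assms by (simp add: cmod_power2[symmetric])
  then show ?thesis unfolding cmod_power2 inner_complex_def by (simp, algebra)
qed

context convex_starlike
begin

definition connector where "connector s = Q s - c1 s"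
definition connector' where "connector' s = foot' s - c1' s"

definition leaf where "leaf \<tau> s = c1 s + \<tau> *\<^sub>R connector s"
definition leaf' where "leaf' \<tau> s = c1' s + \<tau> *\<^sub>R connector' s"
definition jac where "jac \<tau> s = \<bar>Im (cnj (connector s) * leaf' \<tau> s)\<bar>"

lemma connector_eq: "connector s = r s *\<^sub>R N s" by (simp add: connector_def foot_eq)

lemma connector_derivative: "(connector has_vector_derivative connector' s) (at s)"
  unfolding connector_def connector'_def by (intro has_vector_derivative_diff foot_derivative curve_deriv[OF curve1])

lemma connector_continuous: "continuous_on S connector" "continuous_on S connector'" "continuous_on S c1" "continuous_on S c1'"
proof -
  show "continuous_on S connector'" unfolding connector'_def
    using foot'_continuous by (intro continuous_intros curve_continuous[OF curve1]) (rule continuous_on_subset, auto)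
  show "continuous_on S connector" "continuous_on S c1" "continuous_on S c1'" unfolding connector_def
    by (intro continuous_intros foot_continuous curve_continuous[OF curve1])+
qed

lemma connector_continuous_snd:
  "continuous_on S (\<lambda>z. connector (snd z))" "continuous_on S (\<lambda>z. connector' (snd z))"
  "continuous_on S (\<lambda>z. c1 (snd z))" "continuous_on S (\<lambda>z. c1' (snd z))" for S :: "(real \<times> real) set"
  by (rule continuous_on_compose2[OF connector_continuous(1)[of UNIV]] continuous_on_compose2[OF connector_continuous(2)[of UNIV]]
      continuous_on_compose2[OF connector_continuous(3)[of UNIV]] continuous_on_compose2[OF connector_continuous(4)[of UNIV]];
      simp add: continuous_on_snd)+

lemma leaf_continuous:
  fixes S :: "(real \<times> real) set"
  shows "continuous_on S (\<lambda>z. leaf (fst z) (snd z))" "continuous_on S (\<lambda>z. leaf' (fst z) (snd z))"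
    "continuous_on S (\<lambda>z. jac (fst z) (snd z))" 
    "continuous_on T (leaf \<tau>)" "continuous_on T (leaf' \<tau>)" "continuous_on T (jac \<tau>)"
  unfolding leaf_def leaf'_def jac_def by (intro continuous_intros connector_continuous connector_continuous_snd)+

lemma leaf_derivative: "(leaf \<tau> has_vector_derivative leaf' \<tau> s) (at s)"
  unfolding leaf_def leaf'_def
  by (intro has_vector_derivative_add curve_deriv[OF curve1]
      bounded_linear.has_vector_derivative[OF bounded_linear_scaleR_right connector_derivative])

lemma leaf_in_annulus: "0 \<le> \<tau> \<Longrightarrow> \<tau> \<le> 1 \<Longrightarrow> leaf \<tau> s \<in> \<Omega>"
  unfolding leaf_def connector_eq scaleR_scaleR using ray_length_pos[of s]
  by (intro normal_point_in_annulus) (auto simp: mult_left_le_one_le)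

lemma leaf_in_gap: "0 < \<tau> \<Longrightarrow> \<tau> < 1 \<Longrightarrow> leaf \<tau> s \<in> inside (path_image c2) \<inter> outside (path_image c1)"
  unfolding leaf_def connector_eq scaleR_scaleR using ray_length_pos[of s]
  by (intro normal_point_in_gap) auto

lemma leaf_periodic: "leaf \<tau> 1 = leaf \<tau> 0"
  using curve_shift_int[OF curve1, of 0 1] by (simp add: leaf_def connector_def)

text \<open>
  Since \<open>connector = r N\<close> and \<open>N' = k c1'\<close>, the product rule gives
  \<open>connector' = r k c1' + r' N\<close>. So
  \<open>\<kappa> = r k\<close> is nonnegative by convexity, and \<open>\<rho> = r'\<close>.
\<close>

lemma leaf_decomposition:
  obtains \<kappa> \<rho> where "\<And>s. 0 \<le> \<kappa> s" "\<And>s \<tau>. leaf' \<tau> s = (1 + \<tau> * \<kappa> s) *\<^sub>R c1' s + (\<tau> * \<rho> s) *\<^sub>R N s"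
proof -
  obtain k where k: "\<And>s. 0 \<le> k s" "\<And>s. ((\<lambda>s. N s) has_vector_derivative k s *\<^sub>R c1' s) (at s)"
    using normal_C1 by metis
  have RN: "connector s \<bullet> N s = r s" for s by (simp add: connector_eq dot_square_norm N_unit)
  have rd: "((\<lambda>s. r s) has_real_derivative connector' s \<bullet> N s) (at s)" for s
  proof -
    have "((\<lambda>s. connector s \<bullet> N s) has_vector_derivative (connector s \<bullet> (k s *\<^sub>R c1' s) + connector' s \<bullet> N s)) (at s)"
      by (rule bounded_bilinear.has_vector_derivative[OF bounded_bilinear_inner connector_derivative k(2)])
    moreover have "connector s \<bullet> c1' s = 0"
      using outer_normal_properties(2)[OF curve1, of s] by (simp add: connector_eq)
    ultimately show ?thesis by (simp add: RN has_real_derivative_iff_has_vector_derivative)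
  qed
  have "connector' s = (r s * k s) *\<^sub>R c1' s + (connector' s \<bullet> N s) *\<^sub>R N s" for s
  proof -
    have "((\<lambda>s. r s *\<^sub>R N s) has_vector_derivative (r s *\<^sub>R (k s *\<^sub>R c1' s) + (connector' s \<bullet> N s) *\<^sub>R N s)) (at s)"
      by (rule has_vector_derivative_scaleR[OF rd k(2)])
    then have "(connector has_vector_derivative (r s *\<^sub>R (k s *\<^sub>R c1' s) + (connector' s \<bullet> N s) *\<^sub>R N s)) (at s)"
      by (simp add: connector_eq[abs_def])
    from vector_derivative_unique_at[OF connector_derivative this] show ?thesis by simp
  qed
  then have "leaf' \<tau> s = c1' s + \<tau> *\<^sub>R ((r s * k s) *\<^sub>R c1' s + (connector' s \<bullet> N s) *\<^sub>R N s)" for \<tau> s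
    by (metis leaf'_def)
  then have "leaf' \<tau> s = (1 + \<tau> * (r s * k s)) *\<^sub>R c1' s + (\<tau> * (connector' s \<bullet> N s)) *\<^sub>R N s" for \<tau> s
    by (simp add: scaleR_add_right scaleR_add_left)
  moreover have "0 \<le> r s * k s" for s using k(1) ray_length_pos[of s] by simp
  ultimately show ?thesis by (rule that[rotated])
qed

text \<open>
  With \<open>p = \<bar>c1'\<bar>\<close>, the speed of a leaf is the hypotenuse of the right triangle with legs
  \<open>(1 + \<tau> \<kappa>) p\<close> and \<open>\<tau> \<rho>\<close>, while the Jacobian is \<open>r (1 + \<tau> \<kappa>) p\<close>; their quotient is
  \<open>r cos(\<theta>(\<tau>))\<close>. The lower bound for the cosine is known at \<open>\<tau> = 1\<close> from the definition of \<open>m\<close> and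
  is transported to smaller \<open>\<tau>\<close> by \<open>\<tau> (1 + \<kappa>) \<le> 1 + \<tau> \<kappa>\<close>.
\<close>

lemma leaf_geometry:
  assumes \<tau>: "0 \<le> \<tau>" "\<tau> \<le> 1"
  shows leaf_regular: "0 < norm (leaf' \<tau> s)"
    and jac_lower: "min_ray c1 c2 * min_cos c1 c2 * norm (leaf' \<tau> s) \<le> jac \<tau> s"
    and jac_upper: "jac \<tau> s \<le> max_ray c1 c2 * norm (leaf' \<tau> s)"
    and leaf_speed_le: "norm (leaf' \<tau> s) \<le> norm (foot' s)"
proof -
  obtain \<kappa> \<rho> where \<kappa>: "\<And>s. 0 \<le> \<kappa> s"
    and dec: "\<And>s \<tau>. leaf' \<tau> s = (1 + \<tau> * \<kappa> s) *\<^sub>R c1' s + (\<tau> * \<rho> s) *\<^sub>R N s"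
    by (rule leaf_decomposition) blast
  define p where "p = norm (c1' s)"
  define m where "m = min_cos c1 c2"
  have p: "0 < p" using curve_deriv_nonzero[OF curve1] by (simp add: p_def)
  have m: "0 < m" "m \<le> 1" unfolding m_def by (rule min_cos_bounds)+
  have orth: "N s \<bullet> c1' s = 0" "c1' s \<bullet> N s = 0"
    using outer_normal_properties(2)[OF curve1, of s] by (auto simp: inner_commute)
  have NN: "N s \<bullet> N s = 1" by (simp add: dot_square_norm N_unit)
  have sq: "(norm (leaf' t s))\<^sup>2 = ((1 + t * \<kappa> s) * p)\<^sup>2 + (t * \<rho> s)\<^sup>2" for t
  proof -
    have "(norm (x *\<^sub>R c1' s + y *\<^sub>R N s))\<^sup>2 = (x * p)\<^sup>2 + y\<^sup>2" for x y
      unfolding power2_norm_eq_inner by (simp add: inner_add_left inner_add_right orth NN)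
        (simp add: p_def dot_square_norm power2_eq_square)
    then show ?thesis unfolding dec .
  qed
  have f1: "foot' s = leaf' 1 s" by (simp add: leaf'_def connector'_def)
  have pos: "0 < (1 + t * \<kappa> s) * p" if "0 \<le> t" for t
    using p \<kappa>[of s] that by (intro mult_pos_pos) (auto intro!: add_pos_nonneg)
  show "0 < norm (leaf' \<tau> s)"
  proof -
    have "0 < (norm (leaf' \<tau> s))\<^sup>2" unfolding sq using pos[OF \<tau>(1)] by (intro add_pos_nonneg) auto
    then show ?thesis by auto
  qed
  have Ls: "(1 + \<tau> * \<kappa> s) * p \<le> norm (leaf' \<tau> s)"
    by (rule power2_le_imp_le) (simp_all add: sq)
  show "norm (leaf' \<tau> s) \<le> norm (foot' s)"
  proof (rule power2_le_imp_le)
    have "(1 + \<tau> * \<kappa> s) * p \<le> (1 + 1 * \<kappa> s) * p"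
      using \<tau> \<kappa>[of s] p by (intro mult_right_mono add_left_mono) (auto simp: mult_left_le_one_le)
    then have "((1 + \<tau> * \<kappa> s) * p)\<^sup>2 \<le> ((1 + 1 * \<kappa> s) * p)\<^sup>2" using pos[OF \<tau>(1)] by (intro power_mono) auto
    moreover have "(\<tau> * \<rho> s)\<^sup>2 \<le> (1 * \<rho> s)\<^sup>2"
      unfolding power_mult_distrib using \<tau> by (intro mult_right_mono power_mono) auto
    ultimately show "(norm (leaf' \<tau> s))\<^sup>2 \<le> (norm (foot' s))\<^sup>2" unfolding f1 sq by simp
  qed simp
  have jac: "jac \<tau> s = r s * ((1 + \<tau> * \<kappa> s) * p)"
  proof -
    have "\<bar>Im (cnj (c1' s) * N s)\<bar> = p"
    proof (rule power2_eq_imp_eq)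
      show "\<bar>Im (cnj (c1' s) * N s)\<bar>\<^sup>2 = p\<^sup>2"
        using plane_rotated_inner[OF N_unit, of "c1' s" s] unfolding orth(2) p_def by simp
    qed (use p in auto)
    moreover have "Im (cnj (connector s) * leaf' \<tau> s) = - (r s * (1 + \<tau> * \<kappa> s) * Im (cnj (c1' s) * N s))"
      unfolding connector_eq dec by (simp add: algebra_simps)
    ultimately show ?thesis
      using ray_length_pos[of s] \<tau>(1) \<kappa>[of s] by (simp add: jac_def abs_mult)
  qed
  have cos1: "m\<^sup>2 * (((1 + \<kappa> s) * p)\<^sup>2 + (\<rho> s)\<^sup>2) \<le> ((1 + \<kappa> s) * p)\<^sup>2"
  proof -
    \<comment> \<open>at \<open>\<tau> = 1\<close> the leaf is the outer curve and its normal is that of \<open>c2\<close>\<close>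
    define n where "n = outer_normal c2 (Q s)"
    obtain x k where x: "c2 x = Q s" "foot' s = k *\<^sub>R c2' x" using foot'_tangent by blast
    have n1: "norm n = 1" and "n \<bullet> c2' x = 0"
      using outer_normal_properties(1,2)[OF curve2, of x] by (auto simp: n_def x)
    then have "n \<bullet> leaf' 1 s = 0" using x(2) f1 by simp
    \<comment> \<open>\<open>n\<close> has coordinates \<open>a\<close> and \<open>b / p\<close> in the orthonormal frame of \<open>N\<close> and the unit tangent; it is
      orthogonal to the velocity of the last leaf, so \<open>a\<close> is the cosine sought\<close>
    define a b where "a = n \<bullet> N s" and "b = n \<bullet> c1' s"
    have e1: "(1 + \<kappa> s) * b + \<rho> s * a = 0"
      using \<open>n \<bullet> leaf' 1 s = 0\<close> unfolding dec by (simp add: inner_add_right a_def b_def)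
    have e2: "b\<^sup>2 = p\<^sup>2 * (1 - a\<^sup>2)"
    proof -
      define I where "I = Im (cnj n * N s)"
      have "I\<^sup>2 + a\<^sup>2 = 1" using plane_rotated_inner[OF N_unit, of n s] by (simp add: I_def a_def n1)
      moreover have "b\<^sup>2 = p\<^sup>2 * I\<^sup>2"
      proof -
        have NNc: "(Re (N s))\<^sup>2 + (Im (N s))\<^sup>2 = 1" using N_unit[of s] by (simp add: cmod_power2[symmetric])
        have o: "Re (N s) * Re (c1' s) + Im (N s) * Im (c1' s) = 0" using orth(1) by (simp add: inner_complex_def)
        show ?thesis unfolding I_def b_def p_def cmod_power2 inner_complex_def
          using NNc o by (simp, algebra)
      qed
      ultimately show ?thesis by algebra
    qed
    have "a\<^sup>2 * (((1 + \<kappa> s) * p)\<^sup>2 + (\<rho> s)\<^sup>2) = ((1 + \<kappa> s) * p)\<^sup>2"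
      using e1 e2 by algebra
    moreover have "m \<le> a" using min_cos_bounds(2)[of s] by (simp add: m_def a_def n_def inner_commute)
    then have "m\<^sup>2 \<le> a\<^sup>2" using m by (intro power_mono) auto
    ultimately show ?thesis by (metis mult_right_mono add_nonneg_nonneg zero_le_power2)
  qed
  have "m * norm (leaf' \<tau> s) \<le> (1 + \<tau> * \<kappa> s) * p"
  proof (rule power2_le_imp_le)
    have m1: "0 \<le> 1 - m\<^sup>2" using m by (simp add: power_le_one)
    have "m\<^sup>2 * (\<rho> s)\<^sup>2 \<le> (1 - m\<^sup>2) * ((1 + \<kappa> s) * p)\<^sup>2" using cos1 by (simp add: algebra_simps)
    then have "\<tau>\<^sup>2 * (m\<^sup>2 * (\<rho> s)\<^sup>2) \<le> \<tau>\<^sup>2 * ((1 - m\<^sup>2) * ((1 + \<kappa> s) * p)\<^sup>2)" by (intro mult_left_mono) auto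
    also have "\<dots> = (1 - m\<^sup>2) * (\<tau> * (1 + \<kappa> s) * p)\<^sup>2" by (simp add: power_mult_distrib)
    also have "\<dots> \<le> (1 - m\<^sup>2) * ((1 + \<tau> * \<kappa> s) * p)\<^sup>2"
      using \<tau> p \<kappa>[of s] by (intro mult_left_mono[OF _ m1] power_mono mult_right_mono) (auto simp: algebra_simps)
    finally show "(m * norm (leaf' \<tau> s))\<^sup>2 \<le> ((1 + \<tau> * \<kappa> s) * p)\<^sup>2"
      unfolding power_mult_distrib[of m] sq by (simp add: power_mult_distrib algebra_simps)
  qed (use pos[OF \<tau>(1)] in simp)
  then have "min_ray c1 c2 * (m * norm (leaf' \<tau> s)) \<le> r s * ((1 + \<tau> * \<kappa> s) * p)"
    by (rule mult_mono[rotated]) (use ray_length_bounds(1) ray_length_bounds(2)[of s] ray_length_pos[of s] m in auto)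
  then show "min_ray c1 c2 * min_cos c1 c2 * norm (leaf' \<tau> s) \<le> jac \<tau> s"
    by (simp add: jac m_def mult.assoc)
  show "jac \<tau> s \<le> max_ray c1 c2 * norm (leaf' \<tau> s)"
    unfolding jac using ray_length_bounds(3)[of s] Ls pos[OF \<tau>(1)] ray_length_pos[of s] max_ray_pos
    by (intro mult_mono) auto
qed

text \<open>
  The factor \<open>\<tau>\<close> comes first, so that iterated integration ends with the integral over the leaves.
\<close>

definition sweep :: "real \<times> real \<Rightarrow> complex" where "sweep z = leaf (fst z) (snd z)"

definition open_square :: "(real \<times> real) set" where "open_square = box (0, 0) (1, 1)"

lemma open_square: "z \<in> open_square \<longleftrightarrow> 0 < fst z \<and> fst z < 1 \<and> 0 < snd z \<and> snd z < 1"
  by (cases z) (auto simp: open_square_def mem_box Basis_prod_def)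

lemma sweep_inj: "inj_on sweep open_square"
proof (rule inj_onI)
  fix y z assume yz: "y \<in> open_square" "z \<in> open_square" "sweep y = sweep z"
  then have "c1 (snd y) + (fst y * r (snd y)) *\<^sub>R N (snd y) = c1 (snd z) + (fst z * r (snd z)) *\<^sub>R N (snd z)"
    by (simp add: sweep_def leaf_def connector_eq)
  then have e: "c1 (snd y) = c1 (snd z) \<and> fst y * r (snd y) = fst z * r (snd z)"
    using yz ray_length_pos[of "snd y"] ray_length_pos[of "snd z"] by (intro normal_ray_unique) (auto simp: open_square)
  then have "snd y = snd z" using yz by (intro curve_inj[OF curve1]) (auto simp: open_square)
  moreover from this have "fst y = fst z" using e ray_length_pos[of "snd z"] by auto
  ultimately show "y = z" by (simp add: prod_eq_iff)
qed

lemma sweep_derivative: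
  "(sweep has_derivative (\<lambda>h. snd h *\<^sub>R leaf' (fst z) (snd z) + fst h *\<^sub>R connector (snd z))) (at z)"
proof -
  have 1: "((\<lambda>z. c1 (snd z)) has_derivative (\<lambda>h. snd h *\<^sub>R c1' (snd z))) (at z)"
    using has_derivative_compose[OF has_derivative_snd[OF has_derivative_ident] curve_deriv[OF curve1, unfolded has_vector_derivative_def]] .
  have 2: "((\<lambda>z. connector (snd z)) has_derivative (\<lambda>h. snd h *\<^sub>R connector' (snd z))) (at z)"
    using has_derivative_compose[OF has_derivative_snd[OF has_derivative_ident] connector_derivative[unfolded has_vector_derivative_def]] .
  show ?thesis
    unfolding sweep_def leaf_def leaf'_def
    by (rule derivative_eq_intros 1 2 refl | simp add: algebra_simps)+
qed

text \<open>
  The sweep of the open square misses only the two boundary curves and the ray at which the inner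
  curve has been cut open.
\<close>

lemma annulus_minus_sweep: "negligible (\<Omega> - sweep ` open_square)"
proof -
  have "negligible (path_image c1)" "negligible (path_image c2)"
  proof -
    have "negligible (path_image c)" if "smooth_simple_closed_curve c" for c
    proof -
      have "c differentiable_on UNIV"
        unfolding differentiable_on_def using differentiableI_vector[OF curve_deriv[OF that]] by simp
      then have "negligible (range c)" by (intro negligible_differentiable_image_lowdim) simp
      then show ?thesis by (simp only: curve_range[OF that])
    qed
    then show "negligible (path_image c1)" "negligible (path_image c2)" using curve1 curve2 by auto
  qed
  moreover have "negligible ((\<lambda>\<tau>. leaf \<tau> 0) ` UNIV)"
    by (rule negligible_differentiable_image_lowdim) (auto simp: leaf_def intro!: derivative_intros)
  ultimately have "negligible (path_image c1 \<union> path_image c2 \<union> range (\<lambda>\<tau>. leaf \<tau> 0))" by simp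
  moreover have "\<Omega> - sweep ` open_square \<subseteq> path_image c1 \<union> path_image c2 \<union> range (\<lambda>\<tau>. leaf \<tau> 0)"
  proof
    fix p assume p: "p \<in> \<Omega> - sweep ` open_square"
    then have "p \<in> \<Omega>" by simp
    then obtain u t where t: "0 \<le> t" "t \<le> r u" "p = c1 u + t *\<^sub>R N u" by (rule annulus_normal_point)
    obtain s where s: "c1 u = c1 s" "0 \<le> s" "s < 0 + 1" using curve_in_period[OF curve1 on_curve1] by metis
    have t: "0 \<le> t" "t \<le> r s" "p = c1 s + t *\<^sub>R N s" using t s(1) by simp_all
    define \<tau> where "\<tau> = t / r s"
    have \<tau>: "0 \<le> \<tau>" "\<tau> \<le> 1" "p = leaf \<tau> s"
      using t ray_length_pos[of s] by (auto simp: \<tau>_def leaf_def connector_eq)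
    have "(\<tau>, s) \<notin> open_square" using p \<tau>(3) by (metis DiffD2 fst_conv image_eqI snd_conv sweep_def)
    then have "\<tau> = 0 \<or> \<tau> = 1 \<or> s = 0" using \<tau> s by (auto simp: open_square)
    then show "p \<in> path_image c1 \<union> path_image c2 \<union> range (\<lambda>\<tau>. leaf \<tau> 0)"
      using \<tau>(3) on_curve1[of s] foot_on_curve2[of s] by (auto simp: leaf_def connector_def)
  qed
  ultimately show ?thesis by (rule negligible_subset)
qed

lemma sweep_subset: "sweep ` open_square \<subseteq> interior \<Omega>"
  using leaf_in_gap gap_interior by (fastforce simp: sweep_def open_square)

lemma annulus_boundary_negligible: "negligible (\<Omega> - interior \<Omega>)"
  by (rule negligible_subset[OF annulus_minus_sweep]) (use sweep_subset in blast)

lemma annulus_integral: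
  fixes f :: "complex \<Rightarrow> real"
  assumes f: "continuous_on \<Omega> f"
  shows "integral \<Omega> f = integral {0..1} (\<lambda>\<tau>. integral {0..1} (\<lambda>s. jac \<tau> s * f (leaf \<tau> s)))"
proof -
  let ?h = "\<lambda>z. jac (fst z) (snd z) * f (leaf (fst z) (snd z))"
  have sub: "sweep ` open_square \<subseteq> \<Omega>" using sweep_subset interior_subset by blast
  have "open (sweep ` open_square)"
  proof (rule invariance_of_domain_gen[OF _ _ sweep_inj])
    show "open open_square" by (simp add: open_square_def open_box)
    show "continuous_on open_square sweep" unfolding sweep_def by (rule leaf_continuous)
  qed simp
  then have "f absolutely_integrable_on sweep ` open_square"
    by (intro set_integrable_subset[OF absolutely_integrable_continuous_compact[OF compact_annulus f] _ sub]) simp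
  from change_of_variables_plane[OF _ sweep_derivative sweep_inj this]
  have "(?h has_integral integral (sweep ` open_square) f) (box (0, 0) (1, 1))"
    by (simp add: open_square_def open_box jac_def sweep_def)
  then have 1: "integral (cbox (0, 0) (1, 1)) ?h = integral (sweep ` open_square) f"
    by (simp only: has_integral_open_interval integral_unique)
  have "integral (sweep ` open_square) f = integral \<Omega> f"
    by (rule integral_subset_negligible[OF sub annulus_minus_sweep])
  moreover have "continuous_on (cbox (0, 0) (1, 1)) ?h"
    by (intro continuous_intros leaf_continuous continuous_on_compose2[OF f leaf_continuous(1)])
       (auto simp: cbox_Pair_eq leaf_in_annulus)
  from integral_prod_continuous[OF this]
  have "integral (cbox (0, 0) (1, 1)) ?h = integral {0..1} (\<lambda>\<tau>. integral {0..1} (\<lambda>s. jac \<tau> s * f (leaf \<tau> s)))"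
    by simp
  ultimately show ?thesis using 1 by simp
qed

lemma leaf_integral_integrable:
  fixes f :: "complex \<Rightarrow> real"
  assumes f: "continuous_on \<Omega> f"
  shows "(\<lambda>\<tau>. integral {0..1} (\<lambda>s. jac \<tau> s * f (leaf \<tau> s))) integrable_on {0..1}"
proof -
  have "continuous_on ({0..1} \<times> cbox 0 1) (\<lambda>z. jac (fst z) (snd z) * f (leaf (fst z) (snd z)))"
    by (intro continuous_intros leaf_continuous continuous_on_compose2[OF f leaf_continuous(1)])
       (auto simp: leaf_in_annulus)
  then have "continuous_on {0..1} (\<lambda>\<tau>. integral (cbox 0 1) (\<lambda>s. jac \<tau> s * f (leaf \<tau> s)))"
    by (intro integral_continuous_on_param) (simp add: case_prod_beta)
  then show ?thesis by (auto intro: integrable_continuous_real)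
qed

text \<open>
  The annulus is the closure of its interior, so a continuous function that vanishes almost everywhere
  vanishes identically.
\<close>

lemma annulus_integral_pos:
  fixes f :: "complex \<Rightarrow> real"
  assumes f: "continuous_on \<Omega> f" "\<And>p. p \<in> \<Omega> \<Longrightarrow> 0 \<le> f p" and p: "p \<in> \<Omega>" "f p \<noteq> 0"
  shows "0 < integral \<Omega> f"
proof (rule ccontr)
  assume np: "\<not> ?thesis"
  have fi: "f integrable_on S" if "S \<in> sets lebesgue" "S \<subseteq> \<Omega>" for S
    using set_integrable_subset[OF absolutely_integrable_continuous_compact[OF compact_annulus f(1)] that]
    by (rule set_lebesgue_integral_eq_integral)
  have zero: "f q = 0" if q: "q \<in> interior \<Omega>" for q
  proof -
    obtain a b where ab: "q \<in> box a b" "cbox a b \<subseteq> interior \<Omega>"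
      using open_contains_cbox[OF open_interior q] by metis
    have sub: "cbox a b \<subseteq> \<Omega>" using ab interior_subset by blast
    have "integral (cbox a b) f \<le> integral \<Omega> f"
      using sub compact_annulus by (intro integral_subset_le fi) (auto simp: lmeasurable_compact fmeasurableD f(2))
    moreover have "0 \<le> integral (cbox a b) f" using sub f(2) by (intro integral_nonneg fi) auto
    ultimately have "integral (cbox a b) f = 0" using np by linarith
    then have "(f has_integral 0) (cbox a b)" using fi[of "cbox a b"] sub by (simp add: has_integral_iff)
    moreover have "0 \<le> f x" if "x \<in> box a b" for x using that sub f(2) box_subset_cbox[of a b] by blast
    ultimately show ?thesis
      using has_integral_0_cbox_imp_0[OF continuous_on_subset[OF f(1) sub]] ab(1) box_subset_cbox[of a b] by blast
  qed
  obtain s t where t: "0 \<le> t" "t \<le> r s" "p = c1 s + t *\<^sub>R N s" by (rule annulus_normal_point[OF p(1)])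
  have cl: "closure {0<..<r s} = {0..r s}" using ray_length_pos[of s] by simp
  have "f (c1 s + t *\<^sub>R N s) = 0"
  proof (rule continuous_constant_on_closure[of "{0<..<r s}" "\<lambda>t. f (c1 s + t *\<^sub>R N s)"])
    show "continuous_on (closure {0<..<r s}) (\<lambda>t. f (c1 s + t *\<^sub>R N s))" unfolding cl
      by (rule continuous_on_compose2[OF f(1)]) (auto intro!: continuous_intros normal_point_in_annulus)
    show "f (c1 s + u *\<^sub>R N s) = 0" if "u \<in> {0<..<r s}" for u
      using normal_point_in_gap[of u s] gap_interior that by (intro zero) auto
  qed (use t cl in auto)
  then show False using p t by simp
qed

end

section \<open>From the leaves to the Rayleigh quotient\<close>

text \<open>
  The Cauchy-Schwarz inequality: the derivative along the leaf is controlled by the full gradient.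
\<close>

lemma norm_linear_le_basis_sum:
  fixes D :: "complex \<Rightarrow> complex"
  assumes "linear D"
  shows "(norm (D X))\<^sup>2 \<le> (norm X)\<^sup>2 * (\<Sum>e\<in>Basis. (norm (D e))\<^sup>2)"
proof -
  have B: "(\<Sum>e\<in>Basis. (norm (D e))\<^sup>2) = (norm (D 1))\<^sup>2 + (norm (D \<i>))\<^sup>2"
    by (simp add: Basis_complex_def complex_neq_i)
  have "D X = Re X *\<^sub>R D 1 + Im X *\<^sub>R D \<i>" by (rule complex_linear_expand[OF assms])
  then have "norm (D X) \<le> \<bar>Re X\<bar> * norm (D 1) + \<bar>Im X\<bar> * norm (D \<i>)"
    by (metis norm_triangle_ineq norm_scaleR)
  then have "(norm (D X))\<^sup>2 \<le> (\<bar>Re X\<bar> * norm (D 1) + \<bar>Im X\<bar> * norm (D \<i>))\<^sup>2"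
    by (intro power_mono) auto
  also have "\<dots> \<le> ((Re X)\<^sup>2 + (Im X)\<^sup>2) * ((norm (D 1))\<^sup>2 + (norm (D \<i>))\<^sup>2)"
  proof -
    have "0 \<le> (\<bar>Re X\<bar> * norm (D \<i>) - \<bar>Im X\<bar> * norm (D 1))\<^sup>2" by simp
    then show ?thesis by (simp add: power2_sum power2_diff power_mult_distrib algebra_simps)
  qed
  finally show ?thesis unfolding B cmod_power2[of X] .
qed

context convex_starlike
begin

text \<open>
  The Wirtinger inequality on the leaf, with the length element replaced by the area element at the cost
  of \<open>\<beta> m\<close> on the energy side and \<open>B\<close> on the other.
\<close>

lemma energy_inequality_on_leaf:
  assumes \<tau>: "\<tau> \<in> {0..1}"
    and U: "\<Omega> \<subseteq> U" and w: "\<And>p. p \<in> U \<Longrightarrow> (w has_derivative Dw p) (at p)" "\<And>v. continuous_on U (\<lambda>p. Dw p v)"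
    and V: "\<Omega> \<subseteq> V" and G: "\<And>p. p \<in> V \<Longrightarrow> (G has_derivative DG p) (at p)" "\<And>v. continuous_on V (\<lambda>p. DG p v)"
    and sym: "\<And>p X Y. p \<in> interior \<Omega> \<Longrightarrow> blinfun_apply (DG p X) Y = blinfun_apply (DG p Y) X"
    and D: "\<And>p X. D p X = Dw p X - \<i> * complex_of_real (blinfun_apply (G p) X) * w p"
  shows "4 * pi\<^sup>2 / (curve_length c2)\<^sup>2 * (infdist (1 / (2 * pi) * integral {0..1} (\<lambda>s. blinfun_apply (G (c1 s)) (c1' s))) \<int>)\<^sup>2
        * (min_ray c1 c2 * min_cos c1 c2 / max_ray c1 c2) * integral {0..1} (\<lambda>s. jac \<tau> s * (norm (w (leaf \<tau> s)))\<^sup>2)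
     \<le> integral {0..1} (\<lambda>s. jac \<tau> s * (\<Sum>e\<in>Basis. (norm (D (leaf \<tau> s) e))\<^sup>2))"
    (is "?C * ?q * ?I \<le> ?E")
proof -
  let ?l = "\<lambda>s. norm (leaf' \<tau> s)"
  have \<tau>1: "0 \<le> \<tau>" "\<tau> \<le> 1" using \<tau> by auto
  have leafU: "leaf \<tau> s \<in> U" "leaf \<tau> s \<in> V" for s using leaf_in_annulus[OF \<tau>1] U V by auto
  have imU: "leaf \<tau> ` S \<subseteq> U" "leaf \<tau> ` S \<subseteq> V" for S using leafU by auto
  have cw: "continuous_on U w" and cG: "continuous_on V G"
    using w(1) G(1) by (meson continuous_at_imp_continuous_on has_derivative_continuous)+
  have lin: "linear (D (leaf \<tau> s))" for s
  proof -
    have "linear (Dw (leaf \<tau> s))" using w(1)[OF leafU(1)] has_derivative_linear by blast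
    then show ?thesis
      unfolding D
    proof (intro linearI, goal_cases)
      case 1 then show ?case by (simp add: linear_add blinfun.add_right algebra_simps)
    next
      case 2 then show ?case
        by (simp add: linear_scale blinfun.scaleR_right) (simp add: scaleR_conv_of_real algebra_simps)
    qed
  qed
  have vd: "((\<lambda>s. w (leaf \<tau> s)) has_vector_derivative Dw (leaf \<tau> s) (leaf' \<tau> s)) (at s within {0..1})" for s
    by (rule has_vector_derivative_compose_has_derivative[OF has_vector_derivative_at_within[OF leaf_derivative] w(1)[OF leafU(1)]])
  have cw': "continuous_on S (\<lambda>s. w (leaf \<tau> s))" for S
    by (rule continuous_on_compose2[OF cw leaf_continuous(4) imU(1)])
  have cG': "continuous_on S (\<lambda>s. G (leaf \<tau> s))" for S
    by (rule continuous_on_compose2[OF cG leaf_continuous(4) imU(2)])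
  have cDw: "continuous_on S (\<lambda>s. Dw (leaf \<tau> s) (X s))" if "continuous_on S X" for S X
    by (rule continuous_on_directional_derivative[OF w leaf_continuous(4) that imU(1)])
  have len: "integral {0..1} ?l \<le> curve_length c2"
    unfolding foot_length[symmetric]
    by (intro integral_le integrable_continuous_real continuous_intros leaf_continuous leaf_speed_le[OF \<tau>1]
       continuous_on_subset[OF foot'_continuous]) auto
  have flux: "integral {0..1} (\<lambda>s. blinfun_apply (G (leaf \<tau> s)) (leaf' \<tau> s)) = integral {0..1} (\<lambda>s. blinfun_apply (G (c1 s)) (c1' s))"
    unfolding leaf_def leaf'_def
  proof (rule leaf_flux_constant[OF G curve_deriv[OF curve1] connector_continuous(4) connector_derivative connector_continuous(2)])
    show "c1 1 = c1 0" using curve_shift_int[OF curve1, of 0 1] by simp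
    then show "connector 1 = connector 0" by (simp add: connector_def)
    show "c1 s + t *\<^sub>R connector s \<in> V" if "t \<in> {0..1}" for s t
      using leaf_in_annulus[of t s] that V by (auto simp: leaf_def)
    show "blinfun_apply (DG (c1 s + t *\<^sub>R connector s) X) Y = blinfun_apply (DG (c1 s + t *\<^sub>R connector s) Y) X" if "t \<in> {0<..<1}" for s t X Y
      using leaf_in_gap[of t s] gap_interior that by (intro sym) (auto simp: leaf_def)
  qed (use \<tau> in auto)
  have W: "?C * integral {0..1} (\<lambda>s. (norm (w (leaf \<tau> s)))\<^sup>2 * ?l s)
      \<le> integral {0..1} (\<lambda>s. (norm (D (leaf \<tau> s) (leaf' \<tau> s)))\<^sup>2 / ?l s)"
    unfolding flux[symmetric] D
    by (rule magnetic_wirtinger[OF vd cDw _ leaf_regular[OF \<tau>1] _ _ len])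
       (intro continuous_intros leaf_continuous cG' | simp add: leaf_periodic)+
  define m where "m = min_ray c1 c2 * min_cos c1 c2"
  have m0: "0 \<le> m" unfolding m_def using ray_length_bounds(1) min_cos_bounds(1) by simp
  have C0: "0 \<le> ?C" by simp
  have B0: "0 < max_ray c1 c2" by (rule max_ray_pos)
  have cI: "continuous_on {0..1} (\<lambda>s. (norm (w (leaf \<tau> s)))\<^sup>2 * ?l s)" "continuous_on {0..1} (\<lambda>s. jac \<tau> s * (norm (w (leaf \<tau> s)))\<^sup>2)"
    by (intro continuous_intros cw' leaf_continuous)+
  have cE: "continuous_on {0..1} (\<lambda>s. jac \<tau> s * (\<Sum>e\<in>Basis. (norm (D (leaf \<tau> s) e))\<^sup>2))"
    unfolding D by (intro continuous_intros cw' leaf_continuous cDw cG')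
  have cE': "continuous_on {0..1} (\<lambda>s. (norm (D (leaf \<tau> s) (leaf' \<tau> s)))\<^sup>2 / ?l s)"
    unfolding D using leaf_regular[OF \<tau>1] by (intro continuous_intros cw' leaf_continuous cDw cG') auto
  let ?W = "integral {0..1} (\<lambda>s. (norm (w (leaf \<tau> s)))\<^sup>2 * ?l s)"
  have "?I \<le> integral {0..1} (\<lambda>s. max_ray c1 c2 * ((norm (w (leaf \<tau> s)))\<^sup>2 * ?l s))"
  proof (intro integral_le integrable_continuous_real cI continuous_on_mult_left)
    show "jac \<tau> s * (norm (w (leaf \<tau> s)))\<^sup>2 \<le> max_ray c1 c2 * ((norm (w (leaf \<tau> s)))\<^sup>2 * ?l s)" for s
      using mult_right_mono[OF jac_upper[OF \<tau>1, of s], of "(norm (w (leaf \<tau> s)))\<^sup>2"] by (simp add: mult_ac)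
  qed
  then have I: "?I \<le> max_ray c1 c2 * ?W" by simp
  have q0: "0 \<le> ?q" using ray_length_bounds(1) min_cos_bounds(1) B0 by simp
  have "?C * ?q * ?I \<le> ?C * ?q * (max_ray c1 c2 * ?W)"
    by (rule mult_left_mono[OF I mult_nonneg_nonneg[OF C0 q0]])
  also have "\<dots> = m * (?C * ?W)" using B0 by (simp add: m_def)
  also have "\<dots> \<le> m * integral {0..1} (\<lambda>s. (norm (D (leaf \<tau> s) (leaf' \<tau> s)))\<^sup>2 / ?l s)"
    by (rule mult_left_mono[OF W m0])
  also have "\<dots> = integral {0..1} (\<lambda>s. m * ((norm (D (leaf \<tau> s) (leaf' \<tau> s)))\<^sup>2 / ?l s))" by (rule integral_mult_right[symmetric])
  also have "\<dots> \<le> ?E"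
  proof (intro integral_le integrable_continuous_real cE continuous_on_mult_left cE')
    fix s :: real
    let ?S = "\<Sum>e\<in>Basis. (norm (D (leaf \<tau> s) e))\<^sup>2"
    have l: "0 < ?l s" by (rule leaf_regular[OF \<tau>1])
    have "(norm (D (leaf \<tau> s) (leaf' \<tau> s)))\<^sup>2 / ?l s \<le> (?l s)\<^sup>2 * ?S / ?l s"
      using l by (intro divide_right_mono norm_linear_le_basis_sum lin) auto
    also have "\<dots> = ?l s * ?S" using l by (simp add: power2_eq_square)
    finally have "m * ((norm (D (leaf \<tau> s) (leaf' \<tau> s)))\<^sup>2 / ?l s) \<le> m * (?l s * ?S)" using m0 by (rule mult_left_mono)
    also have "\<dots> = (m * ?l s) * ?S" by simp
    also have "\<dots> \<le> jac \<tau> s * ?S"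
      using jac_lower[OF \<tau>1] unfolding m_def by (rule mult_right_mono) (simp add: sum_nonneg)
    finally show "m * ((norm (D (leaf \<tau> s) (leaf' \<tau> s)))\<^sup>2 / ?l s) \<le> jac \<tau> s * ?S" .
  qed
  finally show ?thesis .
qed

text \<open>
  Derivatives within the closed annulus are known to agree with those of a \<open>C\<^sup>1\<close> extension only in the
  interior, but the boundary is a null set, so the energy may be computed from the continuous density
  \<open>e\<close> of the extension. The leafwise inequality is then integrated over \<open>\<tau>\<close>.
\<close>

lemma rayleigh_quotient_bound:
  assumes A: "closed_potential \<Omega> A" and u: "C1_on \<Omega> u" "p0 \<in> \<Omega>" "u p0 \<noteq> 0"
  shows "4 * pi\<^sup>2 / (curve_length c2)\<^sup>2 * (infdist (flux A c1) \<int>)\<^sup>2 * (min_ray c1 c2 * min_cos c1 c2 / max_ray c1 c2)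
      \<le> magnetic_energy \<Omega> A u / (LINT p:\<Omega>|lebesgue. (norm (u p))\<^sup>2)"
    (is "?C \<le> _")
proof -
  obtain U w where U: "open U" "\<Omega> \<subseteq> U" "Ck_open 1 w U" "\<And>p. p \<in> \<Omega> \<Longrightarrow> w p = u p"
    using u(1) unfolding C1_on_def by blast
  obtain V G where V: "open V" "\<Omega> \<subseteq> V" "\<And>k. Ck_open k G V" "\<And>p. p \<in> \<Omega> \<Longrightarrow> G p = A p"
    using A unfolding closed_potential_def smooth_on_def by blast
  define Dw where "Dw = (\<lambda>p. frechet_derivative w (at p))"
  define DG where "DG = (\<lambda>p. frechet_derivative G (at p))"
  have w: "(w has_derivative Dw p) (at p)" if "p \<in> U" for p unfolding Dw_def by (rule Ck_open_1D(1)[OF U(3) that])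
  have w': "continuous_on U (\<lambda>p. Dw p v)" for v unfolding Dw_def by (rule Ck_open_1D(2)[OF U(3)])
  have cw: "continuous_on U w" by (rule Ck_open_1D(3)[OF U(3)])
  have G: "(G has_derivative DG p) (at p)" if "p \<in> V" for p unfolding DG_def by (rule Ck_open_1D(1)[OF V(3) that])
  have G': "continuous_on V (\<lambda>p. DG p v)" for v unfolding DG_def by (rule Ck_open_1D(2)[OF V(3)])
  have cG: "continuous_on V G" by (rule Ck_open_1D(3)[OF V(3)])
  have int: "interior \<Omega> \<subseteq> \<Omega>" by (rule interior_subset)
  have du: "frechet_derivative u (at p within \<Omega>) = Dw p" if p: "p \<in> interior \<Omega>" for p
  proof -
    have "(u has_derivative Dw p) (at p)"
      by (rule has_derivative_transform_within_open[OF w open_interior p]) (use U int p in auto)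
    then show ?thesis using frechet_derivative_at at_within_interior[OF p] by metis
  qed
  have dA: "frechet_derivative A (at p within \<Omega>) = DG p" if p: "p \<in> interior \<Omega>" for p
  proof -
    have "(A has_derivative DG p) (at p)"
      by (rule has_derivative_transform_within_open[OF G open_interior p]) (use V int p in auto)
    then show ?thesis using frechet_derivative_at at_within_interior[OF p] by metis
  qed
  have sym: "blinfun_apply (DG p X) Y = blinfun_apply (DG p Y) X" if p: "p \<in> interior \<Omega>" for p X Y
    using A int p unfolding closed_potential_def dA[OF p, symmetric] by blast
  define D where "D = (\<lambda>p X. Dw p X - \<i> * complex_of_real (blinfun_apply (G p) X) * w p)"
  define e where "e = (\<lambda>p. \<Sum>b\<in>Basis. (norm (D p b))\<^sup>2)"
  define f where "f = (\<lambda>p. (norm (w p))\<^sup>2)"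
  have ce: "continuous_on \<Omega> e" unfolding e_def D_def
    by (intro continuous_intros continuous_on_subset[OF w' U(2)] continuous_on_subset[OF cG V(2)] continuous_on_subset[OF cw U(2)])
  have cf: "continuous_on \<Omega> f" unfolding f_def
    by (intro continuous_intros continuous_on_subset[OF cw U(2)])
  have E: "magnetic_energy \<Omega> A u = integral \<Omega> e"
  proof -
    let ?e = "\<lambda>p. \<Sum>b\<in>Basis. (norm (magnetic_deriv \<Omega> A u p b))\<^sup>2"
    have eq: "?e p = e p" if "p \<in> \<Omega> - (\<Omega> - interior \<Omega>)" for p
      using that U(4)[of p] V(4)[of p] du[of p] by (simp add: e_def D_def magnetic_deriv_def)
    have "?e absolutely_integrable_on \<Omega>"
      by (rule absolutely_integrable_spike[OF absolutely_integrable_continuous_compact[OF compact_annulus ce] annulus_boundary_negligible eq])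
    then have "magnetic_energy \<Omega> A u = integral \<Omega> ?e"
      unfolding magnetic_energy_def by (rule set_lebesgue_integral_eq_integral(2))
    also have "\<dots> = integral \<Omega> e"
      by (rule integral_spike[OF annulus_boundary_negligible]) (use eq in auto)
    finally show ?thesis .
  qed
  have F: "(LINT p:\<Omega>|lebesgue. (norm (u p))\<^sup>2) = integral \<Omega> f"
  proof -
    have "f absolutely_integrable_on \<Omega>" by (rule absolutely_integrable_continuous_compact[OF compact_annulus cf])
    moreover have "(norm (u p))\<^sup>2 = f p" if "p \<in> \<Omega>" for p using U(4)[OF that] by (simp add: f_def)
    ultimately have "(\<lambda>p. (norm (u p))\<^sup>2) absolutely_integrable_on \<Omega>"
      by (rule absolutely_integrable_spike[OF _ negligible_empty]) simp
    then have "(LINT p:\<Omega>|lebesgue. (norm (u p))\<^sup>2) = integral \<Omega> (\<lambda>p. (norm (u p))\<^sup>2)"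
      by (rule set_lebesgue_integral_eq_integral(2))
    also have "\<dots> = integral \<Omega> f" by (rule integral_cong) (simp add: f_def U(4))
    finally show ?thesis .
  qed
  have "flux A c1 = 1 / (2 * pi) * integral {0..1} (\<lambda>s. blinfun_apply (G (c1 s)) (c1' s))"
  proof -
    have "c1 s \<in> \<Omega>" for s using leaf_in_annulus[of 0 s] by (simp add: leaf_def)
    then show ?thesis unfolding flux_def by (simp add: V(4))
  qed
  then have leafs: "?C * integral {0..1} (\<lambda>s. jac \<tau> s * f (leaf \<tau> s)) \<le> integral {0..1} (\<lambda>s. jac \<tau> s * e (leaf \<tau> s))"
    if "\<tau> \<in> {0..1}" for \<tau>
    unfolding f_def e_def
    using energy_inequality_on_leaf[OF that U(2) w w' V(2) G G' sym, of D] by (simp add: D_def)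
  have "?C * integral \<Omega> f = integral {0..1} (\<lambda>\<tau>. ?C * integral {0..1} (\<lambda>s. jac \<tau> s * f (leaf \<tau> s)))"
    unfolding annulus_integral[OF cf] by simp
  also have "\<dots> \<le> integral {0..1} (\<lambda>\<tau>. integral {0..1} (\<lambda>s. jac \<tau> s * e (leaf \<tau> s)))"
    by (intro integral_le leaf_integral_integrable[OF ce] integrable_on_mult_right leaf_integral_integrable[OF cf] leafs)
  also have "\<dots> = integral \<Omega> e" by (rule annulus_integral[OF ce, symmetric])
  finally have "?C * integral \<Omega> f \<le> integral \<Omega> e" .
  moreover have "0 < integral \<Omega> f"
    by (rule annulus_integral_pos[OF cf _ u(2)]) (use u U in \<open>auto simp: f_def\<close>)
  ultimately show ?thesis unfolding E F by (simp add: le_divide_eq)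
qed

text \<open>
  The constant function \<open>1\<close> shows that the infimum is taken over a nonempty set.
\<close>

lemma lambda1_bound:
  assumes A: "closed_potential \<Omega> A"
  shows "4 * pi\<^sup>2 / (curve_length c2)\<^sup>2 * (min_ray c1 c2 * min_cos c1 c2 / max_ray c1 c2) * (infdist (flux A c1) \<int>)\<^sup>2
      \<le> lambda1 \<Omega> A"
  unfolding lambda1_def
proof (rule cInf_greatest)
  have "C1_on \<Omega> (\<lambda>_. 1::complex)"
    unfolding C1_on_def by (intro exI[of _ UNIV] exI[of _ "\<lambda>_. 1"]) (simp add: frechet_derivative_const)
  moreover have "c1 0 \<in> \<Omega>" using leaf_in_annulus[of 0 0] by (simp add: leaf_def)
  ultimately show "{magnetic_energy \<Omega> A u / (LINT p:\<Omega>|lebesgue. (norm (u p))\<^sup>2) | u.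
      C1_on \<Omega> u \<and> (\<exists>p\<in>\<Omega>. u p \<noteq> 0)} \<noteq> {}" by fastforce
qed (use rayleigh_quotient_bound[OF A] in \<open>auto simp: mult_ac\<close>)

end

theorem theorem2:
  fixes \<Omega> :: "complex set" and c1 c2 :: "real \<Rightarrow> complex"
    and A :: "complex \<Rightarrow> complex \<Rightarrow>\<^sub>L real"
  assumes "annulus \<Omega> c1 c2"
    and "convex_curve c1"
    and "strictly_starlike_annulus c1 c2"
    and "closed_potential \<Omega> A"
  shows "lambda1 \<Omega> A \<ge> 4 * pi\<^sup>2 / (curve_length c2)\<^sup>2
             * (min_ray c1 c2 * min_cos c1 c2 / max_ray c1 c2) * (infdist (flux A c1) \<int>)\<^sup>2
         \<and> (convex_curve c2 \<longrightarrow>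
              min_cos c1 c2 \<ge> min_ray c1 c2 / max_ray c1 c2 \<and>
              lambda1 \<Omega> A \<ge> 4 * pi\<^sup>2 / (curve_length c2)\<^sup>2
                 * ((min_ray c1 c2)\<^sup>2 / (max_ray c1 c2)\<^sup>2) * (infdist (flux A c1) \<int>)\<^sup>2)"
proof -
  interpret convex_starlike \<Omega> c1 c2 by unfold_locales (rule assms)+
  let ?b = "min_ray c1 c2" and ?B = "max_ray c1 c2" and ?m = "min_cos c1 c2"
  have bound: "4 * pi\<^sup>2 / (curve_length c2)\<^sup>2 * (?b * ?m / ?B) * (infdist (flux A c1) \<int>)\<^sup>2 \<le> lambda1 \<Omega> A"
    by (rule lambda1_bound[OF assms(4)])
  have "4 * pi\<^sup>2 / (curve_length c2)\<^sup>2 * (?b\<^sup>2 / ?B\<^sup>2) * (infdist (flux A c1) \<int>)\<^sup>2 \<le> lambda1 \<Omega> A"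
    if m: "?b / ?B \<le> ?m"
  proof -
    have "?b\<^sup>2 / ?B\<^sup>2 = (?b / ?B) * (?b / ?B)" by (simp add: power2_eq_square)
    also have "\<dots> \<le> (?b / ?B) * ?m"
      using m ray_length_bounds(1) max_ray_pos by (intro mult_left_mono) auto
    finally have "?b\<^sup>2 / ?B\<^sup>2 \<le> ?b * ?m / ?B" by simp
    then show ?thesis by (intro order_trans[OF _ bound] mult_right_mono mult_left_mono) auto
  qed
  then show ?thesis using bound min_cos_ge_ratio by blast
qed

end
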